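(* Let $G$ be a group with a nilpotent normal subgroup $N$ such that $h(N)<\infty$ and $G/N$ is finitely generated and abelian. Assume further that there is a finite subset $X$ of $G$ such that the following two properties hold: (i) $G=\langle N\cup X\rangle$. (ii) Each automorphism of $N_{\mathrm{ab}}$ that is induced by conjugation by an element of $X$ is integral. Then $G$ is locally of type $\mathrm{FP}_\infty$.
   Context: $N_{\mathrm{ab}}=N/[N,N]$. $h(N)$ is the Hirsch length: $h(N)<\infty$ if and only if $N$ has a finite series $1=N_0\lhd N_1\lhd\dots\lhd N_n=N$ with each factor cyclic or locally finite, and then $h(N)$ is the number of infinite cyclic factors in any such series. An endomorphism $\alpha$ of an abelian group is integral if there are a positive integer $m$ and integers $b_0,\dots,b_{m-1}$ such that $\alpha^m+b_{m-1}\alpha^{m-1}+\dots+b_1\alpha+b_0=0$. A group is locally of type $\mathrm{FP}_\infty$ if every finite subset of it is contained in a subgroup of type $\mathrm{FP}_\infty$ (over $\mathbb Z$). *)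

theory Defs
  imports "HOL-Algebra.Algebra" "HOL-Library.Extended_Nat"
begin

section \<open>Groups\<close>

definition finitely_generated_group :: "('a, 'b) monoid_scheme \<Rightarrow> bool" where
  "finitely_generated_group G \<longleftrightarrow>
     (\<exists>A. finite A \<and> A \<subseteq> carrier G \<and> generate G A = carrier G)"

definition locally_finite_group :: "('a, 'b) monoid_scheme \<Rightarrow> bool" where
  "locally_finite_group G \<longleftrightarrow>
     (\<forall>A. finite A \<and> A \<subseteq> carrier G \<longrightarrow> finite (generate G A))"

primrec lower_central :: "('a, 'b) monoid_scheme \<Rightarrow> nat \<Rightarrow> 'a set" where
  "lower_central G 0 = carrier G"
| "lower_central G (Suc n) =
     generate G (\<Union>h\<in>lower_central G n. \<Union>g\<in>carrier G.
       {h \<otimes>\<^bsub>G\<^esub> g \<otimes>\<^bsub>G\<^esub> inv\<^bsub>G\<^esub> h \<otimes>\<^bsub>G\<^esub> inv\<^bsub>G\<^esub> g})"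

definition nilpotent_group :: "('a, 'b) monoid_scheme \<Rightarrow> bool" where
  "nilpotent_group G \<longleftrightarrow> group G \<and> (\<exists>n. lower_central G n = {\<one>\<^bsub>G\<^esub>})"

definition abelianization :: "('a, 'b) monoid_scheme \<Rightarrow> 'a set monoid" where
  "abelianization G = G Mod derived G (carrier G)"

subsection \<open>Hirsch length\<close>

definition series_factor :: "('a, 'b) monoid_scheme \<Rightarrow> (nat \<Rightarrow> 'a set) \<Rightarrow> nat \<Rightarrow> 'a set monoid" where
  "series_factor G S i = G\<lparr>carrier := S (Suc i)\<rparr> Mod S i"

definition hirsch_series :: "('a, 'b) monoid_scheme \<Rightarrow> nat \<Rightarrow> (nat \<Rightarrow> 'a set) \<Rightarrow> bool" where
  "hirsch_series G n S \<longleftrightarrow>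
     S 0 = {\<one>\<^bsub>G\<^esub>} \<and> S n = carrier G \<and>
     (\<forall>i<n. S i \<lhd> G\<lparr>carrier := S (Suc i)\<rparr> \<and>
        (cyclic_group (series_factor G S i) \<or> locally_finite_group (series_factor G S i)))"

definition infinite_cyclic_factors ::
  "('a, 'b) monoid_scheme \<Rightarrow> nat \<Rightarrow> (nat \<Rightarrow> 'a set) \<Rightarrow> nat" where
  "infinite_cyclic_factors G n S =
     card {i. i < n \<and> cyclic_group (series_factor G S i) \<and> infinite (carrier (series_factor G S i))}"

text \<open>The description is well posed: any two such series of a group have isomorphic
  refinements, so they have the same number of infinite cyclic factors.\<close>

definition hirsch_length :: "('a, 'b) monoid_scheme \<Rightarrow> enat" where
  "hirsch_length G =
     (if \<exists>n S. hirsch_series G n S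
      then enat (THE k. \<exists>n S. hirsch_series G n S \<and> k = infinite_cyclic_factors G n S)
      else \<infinity>)"

subsection \<open>Integral endomorphisms and conjugation\<close>

text \<open>The abelian group \<open>A\<close> is written multiplicatively, so the monic
  polynomial relation in \<open>\<alpha>\<close> becomes a product of integer powers.\<close>

definition integral_endomorphism :: "('a, 'b) monoid_scheme \<Rightarrow> ('a \<Rightarrow> 'a) \<Rightarrow> bool" where
  "integral_endomorphism A \<alpha> \<longleftrightarrow>
     \<alpha> \<in> hom A A \<and>
     (\<exists>m>0. \<exists>b :: nat \<Rightarrow> int. \<forall>a\<in>carrier A.
        (\<alpha> ^^ m) a \<otimes>\<^bsub>A\<^esub> finprod A (\<lambda>i. (\<alpha> ^^ i) a [^]\<^bsub>A\<^esub> b i) {..<m} = \<one>\<^bsub>A\<^esub>)"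

text \<open>Elements of a quotient are cosets; the automorphism induced on it by conjugation
  sends the coset of \<open>n\<close> to the coset of \<open>x n x\<^sup>-\<^sup>1\<close>, which is the image
  of the coset under conjugation.\<close>

definition conj_induced :: "('a, 'b) monoid_scheme \<Rightarrow> 'a \<Rightarrow> 'a set \<Rightarrow> 'a set" where
  "conj_induced G x C = (\<lambda>n. x \<otimes>\<^bsub>G\<^esub> n \<otimes>\<^bsub>G\<^esub> inv\<^bsub>G\<^esub> x) ` C"

section \<open>Modules over a not necessarily commutative ring\<close>

text \<open>The axioms of \<^locale>\<open>module\<close>, without commutativity of the ring. As there, the
  multiplicative part of the record \<open>M\<close> is irrelevant.\<close>

locale left_module = R?: ring R + M?: abelian_group M
  for R :: "('r, 'c) ring_scheme" (structure)
    and M :: "('r, 'm, 'd) module_scheme" (structure) +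
  assumes smult_closed [simp, intro]:
      "\<lbrakk>a \<in> carrier R; x \<in> carrier M\<rbrakk> \<Longrightarrow> a \<odot>\<^bsub>M\<^esub> x \<in> carrier M"
    and smult_l_distr:
      "\<lbrakk>a \<in> carrier R; b \<in> carrier R; x \<in> carrier M\<rbrakk> \<Longrightarrow>
       (a \<oplus>\<^bsub>R\<^esub> b) \<odot>\<^bsub>M\<^esub> x = a \<odot>\<^bsub>M\<^esub> x \<oplus>\<^bsub>M\<^esub> b \<odot>\<^bsub>M\<^esub> x"
    and smult_r_distr:
      "\<lbrakk>a \<in> carrier R; x \<in> carrier M; y \<in> carrier M\<rbrakk> \<Longrightarrow>
       a \<odot>\<^bsub>M\<^esub> (x \<oplus>\<^bsub>M\<^esub> y) = a \<odot>\<^bsub>M\<^esub> x \<oplus>\<^bsub>M\<^esub> a \<odot>\<^bsub>M\<^esub> y"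
    and smult_assoc1:
      "\<lbrakk>a \<in> carrier R; b \<in> carrier R; x \<in> carrier M\<rbrakk> \<Longrightarrow>
       (a \<otimes>\<^bsub>R\<^esub> b) \<odot>\<^bsub>M\<^esub> x = a \<odot>\<^bsub>M\<^esub> (b \<odot>\<^bsub>M\<^esub> x)"
    and smult_one [simp]:
      "x \<in> carrier M \<Longrightarrow> \<one>\<^bsub>R\<^esub> \<odot>\<^bsub>M\<^esub> x = x"

definition left_module_hom ::
  "('r, 'c) ring_scheme \<Rightarrow> ('r, 'm, 'd) module_scheme \<Rightarrow> ('r, 'n, 'e) module_scheme \<Rightarrow> ('m \<Rightarrow> 'n) set"
where
  "left_module_hom R M N =
     {f \<in> carrier M \<rightarrow> carrier N.
        (\<forall>x\<in>carrier M. \<forall>y\<in>carrier M. f (x \<oplus>\<^bsub>M\<^esub> y) = f x \<oplus>\<^bsub>N\<^esub> f y) \<and>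
        (\<forall>a\<in>carrier R. \<forall>x\<in>carrier M. f (a \<odot>\<^bsub>M\<^esub> x) = a \<odot>\<^bsub>N\<^esub> f x)}"

definition finitely_generated_module ::
  "('r, 'c) ring_scheme \<Rightarrow> ('r, 'm, 'd) module_scheme \<Rightarrow> bool" where
  "finitely_generated_module R M \<longleftrightarrow>
     (\<exists>A. finite A \<and> A \<subseteq> carrier M \<and>
        (\<forall>H. submodule H R M \<and> A \<subseteq> H \<longrightarrow> H = carrier M))"

text \<open>Projectivity is the lifting property against surjections \<open>M \<rightarrow> N\<close>. A definition cannot
  quantify over types, but the types chosen here lose nothing: \<open>N = P\<close> and
  \<open>M\<close> the free module on \<open>carrier P\<close> (finitely supported functions \<open>'m \<Rightarrow> 'r\<close>) are
  among the test modules, so \<open>P\<close> is a direct summand of a free module and has the lifting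
  property against surjections of modules over arbitrary types.\<close>

definition projective_module ::
  "('r, 'c) ring_scheme \<Rightarrow> ('r, 'm, 'd) module_scheme \<Rightarrow> bool" where
  "projective_module R P \<longleftrightarrow>
     left_module R P \<and>
     (\<forall>(M :: ('r, 'm \<Rightarrow> 'r) module) (N :: ('r, 'm) module) p f.
        left_module R M \<and> left_module R N \<and>
        p \<in> left_module_hom R M N \<and> p ` carrier M = carrier N \<and>
        f \<in> left_module_hom R P N \<longrightarrow>
        (\<exists>g\<in>left_module_hom R P M. \<forall>x\<in>carrier P. p (g x) = f x))"

section \<open>The integral group ring and type \<open>FP\<^sub>\<infinity>\<close>\<close>

definition group_ring :: "('a, 'b) monoid_scheme \<Rightarrow> ('a \<Rightarrow> int) ring" where
  "group_ring G =
     \<lparr>carrier = {f. finite {g. f g \<noteq> 0} \<and> {g. f g \<noteq> 0} \<subseteq> carrier G},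
      monoid.mult = (\<lambda>f f' x. \<Sum>g | f g \<noteq> 0. \<Sum>h | f' h \<noteq> 0. if g \<otimes>\<^bsub>G\<^esub> h = x then f g * f' h else 0),
      one = (\<lambda>x. if x = \<one>\<^bsub>G\<^esub> then 1 else 0),
      ring.zero = (\<lambda>x. 0),
      add = (\<lambda>f f' x. f x + f' x)\<rparr>"

definition trivial_module :: "('a \<Rightarrow> int, int) module" where
  "trivial_module =
     \<lparr>carrier = UNIV, monoid.mult = (*), one = 1, ring.zero = 0, add = (+),
      smult = (\<lambda>f n. (\<Sum>g | f g \<noteq> 0. f g) * n)\<rparr>"

text \<open>Placing the terms of the resolution in the type \<^typ>\<open>nat \<Rightarrow> 'a \<Rightarrow> int\<close> is no
  restriction: a finitely generated projective module over the group ring is isomorphic to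
  a direct summand of a free module of finite rank, whose elements are finite sequences of
  elements of the group ring.\<close>

definition type_FP_inf :: "('a, 'b) monoid_scheme \<Rightarrow> bool" where
  "type_FP_inf G \<longleftrightarrow>
     (\<exists>(P :: nat \<Rightarrow> ('a \<Rightarrow> int, nat \<Rightarrow> 'a \<Rightarrow> int) module) d \<epsilon>.
        (\<forall>i. projective_module (group_ring G) (P i) \<and>
             finitely_generated_module (group_ring G) (P i)) \<and>
        (\<forall>i. d i \<in> left_module_hom (group_ring G) (P (Suc i)) (P i)) \<and>
        \<epsilon> \<in> left_module_hom (group_ring G) (P 0) trivial_module \<and>
        \<epsilon> ` carrier (P 0) = carrier (trivial_module :: ('a \<Rightarrow> int, int) module) \<and>
        d 0 ` carrier (P (Suc 0)) = a_kernel (P 0) (trivial_module :: ('a \<Rightarrow> int, int) module) \<epsilon> \<and>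
        (\<forall>i. d (Suc i) ` carrier (P (Suc (Suc i))) = a_kernel (P (Suc i)) (P i) (d i)))"

definition locally_FP_inf :: "('a, 'b) monoid_scheme \<Rightarrow> bool" where
  "locally_FP_inf G \<longleftrightarrow>
     (\<forall>A. finite A \<and> A \<subseteq> carrier G \<longrightarrow>
        (\<exists>H. subgroup H G \<and> A \<subseteq> H \<and> type_FP_inf (G\<lparr>carrier := H\<rparr>)))"

end

theory Submission
  imports Defs "HOL-Library.Function_Algebras"
begin

text \<open>Let \<open>N = L\<^sub>0 \<ge> L\<^sub>1 \<ge> \<dots>\<close> be the lower central series of \<open>N\<close>. By integrality, and since \<open>G / N\<close> is
  abelian, every finite subset of \<open>N\<^sub>a\<^sub>b\<close> lies in a finitely generated subgroup mapped into
  itself by conjugation with the elements of \<open>Xs\<close>; by bilinearity of commutators the same holds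
  in every \<open>L\<^sub>i / L\<^sub>i\<^sub>+\<^sub>1\<close>. Working down the series, one obtains for every finite
  \<open>D \<subseteq> N\<close> a finitely generated \<open>K \<le> N\<close> with \<open>D \<subseteq> K\<close> and \<open>x K x\<^sup>-\<^sup>1 \<subseteq> K\<close> for all \<open>x \<in> Xs\<close>.
  If \<open>K\<close> contains the commutators of elements of \<open>Xs\<close>, then the subgroup generated by \<open>K\<close>
  and \<open>Xs\<close> arises from the trivial group by finitely many steps from \<open>M\<close> to \<open>\<langle>M, x\<rangle>\<close> with
  \<open>x M x\<^sup>-\<^sup>1 \<subseteq> M\<close>. Each step preserves \<open>FP\<^sub>\<infinity>\<close>: if some positive power of \<open>x\<close> lies
  in \<open>M\<close>, then \<open>M\<close> has finite index in \<open>\<langle>M, x\<rangle>\<close>; otherwise \<open>\<langle>M, x\<rangle>\<close> is an ascending HNN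
  extension, and its action on the Bass-Serre tree resolves \<open>\<int>\<close> by two copies of the
  permutation module on the cosets of \<open>M\<close>.\<close>


section \<open>Modules over the group ring of a subgroup\<close>

text \<open>Integrality controls only the nonnegative powers of conjugation by \<open>x\<close>, so
  a finitely generated \<open>K\<close> can be arranged to satisfy x K x^-1 \<subseteq> K but not
  equality. Hence \<open>M\<close> need not be normal in the group it generates with
  \<open>x\<close>, and there is no quotient to work with. Its place is taken by the set of left
  cosets: sending hM to h x^-1 M is well defined exactly because x M x^-1 \<subseteq> M.

  Two facts about this map \<open>\<phi>\<close> carry the argument. Every element of the step has
  the form x^-k m x^n, so the iterates of any coset meet those of \<open>M\<close>; this makes the
  cokernel of the difference of the identity and \<open>\<phi>\<close> equal to \<int>. The
  difference is injective as soon as no coset is periodic. If x^n lies in \<open>M\<close> for some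
  n > 0, the sum over the orbit of \<open>M\<close> is a nonzero fixed vector and injectivity is
  lost, which forces the separate treatment by finite index.

  Both cases need resolutions over one group to be turned into resolutions over a larger one: by
  induction from \<open>M\<close> for the permutation module, and by restriction together with
  Schanuel's lemma for finite index.\<close>

definition zmul :: "int \<Rightarrow> 'v::ab_group_add \<Rightarrow> 'v" where
  "zmul k v = (\<Sum>i<nat k. v) - (\<Sum>i<nat (- k). v)"

lemma sum_const_add: "(\<Sum>i<m + n. v) = (\<Sum>i<m. v) + (\<Sum>i<n. v)"
  for m n :: nat and v :: "'v::ab_group_add"
  by (induction n) (auto simp: add.assoc)

lemma zmul_diff: "zmul (int a - int b) v = (\<Sum>i<a. v) - (\<Sum>i<b. v)"
proof (cases "a \<le> b")
  case True
  then obtain c where "b = a + c" using le_Suc_ex by blast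
  then show ?thesis by (simp add: zmul_def sum_const_add)
next
  case False
  then obtain c where "a = b + c" using le_Suc_ex nat_le_linear by blast
  then show ?thesis by (simp add: zmul_def sum_const_add)
qed

lemma zmul_add: "zmul (k + l) v = zmul k v + zmul l v"
proof -
  obtain a b where k: "k = int a - int b" by (metis int_diff_cases)
  obtain c d where l: "l = int c - int d" by (metis int_diff_cases)
  have "k + l = int (a + c) - int (b + d)" by (simp add: k l)
  then have "zmul (k + l) v = (\<Sum>i<a + c. v) - (\<Sum>i<b + d. v)" by (simp only: zmul_diff)
  then show ?thesis by (simp add: sum_const_add k l zmul_diff)
qed

lemma zmul_0 [simp]: "zmul 0 v = 0" and zmul_1 [simp]: "zmul 1 v = v"
  by (simp_all add: zmul_def)

lemma zmul_minus: "zmul (- k) v = - zmul k v"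
  by (simp add: zmul_def)

lemma zmul_int [simp]: "zmul k (n::int) = k * n"
  by (cases "k \<ge> 0") (simp_all add: zmul_def)

lemma sum_fun_apply: "(\<Sum>i\<in>S. f i) x = (\<Sum>i\<in>S. f i x)"
  by (induction S rule: infinite_finite_induct) auto

lemma zmul_fun_apply: "zmul k f x = zmul k (f x)"
  by (simp add: zmul_def sum_fun_apply)

section \<open>Additive subgroups and maps additive on them\<close>

definition add_subgroup :: "'v::ab_group_add set \<Rightarrow> bool" where
  "add_subgroup A \<longleftrightarrow> 0 \<in> A \<and> (\<forall>u\<in>A. \<forall>v\<in>A. u - v \<in> A)"

lemma add_subgroupD:
  assumes "add_subgroup A"
  shows "0 \<in> A" "u \<in> A \<Longrightarrow> v \<in> A \<Longrightarrow> u - v \<in> A" "v \<in> A \<Longrightarrow> - v \<in> A"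
    "u \<in> A \<Longrightarrow> v \<in> A \<Longrightarrow> u + v \<in> A"
proof -
  show 0: "0 \<in> A" and d: "\<And>u v. u \<in> A \<Longrightarrow> v \<in> A \<Longrightarrow> u - v \<in> A"
    using assms by (auto simp: add_subgroup_def)
  show m: "\<And>v. v \<in> A \<Longrightarrow> - v \<in> A" using 0 d by fastforce
  show "u \<in> A \<Longrightarrow> v \<in> A \<Longrightarrow> u + v \<in> A" using d m by fastforce
qed

lemma add_subgroup_sum:
  assumes "add_subgroup A" "\<And>i. i \<in> S \<Longrightarrow> f i \<in> A"
  shows "(\<Sum>i\<in>S. f i) \<in> A"
  using assms(2) by (induction S rule: infinite_finite_induct) (auto intro: add_subgroupD[OF assms(1)])

lemma add_subgroup_zmul:
  assumes "add_subgroup A" "v \<in> A" shows "zmul k v \<in> A"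
  unfolding zmul_def using assms by (intro add_subgroupD[OF assms(1)] add_subgroup_sum) auto

definition additive_on :: "'v::ab_group_add set \<Rightarrow> ('v \<Rightarrow> 'w::ab_group_add) \<Rightarrow> bool" where
  "additive_on A f \<longleftrightarrow> (\<forall>u\<in>A. \<forall>v\<in>A. f (u + v) = f u + f v)"

lemma additive_onD:
  assumes "additive_on A f" "add_subgroup A"
  shows "u \<in> A \<Longrightarrow> v \<in> A \<Longrightarrow> f (u + v) = f u + f v" "f 0 = 0"
    "v \<in> A \<Longrightarrow> f (- v) = - f v" "u \<in> A \<Longrightarrow> v \<in> A \<Longrightarrow> f (u - v) = f u - f v"
proof -
  show p: "\<And>u v. u \<in> A \<Longrightarrow> v \<in> A \<Longrightarrow> f (u + v) = f u + f v"
    using assms by (auto simp: additive_on_def)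
  show z: "f 0 = 0" using p[of 0 0] add_subgroupD(1)[OF assms(2)] by simp
  show m: "f (- v) = - f v" if "v \<in> A" for v
    using p[of v "- v"] z add_subgroupD(3)[OF assms(2) that] that
    by (simp add: minus_unique)
  show "f (u - v) = f u - f v" if "u \<in> A" "v \<in> A"
    using p[of u "- v"] m[of v] add_subgroupD(3)[OF assms(2)] that by simp
qed

lemma additive_on_sum:
  assumes "additive_on A f" "add_subgroup A" "\<And>i. i \<in> S \<Longrightarrow> h i \<in> A"
  shows "f (\<Sum>i\<in>S. h i) = (\<Sum>i\<in>S. f (h i))"
  using assms(3)
proof (induction S rule: infinite_finite_induct)
  case (insert x S)
  have "(\<Sum>i\<in>S. h i) \<in> A" using insert by (intro add_subgroup_sum[OF assms(2)]) auto
  moreover have "h x \<in> A" using insert.prems by blast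
  ultimately have "f (h x + (\<Sum>i\<in>S. h i)) = f (h x) + f (\<Sum>i\<in>S. h i)"
    by (intro additive_onD(1)[OF assms(1,2)])
  moreover have "f (\<Sum>i\<in>S. h i) = (\<Sum>i\<in>S. f (h i))" using insert.IH insert.prems by blast
  ultimately show ?case using insert.hyps by simp
qed (simp_all add: additive_onD(2)[OF assms(1,2)])

lemma additive_on_zmul:
  assumes "additive_on A f" "add_subgroup A" "v \<in> A"
  shows "f (zmul k v) = zmul k (f v)"
  unfolding zmul_def
  by (subst additive_onD(4)[OF assms(1,2)])
    (use assms in \<open>auto simp: additive_on_sum[OF assms(1,2)] intro: add_subgroup_sum[OF assms(2)]\<close>)

abbreviation ker_on :: "'v set \<Rightarrow> ('v \<Rightarrow> 'w::zero) \<Rightarrow> 'v set" where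
  "ker_on A f \<equiv> {v\<in>A. f v = 0}"

section \<open>Group actions on subsets of an additive type, and equivariant maps\<close>

context group
begin

text \<open>A module is a subset of an additive type with an action constrained only on that subset,
  so that submodules keep both the type and the action.\<close>

definition gmod :: "'a set \<Rightarrow> ('a \<Rightarrow> 'v \<Rightarrow> 'v::ab_group_add) \<Rightarrow> 'v set \<Rightarrow> bool" where
  "gmod H \<rho> A \<longleftrightarrow> add_subgroup A \<and>
     (\<forall>h\<in>H. additive_on A (\<rho> h) \<and> \<rho> h ` A \<subseteq> A) \<and> (\<forall>v\<in>A. \<rho> \<one> v = v) \<and>
     (\<forall>g\<in>H. \<forall>h\<in>H. \<forall>v\<in>A. \<rho> (g \<otimes> h) v = \<rho> g (\<rho> h v))"

definition ghom :: "'a set \<Rightarrow> ('a \<Rightarrow> 'v \<Rightarrow> 'v::ab_group_add) \<Rightarrow> 'v set \<Rightarrow>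
    ('a \<Rightarrow> 'w \<Rightarrow> 'w::ab_group_add) \<Rightarrow> ('v \<Rightarrow> 'w) \<Rightarrow> bool" where
  "ghom H \<rho> A \<sigma> f \<longleftrightarrow> additive_on A f \<and> (\<forall>h\<in>H. \<forall>v\<in>A. f (\<rho> h v) = \<sigma> h (f v))"

lemma gmodD:
  assumes "gmod H \<rho> A"
  shows "add_subgroup A" "h \<in> H \<Longrightarrow> additive_on A (\<rho> h)" "h \<in> H \<Longrightarrow> v \<in> A \<Longrightarrow> \<rho> h v \<in> A"
    "v \<in> A \<Longrightarrow> \<rho> \<one> v = v" "g \<in> H \<Longrightarrow> h \<in> H \<Longrightarrow> v \<in> A \<Longrightarrow> \<rho> (g \<otimes> h) v = \<rho> g (\<rho> h v)"
  using assms unfolding gmod_def by blast+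

lemma ghomD:
  assumes "ghom H \<rho> A \<sigma> f"
  shows "additive_on A f" "h \<in> H \<Longrightarrow> v \<in> A \<Longrightarrow> f (\<rho> h v) = \<sigma> h (f v)"
  using assms unfolding ghom_def by blast+

lemma ghom_image_gmod:
  assumes f: "ghom H \<rho> A \<sigma> f" and A: "gmod H \<rho> A" and H: "subgroup H G"
  shows "gmod H \<sigma> (f ` A)"
proof -
  note fD = additive_onD[OF ghomD(1)[OF f] gmodD(1)[OF A]]
  note AD = add_subgroupD[OF gmodD(1)[OF A]]
  have 1: "add_subgroup (f ` A)"
    unfolding add_subgroup_def
  proof (intro conjI ballI)
    show "0 \<in> f ` A" using fD(2) AD(1) by (metis imageI)
    fix u v assume "u \<in> f ` A" "v \<in> f ` A"
    then obtain u' v' where "u' \<in> A" "v' \<in> A" "u = f u'" "v = f v'" by auto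
    then show "u - v \<in> f ` A" using fD(4)[of u' v'] AD(2)[of u' v'] by (metis imageI)
  qed
  have 2: "additive_on (f ` A) (\<sigma> h)" if "h \<in> H" for h
  proof (unfold additive_on_def, safe)
    fix u v assume uv: "u \<in> A" "v \<in> A"
    have "\<sigma> h (f u + f v) = f (\<rho> h (u + v))"
      using that uv by (simp add: fD ghomD(2)[OF f] AD)
    also have "\<dots> = f (\<rho> h u + \<rho> h v)"
      using gmodD(2)[OF A that] uv by (simp add: additive_on_def)
    also have "\<dots> = \<sigma> h (f u) + \<sigma> h (f v)"
      using that uv by (simp add: fD ghomD(2)[OF f] gmodD(3)[OF A])
    finally show "\<sigma> h (f u + f v) = \<sigma> h (f u) + \<sigma> h (f v)" .
  qed
  have 3: "\<sigma> h (f v) \<in> f ` A" if "h \<in> H" "v \<in> A" for h v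
    using that ghomD(2)[OF f, symmetric] gmodD(3)[OF A] by auto
  have 4: "\<sigma> \<one> (f v) = f v" if "v \<in> A" for v
    using ghomD(2)[OF f, of \<one> v] gmodD(4)[OF A that] that subgroup.one_closed[OF H] by simp
  have 5: "\<sigma> (g \<otimes> h) (f v) = \<sigma> g (\<sigma> h (f v))" if "g \<in> H" "h \<in> H" "v \<in> A" for g h v
    using that ghomD(2)[OF f] gmodD(3,5)[OF A] subgroup.m_closed[OF H] by metis
  show ?thesis unfolding gmod_def using 1 2 3 4 5 by auto
qed

lemma gmod_subset:
  assumes "gmod H \<rho> A" "B \<subseteq> A" "add_subgroup B" "\<And>h v. h \<in> H \<Longrightarrow> v \<in> B \<Longrightarrow> \<rho> h v \<in> B"
  shows "gmod H \<rho> B"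
  using assms unfolding gmod_def additive_on_def by blast

lemma ghom_subset: "ghom H \<rho> A \<sigma> f \<Longrightarrow> B \<subseteq> A \<Longrightarrow> ghom H \<rho> B \<sigma> f"
  unfolding ghom_def additive_on_def by blast

lemma ghom_mono: "ghom H \<rho> A \<sigma> f \<Longrightarrow> M \<subseteq> H \<Longrightarrow> ghom M \<rho> A \<sigma> f"
  unfolding ghom_def by blast

lemma ghom_comp:
  assumes "ghom H \<rho> A \<sigma> f" "ghom H \<sigma> B \<tau> k" "f ` A \<subseteq> B"
  shows "ghom H \<rho> A \<tau> (k \<circ> f)"
  using assms unfolding ghom_def additive_on_def by (auto simp: image_subset_iff)

lemma ghom_kernel_gmod:
  assumes f: "ghom H \<rho> A \<sigma> f" and A: "gmod H \<rho> A" and H: "subgroup H G"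
  shows "gmod H \<rho> (ker_on A f)"
proof (rule gmod_subset[OF A])
  note fD = additive_onD[OF ghomD(1)[OF f] gmodD(1)[OF A]]
  note AD = add_subgroupD[OF gmodD(1)[OF A]]
  show "add_subgroup (ker_on A f)"
    unfolding add_subgroup_def using fD AD by auto
  fix h v assume h: "h \<in> H" and v: "v \<in> ker_on A f"
  have "f (\<rho> h v) = \<sigma> h 0" using h v ghomD(2)[OF f] by auto
  \<comment> \<open>Nothing is known about \<sigma> away from the image, so its value at 0 is read
    off from the module structure of the image.\<close>
  also have "\<dots> = 0"
  proof -
    have "gmod H \<sigma> (f ` A)" by (rule ghom_image_gmod[OF f A H])
    then show ?thesis using additive_onD(2) gmodD(1,2) h by blast
  qed
  finally show "\<rho> h v \<in> ker_on A f" using v gmodD(3)[OF A h] by auto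
qed auto

text \<open>Vectors with entries in the group ring; \<open>act g\<close> is left translation by \<open>g\<close>. It fixes the
  coordinates outside \<open>carrier G\<close>, so that \<open>G\<close> acts on the whole type.\<close>

definition act :: "'a \<Rightarrow> (nat \<Rightarrow> 'a \<Rightarrow> int) \<Rightarrow> nat \<Rightarrow> 'a \<Rightarrow> int" where
  "act g v = (\<lambda>i x. if x \<in> carrier G then v i (inv g \<otimes> x) else v i x)"

definition supp :: "(nat \<Rightarrow> 'a \<Rightarrow> int) \<Rightarrow> (nat \<times> 'a) set" where
  "supp v = {(i, g). v i g \<noteq> 0}"

definition freeM :: "'a set \<Rightarrow> nat \<Rightarrow> (nat \<Rightarrow> 'a \<Rightarrow> int) set" where
  "freeM H r = {v. finite (supp v) \<and> supp v \<subseteq> {..<r} \<times> H}"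

definition bas :: "nat \<Rightarrow> nat \<Rightarrow> 'a \<Rightarrow> int" where
  "bas i = (\<lambda>j x. if j = i \<and> x = \<one> then 1 else 0)"

text \<open>The homomorphism prescribed by sending \<open>bas i\<close> to \<open>b i\<close>, that
  is, the universal property of a free module over the group ring.\<close>

definition ext :: "('a \<Rightarrow> 'v \<Rightarrow> 'v::ab_group_add) \<Rightarrow> (nat \<Rightarrow> 'v) \<Rightarrow> (nat \<Rightarrow> 'a \<Rightarrow> int) \<Rightarrow> 'v" where
  "ext \<rho> b v = (\<Sum>(i, g)\<in>supp v. zmul (v i g) (\<rho> g (b i)))"

lemma gmod_act_UNIV:
  assumes "H \<subseteq> carrier G" shows "gmod H act UNIV"
proof -
  have "act (g \<otimes> h) v = act g (act h v)" if "g \<in> H" "h \<in> H" for g h v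
    using that assms unfolding act_def
    by (intro ext) (auto simp: inv_mult_group m_assoc subset_iff)
  then show ?thesis
    unfolding gmod_def add_subgroup_def additive_on_def act_def
    by (auto simp: fun_eq_iff)
qed

lemma supp_act:
  assumes "supp v \<subseteq> UNIV \<times> carrier G" "g \<in> carrier G"
  shows "supp (act g v) = (\<lambda>(i, x). (i, g \<otimes> x)) ` supp v"
proof (intro equalityI subsetI)
  fix p assume p: "p \<in> supp (act g v)"
  obtain i x where [simp]: "p = (i, x)" by (cases p)
  have "x \<in> carrier G" and n: "v i (inv g \<otimes> x) \<noteq> 0"
    using p assms by (auto simp: supp_def act_def split: if_splits)
  then have "x = g \<otimes> (inv g \<otimes> x)" using assms(2) by (simp add: m_assoc[symmetric])
  then show "p \<in> (\<lambda>(i, x). (i, g \<otimes> x)) ` supp v"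
    using n by (auto simp: supp_def intro!: rev_image_eqI[of "(i, inv g \<otimes> x)"])
next
  fix p assume "p \<in> (\<lambda>(i, x). (i, g \<otimes> x)) ` supp v"
  then obtain i x where p: "p = (i, g \<otimes> x)" "v i x \<noteq> 0" "x \<in> carrier G"
    using assms by (auto simp: supp_def)
  have "inv g \<otimes> (g \<otimes> x) = x" using p assms by (simp add: m_assoc[symmetric])
  then show "p \<in> supp (act g v)" using p assms by (simp add: supp_def act_def)
qed

lemma supp_minus: "supp (u - v) \<subseteq> supp u \<union> supp v"
  and supp_plus: "supp (u + v) \<subseteq> supp u \<union> supp v"
  by (auto simp: supp_def)

lemma freeM_add_subgroup: "add_subgroup (freeM H r)"
proof -
  have "u - v \<in> freeM H r" if "u \<in> freeM H r" "v \<in> freeM H r" for u v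
    using that supp_minus[of u v] finite_subset[OF supp_minus[of u v]]
    by (auto simp: freeM_def)
  moreover have "supp 0 = {}" by (simp add: supp_def)
  ultimately show ?thesis by (auto simp: add_subgroup_def freeM_def)
qed

text \<open>\<open>K\<close> need not be a subgroup: later it is a finite union of right cosets of
  \<open>M\<close>, which is how a free module over a larger group is restricted to
  \<open>M\<close>.\<close>

lemma freeM_gmod_stable:
  assumes M: "M \<subseteq> carrier G" and K: "K \<subseteq> carrier G" "\<And>m k. m \<in> M \<Longrightarrow> k \<in> K \<Longrightarrow> m \<otimes> k \<in> K"
  shows "gmod M act (freeM K r)"
proof (rule gmod_subset[OF gmod_act_UNIV[OF M]])
  fix h v assume h: "h \<in> M" and v: "v \<in> freeM K r"
  have "supp (act h v) = (\<lambda>(i, x). (i, h \<otimes> x)) ` supp v"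
    using v h M K(1) by (intro supp_act) (auto simp: freeM_def)
  then show "act h v \<in> freeM K r" using v K(2)[OF h] by (auto simp: freeM_def)
qed (auto simp: freeM_add_subgroup)

lemma freeM_gmod: "subgroup H G \<Longrightarrow> gmod H act (freeM H r)"
  by (intro freeM_gmod_stable subgroup.subset subgroup.m_closed)

lemma supp_bas: "supp (bas i) = {(i, \<one>)}"
  by (auto simp: supp_def bas_def)

lemma bas_freeM: "subgroup H G \<Longrightarrow> i < r \<Longrightarrow> bas i \<in> freeM H r"
  using subgroup.one_closed by (auto simp: freeM_def supp_bas)

lemma freeM_mono: "H \<subseteq> K \<Longrightarrow> r \<le> s \<Longrightarrow> freeM H r \<subseteq> freeM K s"
  by (auto simp: freeM_def)

lemma ext_superset:
  assumes "finite S" "supp v \<subseteq> S"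
  shows "ext \<rho> b v = (\<Sum>(i, g)\<in>S. zmul (v i g) (\<rho> g (b i)))"
  unfolding ext_def using assms
  by (intro sum.mono_neutral_left) (auto simp: supp_def)

lemma ext_in:
  assumes A: "gmod H \<rho> A" and b: "\<And>i. i < r \<Longrightarrow> b i \<in> A" and v: "v \<in> freeM H r"
  shows "ext \<rho> b v \<in> A"
  unfolding ext_def
proof (rule add_subgroup_sum[OF gmodD(1)[OF A]], clarify)
  fix i g assume "(i, g) \<in> supp v"
  then have "i < r" "g \<in> H" using v by (auto simp: freeM_def)
  then show "zmul (v i g) (\<rho> g (b i)) \<in> A"
    using gmodD[OF A] b by (intro add_subgroup_zmul) auto
qed

lemma ext_ghom:
  assumes H: "subgroup H G" and A: "gmod H \<rho> A" and b: "\<And>i. i < r \<Longrightarrow> b i \<in> A"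
  shows "ghom H act (freeM H r) \<rho> (ext \<rho> b)"
  unfolding ghom_def additive_on_def
proof (intro conjI ballI)
  fix u v assume u: "u \<in> freeM H r" and v: "v \<in> freeM H r"
  let ?S = "supp u \<union> supp v"
  have f: "finite ?S" using u v by (auto simp: freeM_def)
  show "ext \<rho> b (u + v) = ext \<rho> b u + ext \<rho> b v"
    using ext_superset[OF f, of _ \<rho> b] supp_plus[of u v]
    by (simp add: zmul_add sum.distrib case_prod_beta)
next
  fix h v assume h: "h \<in> H" and v: "v \<in> freeM H r"
  have hc: "h \<in> carrier G" using h subgroup.subset[OF H] by auto
  have sc: "supp v \<subseteq> {..<r} \<times> carrier G" using v subgroup.subset[OF H] by (auto simp: freeM_def)
  have s: "supp (act h v) = (\<lambda>(i, x). (i, h \<otimes> x)) ` supp v"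
    using sc hc by (intro supp_act) auto
  have inj: "inj_on (\<lambda>(i, x). (i, h \<otimes> x)) (supp v)"
    using sc hc by (auto simp: inj_on_def) (metis SigmaD2 l_cancel subsetD)
  have "ext \<rho> b (act h v) = (\<Sum>(i, g)\<in>supp v. zmul (act h v i (h \<otimes> g)) (\<rho> (h \<otimes> g) (b i)))"
    unfolding ext_def s by (subst sum.reindex[OF inj]) (simp add: case_prod_beta o_def)
  also have "\<dots> = (\<Sum>(i, g)\<in>supp v. \<rho> h (zmul (v i g) (\<rho> g (b i))))"
  proof (intro sum.cong refl, clarify)
    fix i g assume ig: "(i, g) \<in> supp v"
    have g: "g \<in> H" "i < r" using ig v by (auto simp: freeM_def)
    have gc: "g \<in> carrier G" using g subgroup.subset[OF H] by auto
    have "inv h \<otimes> (h \<otimes> g) = g" using gc hc by (simp add: m_assoc[symmetric])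
    then have "act h v i (h \<otimes> g) = v i g" using gc hc by (simp add: act_def)
    then show "zmul (act h v i (h \<otimes> g)) (\<rho> (h \<otimes> g) (b i)) = \<rho> h (zmul (v i g) (\<rho> g (b i)))"
      using g h b gmodD[OF A] additive_on_zmul[OF gmodD(2)[OF A h] gmodD(1)[OF A]] by simp
  qed
  also have "\<dots> = \<rho> h (ext \<rho> b v)"
    unfolding ext_def case_prod_beta
  proof (rule additive_on_sum[symmetric, OF gmodD(2)[OF A h] gmodD(1)[OF A]])
    fix p assume "p \<in> supp v"
    then have "fst p < r" "snd p \<in> H" using v by (auto simp: freeM_def)
    then show "zmul (v (fst p) (snd p)) (\<rho> (snd p) (b (fst p))) \<in> A"
      using gmodD[OF A] b by (intro add_subgroup_zmul) auto
  qed
  finally show "ext \<rho> b (act h v) = \<rho> h (ext \<rho> b v)" .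
qed

lemma act_bas:
  assumes "g \<in> carrier G" shows "act g (bas i) j x = (if j = i \<and> x = g then 1 else 0)"
proof (cases "x \<in> carrier G")
  case True
  then have "inv g \<otimes> x = \<one> \<longleftrightarrow> x = g"
    using assms by (metis inv_closed inv_inv inv_equality r_inv)
  then show ?thesis using True by (auto simp: act_def bas_def)
next
  case False
  then show ?thesis using assms by (auto simp: act_def bas_def)
qed

lemma ext_bas_id:
  assumes "finite (supp v)" "supp v \<subseteq> UNIV \<times> carrier G"
  shows "ext act bas v = v"
proof (intro HOL.ext)
  fix j x
  have "ext act bas v j x = (\<Sum>p\<in>supp v. zmul (v (fst p) (snd p)) (act (snd p) (bas (fst p)) j x))"
    unfolding ext_def case_prod_beta by (simp add: sum_fun_apply zmul_fun_apply)
  also have "\<dots> = (\<Sum>p\<in>supp v. if (j, x) = p then v j x else 0)"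
  proof (rule sum.cong)
    fix p assume "p \<in> supp v"
    then have "snd p \<in> carrier G" using assms by auto
    then show "zmul (v (fst p) (snd p)) (act (snd p) (bas (fst p)) j x) =
        (if (j, x) = p then v j x else 0)"
      by (cases p) (auto simp: act_bas)
  qed simp
  also have "\<dots> = v j x"
    using assms(1) by (simp add: supp_def)
  finally show "ext act bas v j x = v j x" .
qed

text \<open>The translates \<open>act g (bas i)\<close> form a \<int>-basis. Only additivity is
  asked of the two maps, because coefficients and slices, to which this is applied, are not
  equivariant.\<close>

lemma additive_cong_free:
  assumes H: "subgroup H G" and f: "additive_on (freeM H r) f" and k: "additive_on (freeM H r) k"
    and eq: "\<And>g i. g \<in> H \<Longrightarrow> i < r \<Longrightarrow> f (act g (bas i)) = k (act g (bas i))" and v: "v \<in> freeM H r"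
  shows "f v = k v"
proof -
  have m: "act (snd p) (bas (fst p)) \<in> freeM H r" and e: "f (act (snd p) (bas (fst p))) = k (act (snd p) (bas (fst p)))"
    if "p \<in> supp v" for p
  proof -
    have "snd p \<in> H" "fst p < r" using that v by (auto simp: freeM_def)
    then show "act (snd p) (bas (fst p)) \<in> freeM H r" "f (act (snd p) (bas (fst p))) = k (act (snd p) (bas (fst p)))"
      using bas_freeM[OF H] gmodD(3)[OF freeM_gmod[OF H]] eq by simp_all
  qed
  have v': "v = (\<Sum>p\<in>supp v. zmul (v (fst p) (snd p)) (act (snd p) (bas (fst p))))"
  proof -
    have "ext act bas v = v"
      using v subgroup.subset[OF H] by (intro ext_bas_id) (auto simp: freeM_def)
    then show ?thesis unfolding ext_def case_prod_beta by simp
  qed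
  have "l v = (\<Sum>p\<in>supp v. zmul (v (fst p) (snd p)) (l (act (snd p) (bas (fst p)))))"
    if l: "additive_on (freeM H r) l" for l :: "(nat \<Rightarrow> 'a \<Rightarrow> int) \<Rightarrow> 'c"
  proof -
    have "l v = l (\<Sum>p\<in>supp v. zmul (v (fst p) (snd p)) (act (snd p) (bas (fst p))))"
      using v' by simp
    also have "\<dots> = (\<Sum>p\<in>supp v. l (zmul (v (fst p) (snd p)) (act (snd p) (bas (fst p)))))"
      by (rule additive_on_sum[OF l freeM_add_subgroup]) (intro add_subgroup_zmul[OF freeM_add_subgroup] m)
    also have "\<dots> = (\<Sum>p\<in>supp v. zmul (v (fst p) (snd p)) (l (act (snd p) (bas (fst p)))))"
      by (intro sum.cong refl additive_on_zmul[OF l freeM_add_subgroup] m)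
    finally show ?thesis .
  qed
  from this[OF f] this[OF k] show ?thesis using e by simp
qed

lemma ext_bas:
  assumes "gmod H \<rho> A" "b i \<in> A" shows "ext \<rho> b (bas i) = b i"
  using assms gmodD(4) by (simp add: ext_def supp_bas) (simp add: bas_def)

lemma ghom_cong_bas:
  assumes H: "subgroup H G" and f: "ghom H act (freeM H r) \<rho> f" and k: "ghom H act (freeM H r) \<rho> k"
    and eq: "\<And>i. i < r \<Longrightarrow> f (bas i) = k (bas i)" and v: "v \<in> freeM H r"
  shows "f v = k v"
proof (rule additive_cong_free[OF H ghomD(1)[OF f] ghomD(1)[OF k] _ v])
  fix g i assume "g \<in> H" "i < r"
  then show "f (act g (bas i)) = k (act g (bas i))"
    using ghomD(2)[OF f] ghomD(2)[OF k] bas_freeM[OF H] eq by simp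
qed

text \<open>Projectivity of free modules: preimages are chosen for the images of the basis and
  extended.\<close>

lemma freeM_lift:
  assumes H: "subgroup H G" and c: "ghom H act (freeM H r) \<sigma> c"
    and E: "gmod H \<rho> E" and p: "ghom H \<rho> E \<sigma> p" and cp: "c ` freeM H r \<subseteq> p ` E"
  obtains c' where "ghom H act (freeM H r) \<rho> c'" "c' ` freeM H r \<subseteq> E"
    "\<And>v. v \<in> freeM H r \<Longrightarrow> p (c' v) = c v"
proof -
  have "\<forall>i. \<exists>e. i < r \<longrightarrow> e \<in> E \<and> p e = c (bas i)"
    using cp bas_freeM[OF H] by (metis (no_types, lifting) image_iff image_subset_iff)
  then obtain e where e: "\<And>i. i < r \<Longrightarrow> e i \<in> E" "\<And>i. i < r \<Longrightarrow> p (e i) = c (bas i)" by metis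
  have g: "ghom H act (freeM H r) \<rho> (ext \<rho> e)" by (rule ext_ghom[OF H E e(1)])
  have i: "ext \<rho> e ` freeM H r \<subseteq> E" using ext_in[OF E e(1)] by auto
  have "p (ext \<rho> e v) = c v" if "v \<in> freeM H r" for v
    using ghom_cong_bas[OF H ghom_comp[OF g p i] c _ that] e ext_bas[OF E] by simp
  then show ?thesis using that g i by blast
qed

end

section \<open>Modules with a resolution by finitely generated free modules\<close>

context group
begin

text \<open>Having a resolution by finitely generated free modules, as a greatest fixed point: the
  module is the image of such a module with a kernel of the same kind. \<open>FPU\<close> is the version for
  submodules of vectors, where these kernels live; \<open>FP\<close> allows modules over any type.\<close>

definition FPU :: "'a set \<Rightarrow> (nat \<Rightarrow> 'a \<Rightarrow> int) set \<Rightarrow> bool" where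
  "FPU H A \<longleftrightarrow> (\<exists>\<C>. A \<in> \<C> \<and> (\<forall>B\<in>\<C>. \<exists>r f. ghom H act (freeM H r) act f \<and>
     f ` freeM H r = B \<and> ker_on (freeM H r) f \<in> \<C>))"

definition FP :: "'a set \<Rightarrow> ('a \<Rightarrow> 'v \<Rightarrow> 'v::ab_group_add) \<Rightarrow> 'v set \<Rightarrow> bool" where
  "FP H \<rho> A \<longleftrightarrow> (\<exists>r f. ghom H act (freeM H r) \<rho> f \<and> f ` freeM H r = A \<and>
     FPU H (ker_on (freeM H r) f))"

text \<open>One unfolding of the fixed point; for the converse, \<open>A\<close> is added to a
  family that witnesses the claim for the kernel of its cover.\<close>

lemma FPU_iff_FP: "FPU H A \<longleftrightarrow> FP H act A"
proof
  assume "FPU H A"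
  then obtain \<C> where "A \<in> \<C>" and \<C>: "\<forall>B\<in>\<C>. \<exists>r f. ghom H act (freeM H r) act f \<and>
     f ` freeM H r = B \<and> ker_on (freeM H r) f \<in> \<C>" unfolding FPU_def by blast
  then obtain r f where "ghom H act (freeM H r) act f" "f ` freeM H r = A"
    and k: "ker_on (freeM H r) f \<in> \<C>" by blast
  moreover have "FPU H (ker_on (freeM H r) f)"
    unfolding FPU_def using k \<C> by blast
  ultimately show "FP H act A" unfolding FP_def by blast
next
  assume "FP H act A"
  then obtain r f where rf: "ghom H act (freeM H r) act f" "f ` freeM H r = A"
    and "FPU H (ker_on (freeM H r) f)" unfolding FP_def by blast
  then obtain \<C> where k: "ker_on (freeM H r) f \<in> \<C>" and \<C>: "\<forall>B\<in>\<C>. \<exists>r f. ghom H act (freeM H r) act f \<and>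
     f ` freeM H r = B \<and> ker_on (freeM H r) f \<in> \<C>" unfolding FPU_def by blast
  show "FPU H A" unfolding FPU_def
  proof (intro exI[of _ "insert A \<C>"] conjI ballI)
    fix B assume "B \<in> insert A \<C>"
    then show "\<exists>r f. ghom H act (freeM H r) act f \<and>
     f ` freeM H r = B \<and> ker_on (freeM H r) f \<in> insert A \<C>"
    proof
      assume "B = A"
      then show ?thesis using rf k by blast
    next
      assume "B \<in> \<C>"
      then show ?thesis using \<C> by blast
    qed
  qed simp
qed

lemma FPU_coinduct:
  assumes "A \<in> \<C>"
    and step: "\<And>B. B \<in> \<C> \<Longrightarrow> \<exists>r f. ghom H act (freeM H r) act f \<and> f ` freeM H r = B \<and>
      ker_on (freeM H r) f \<in> \<C>"
  shows "FPU H A"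
  unfolding FPU_def using assms by blast

lemma FP_gmod:
  assumes "subgroup H G" "FP H \<rho> A" shows "gmod H \<rho> A"
  using assms ghom_image_gmod[OF _ freeM_gmod] unfolding FP_def by blast

lemma ghom_add:
  assumes f: "ghom H \<rho> A \<sigma> f" and k: "ghom H \<rho> A \<sigma> k" and E: "gmod H \<sigma> E"
    and "f ` A \<subseteq> E" "k ` A \<subseteq> E"
  shows "ghom H \<rho> A \<sigma> (\<lambda>v. f v + k v)"
  unfolding ghom_def additive_on_def
proof (intro conjI ballI)
  show "f (u + v) + k (u + v) = f u + k u + (f v + k v)" if "u \<in> A" "v \<in> A" for u v
    using that f k by (simp add: ghom_def additive_on_def)
  show "f (\<rho> h v) + k (\<rho> h v) = \<sigma> h (f v + k v)" if "h \<in> H" "v \<in> A" for h v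
  proof -
    have "\<sigma> h (f v + k v) = \<sigma> h (f v) + \<sigma> h (k v)"
      using additive_onD(1)[OF gmodD(2)[OF E \<open>h \<in> H\<close>] gmodD(1)[OF E]] assms(4,5) that by blast
    then show ?thesis using that f k by (simp add: ghom_def)
  qed
qed

section \<open>Splitting a free module of rank r + s into its first r and last s coordinates\<close>

definition trunc :: "nat \<Rightarrow> (nat \<Rightarrow> 'a \<Rightarrow> int) \<Rightarrow> nat \<Rightarrow> 'a \<Rightarrow> int" where
  "trunc k v = (\<lambda>i. if i < k then v i else 0)"

definition shift :: "nat \<Rightarrow> (nat \<Rightarrow> 'a \<Rightarrow> int) \<Rightarrow> nat \<Rightarrow> 'a \<Rightarrow> int" where
  "shift k v = (\<lambda>i. v (i + k))"

definition unshift :: "nat \<Rightarrow> (nat \<Rightarrow> 'a \<Rightarrow> int) \<Rightarrow> nat \<Rightarrow> 'a \<Rightarrow> int" where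
  "unshift k v = (\<lambda>i. if i < k then 0 else v (i - k))"

lemma trunc_ghom: "ghom H act A act (trunc k)"
  and shift_ghom: "ghom H act A act (shift k)"
  by (auto simp: ghom_def additive_on_def trunc_def shift_def act_def fun_eq_iff)

lemma trunc_freeM: "v \<in> freeM H s \<Longrightarrow> trunc r v \<in> freeM H r"
proof -
  assume v: "v \<in> freeM H s"
  have "supp (trunc r v) \<subseteq> supp v" by (auto simp: supp_def trunc_def split: if_splits)
  moreover have "supp (trunc r v) \<subseteq> {..<r} \<times> UNIV"
    by (auto simp: supp_def trunc_def split: if_splits)
  ultimately show ?thesis using v finite_subset by (fastforce simp: freeM_def)
qed

lemma shift_freeM: "v \<in> freeM H (r + s) \<Longrightarrow> shift r v \<in> freeM H s"
proof -
  assume v: "v \<in> freeM H (r + s)"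
  have "(\<lambda>(i, x). (i + r, x)) ` supp (shift r v) \<subseteq> supp v"
    by (auto simp: supp_def shift_def)
  moreover have "inj_on (\<lambda>(i, x). (i + r, x)) (supp (shift r v))" by (auto simp: inj_on_def)
  ultimately have "finite (supp (shift r v))"
    using v finite_subset finite_imageD unfolding freeM_def by blast
  moreover have "supp (shift r v) \<subseteq> {..<s} \<times> H"
    using v by (fastforce simp: freeM_def supp_def shift_def)
  ultimately show ?thesis by (simp add: freeM_def)
qed

lemma unshift_freeM: "v \<in> freeM H s \<Longrightarrow> unshift r v \<in> freeM H (r + s)"
proof -
  assume v: "v \<in> freeM H s"
  have "supp (unshift r v) \<subseteq> (\<lambda>(i, x). (i + r, x)) ` supp v"
  proof clarify
    fix i x assume "(i, x) \<in> supp (unshift r v)"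
    then have "i \<ge> r" "(i - r, x) \<in> supp v" by (auto simp: supp_def unshift_def split: if_splits)
    then show "(i, x) \<in> (\<lambda>(i, x). (i + r, x)) ` supp v"
      by (intro rev_image_eqI[of "(i - r, x)"]) auto
  qed
  moreover have "(\<lambda>(i, x). (i + r, x)) ` supp v \<subseteq> {..<r + s} \<times> H"
    using v by (fastforce simp: freeM_def)
  ultimately show ?thesis using v finite_subset by (fastforce simp: freeM_def)
qed

lemma trunc_id: "u \<in> freeM H r \<Longrightarrow> trunc r u = u"
  by (force simp: freeM_def trunc_def supp_def fun_eq_iff)

lemma shift_zero: "u \<in> freeM H r \<Longrightarrow> shift r u = 0"
  by (force simp: freeM_def shift_def supp_def fun_eq_iff)

lemma trunc_shift_join:
  assumes "u \<in> freeM H r"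
  shows "trunc r (u + unshift r w) = u" "shift r (u + unshift r w) = w"
proof -
  have "trunc r (u + unshift r w) = trunc r u"
    by (auto simp: trunc_def unshift_def fun_eq_iff)
  then show "trunc r (u + unshift r w) = u" using trunc_id[OF assms] by simp
  have "shift r (u + unshift r w) = shift r u + w"
    by (auto simp: shift_def unshift_def fun_eq_iff)
  then show "shift r (u + unshift r w) = w" using shift_zero[OF assms] by simp
qed

lemma join_freeM: "u \<in> freeM H r \<Longrightarrow> w \<in> freeM H s \<Longrightarrow> u + unshift r w \<in> freeM H (r + s)"
  using unshift_freeM[of w H s r] freeM_mono[of H H r "r + s"]
    add_subgroupD(4)[OF freeM_add_subgroup] by auto

lemma trunc_shift_zero:
  assumes "shift r v = 0" shows "trunc r v = v"
proof (intro HOL.ext)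
  fix i x
  show "trunc r v i x = v i x"
  proof (cases "i < r")
    case False
    then have "v i x = shift r v (i - r) x" by (simp add: shift_def)
    then show ?thesis using assms False by (simp add: trunc_def)
  qed (simp add: trunc_def)
qed

text \<open>The middle term is covered by \<open>a\<close> on the first r coordinates plus a lift of
  \<open>c\<close> through \<open>p\<close> on the last s. The last two conclusions say that
  \<open>shift r\<close> presents the kernel of \<open>f\<close> as an extension of the kernel of
  \<open>c\<close> by that of \<open>a\<close>, which allows the construction to be
  repeated.\<close>

lemma horseshoe:
  assumes H: "subgroup H G" and E: "gmod H \<rho> E" and p: "ghom H \<rho> E \<sigma> p"
    and a: "ghom H act (freeM H r) \<rho> a" "a ` freeM H r = ker_on E p"
    and c: "ghom H act (freeM H s) \<sigma> c" "c ` freeM H s = p ` E"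
  obtains f where "ghom H act (freeM H (r + s)) \<rho> f" "f ` freeM H (r + s) = E"
    "shift r ` (ker_on (freeM H (r + s)) f) = ker_on (freeM H s) c"
    "{v\<in>freeM H (r + s). f v = 0 \<and> shift r v = 0} = ker_on (freeM H r) a"
proof -
  obtain c' where c': "ghom H act (freeM H s) \<rho> c'" "c' ` freeM H s \<subseteq> E"
    "\<And>v. v \<in> freeM H s \<Longrightarrow> p (c' v) = c v"
    using freeM_lift[OF H c(1) E p] c(2) by (metis order_refl)
  define f where "f v = a (trunc r v) + c' (shift r v)" for v
  note ED = add_subgroupD[OF gmodD(1)[OF E]]
  note pD = additive_onD[OF ghomD(1)[OF p] gmodD(1)[OF E]]
  have aE: "a u \<in> E" "p (a u) = 0" if "u \<in> freeM H r" for u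
    using that a(2) by auto
  have a0: "a 0 = 0" and c0: "c' 0 = 0"
    using additive_onD(2)[OF ghomD(1) freeM_add_subgroup] a(1) c'(1) by blast+
  have tr: "trunc r v \<in> freeM H r" and sh: "shift r v \<in> freeM H s" if "v \<in> freeM H (r + s)" for v
    using that trunc_freeM shift_freeM by blast+
  have fjoin: "f (u + unshift r w) = a u + c' w" if "u \<in> freeM H r" for u w
    using that by (simp add: f_def trunc_shift_join)
  have fE: "f v \<in> E" and pf: "p (f v) = c (shift r v)" if "v \<in> freeM H (r + s)" for v
    using that aE[OF tr[OF that]] sh[OF that] c' ED(4) by (auto simp: f_def pD image_subset_iff)
  have 1: "ghom H act (freeM H (r + s)) \<rho> f"
  proof -
    have "ghom H act (freeM H (r + s)) \<rho> (a \<circ> trunc r)"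
      using trunc_ghom a(1) tr by (intro ghom_comp) auto
    moreover have "ghom H act (freeM H (r + s)) \<rho> (c' \<circ> shift r)"
      using shift_ghom c'(1) sh by (intro ghom_comp) auto
    ultimately have "ghom H act (freeM H (r + s)) \<rho> (\<lambda>v. (a \<circ> trunc r) v + (c' \<circ> shift r) v)"
    proof (rule ghom_add[OF _ _ E])
      show "(a \<circ> trunc r) ` freeM H (r + s) \<subseteq> E" using aE tr by auto
      show "(c' \<circ> shift r) ` freeM H (r + s) \<subseteq> E" using sh c'(2) by auto
    qed
    then show ?thesis by (simp add: f_def[abs_def])
  qed
  have 2: "f ` freeM H (r + s) = E"
  proof (intro equalityI subsetI)
    fix e assume e: "e \<in> E"
    then obtain w where w: "w \<in> freeM H s" "p e = c w" using c(2) by blast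
    then have "e - c' w \<in> ker_on E p" using e c' ED(2) by (auto simp: pD image_subset_iff)
    then obtain u where u: "u \<in> freeM H r" "e - c' w = a u" using a(2) by blast
    have "e = a u + c' w" using u(2) by (simp add: algebra_simps)
    also have "\<dots> = f (u + unshift r w)" using fjoin[OF u(1), of w] by simp
    finally show "e \<in> f ` freeM H (r + s)" using join_freeM[OF u(1) w(1)] by blast
  qed (use fE in blast)
  have 3: "shift r ` (ker_on (freeM H (r + s)) f) = ker_on (freeM H s) c"
  proof (intro equalityI subsetI)
    fix w assume w: "w \<in> ker_on (freeM H s) c"
    \<comment> \<open>The value of the lift lies in the kernel of \<open>p\<close>, hence in the
      image of \<open>a\<close>, so suitable first coordinates cancel it.\<close>
    then have cw: "- c' w \<in> ker_on E p" using c' ED(3) by (auto simp: pD image_subset_iff)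
    then obtain u where u: "u \<in> freeM H r" "a u = - c' w" using a(2) by (metis (no_types, lifting) imageE)
    have "f (u + unshift r w) = 0" using fjoin[OF u(1), of w] u(2) by simp
    moreover have "shift r (u + unshift r w) = w" using trunc_shift_join[OF u(1)] by blast
    ultimately show "w \<in> shift r ` (ker_on (freeM H (r + s)) f)"
      using join_freeM[OF u(1)] w by (metis (mono_tags, lifting) image_eqI mem_Collect_eq)
  next
    fix w assume "w \<in> shift r ` (ker_on (freeM H (r + s)) f)"
    then obtain v where "v \<in> freeM H (r + s)" "f v = 0" "w = shift r v" by blast
    then show "w \<in> ker_on (freeM H s) c" using pf[of v] sh[of v] pD(2) by simp
  qed
  have 4: "{v\<in>freeM H (r + s). f v = 0 \<and> shift r v = 0} = ker_on (freeM H r) a"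
  proof (intro equalityI subsetI)
    fix v assume v: "v \<in> {v\<in>freeM H (r + s). f v = 0 \<and> shift r v = 0}"
    have "v = trunc r v" using v trunc_shift_zero[of r v] by simp
    then have "v \<in> freeM H r" using v tr by (metis (mono_tags, lifting) mem_Collect_eq)
    moreover have "a v = 0"
    proof -
      have "f v = a v + c' (shift r v)" unfolding f_def using \<open>v = trunc r v\<close> by metis
      moreover have "f v = 0" "shift r v = 0" using v by simp_all
      ultimately show ?thesis by (metis add.right_neutral c0)
    qed
    ultimately show "v \<in> ker_on (freeM H r) a" by simp
  next
    fix u assume u: "u \<in> ker_on (freeM H r) a"
    then have "u \<in> freeM H (r + s)" using freeM_mono[of H H r "r + s"] by auto
    then show "u \<in> {v\<in>freeM H (r + s). f v = 0 \<and> shift r v = 0}"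
      using u shift_zero[of u H r] trunc_id[of u H r] c0 by (simp add: f_def)
  qed
  show ?thesis by (rule that[OF 1 2 3 4])
qed

text \<open>One step of the coinduction for extensions: the kernel of the horseshoe cover is itself
  an extension, by \<open>q\<close>, of two modules with resolutions.\<close>

lemma extension_cover:
  assumes H: "subgroup H G" and B: "gmod H \<rho> B" and p: "ghom H \<rho> B \<sigma> p"
    and "FP H \<sigma> (p ` B)" "FP H \<rho> (ker_on B p)"
  obtains n f q where "ghom H act (freeM H n) \<rho> f" "f ` freeM H n = B"
    "ghom H act (ker_on (freeM H n) f) act q" "FPU H (q ` (ker_on (freeM H n) f))"
    "FPU H (ker_on (ker_on (freeM H n) f) q)"
proof -
  obtain r a where a: "ghom H act (freeM H r) \<rho> a" "a ` freeM H r = ker_on B p"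
    and ka: "FPU H (ker_on (freeM H r) a)" using assms(5) unfolding FP_def by blast
  obtain s c where c: "ghom H act (freeM H s) \<sigma> c" "c ` freeM H s = p ` B"
    and kc: "FPU H (ker_on (freeM H s) c)" using assms(4) unfolding FP_def by blast
  obtain f where f: "ghom H act (freeM H (r + s)) \<rho> f" "f ` freeM H (r + s) = B"
    and 3: "shift r ` (ker_on (freeM H (r + s)) f) = ker_on (freeM H s) c"
    and 4: "{v\<in>freeM H (r + s). f v = 0 \<and> shift r v = 0} = ker_on (freeM H r) a"
    using horseshoe[OF H B p a c] by blast
  show ?thesis by (rule that[OF f shift_ghom[of _ _ r]]) (use 3 4 ka kc in simp_all)
qed

lemma FPU_extension:
  assumes H: "subgroup H G" and E: "gmod H act E" and p: "ghom H act E act p"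
    and "FPU H (p ` E)" "FPU H (ker_on E p)"
  shows "FPU H E"
proof -
  \<comment> \<open>The coinduction ranges over all extensions of one \<open>FPU\<close> module by
    another, since the two ends change from one kernel to the next.\<close>
  define \<C> where "\<C> = {E. \<exists>p. gmod H act E \<and> ghom H act E act p \<and> FPU H (p ` E) \<and> FPU H (ker_on E p)}"
  show ?thesis
  proof (rule FPU_coinduct[of _ \<C>])
    show "E \<in> \<C>" unfolding \<C>_def using assms by blast
    fix B assume "B \<in> \<C>"
    then obtain p where B: "gmod H act B" and p: "ghom H act B act p"
      and FP: "FP H act (p ` B)" "FP H act (ker_on B p)"
      unfolding \<C>_def FPU_iff_FP by blast
    obtain n f q where f: "ghom H act (freeM H n) act f" "f ` freeM H n = B"
      and q: "ghom H act (ker_on (freeM H n) f) act q" "FPU H (q ` (ker_on (freeM H n) f))"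
        "FPU H (ker_on (ker_on (freeM H n) f) q)"
      by (rule extension_cover[OF H B p FP])
    have "ker_on (freeM H n) f \<in> \<C>"
      unfolding \<C>_def using ghom_kernel_gmod[OF f(1) freeM_gmod[OF H] H] q
      by (intro CollectI exI[of _ q]) simp
    then show "\<exists>r f. ghom H act (freeM H r) act f \<and> f ` freeM H r = B \<and>
      ker_on (freeM H r) f \<in> \<C>" using f by blast
  qed
qed

lemma FP_extension:
  assumes H: "subgroup H G" and B: "gmod H \<rho> B" and p: "ghom H \<rho> B \<sigma> p"
    and FP: "FP H \<sigma> (p ` B)" "FP H \<rho> (ker_on B p)"
  shows "FP H \<rho> B"
proof -
  obtain n f q where f: "ghom H act (freeM H n) \<rho> f" "f ` freeM H n = B"
    and q: "ghom H act (ker_on (freeM H n) f) act q" "FPU H (q ` (ker_on (freeM H n) f))"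
      "FPU H (ker_on (ker_on (freeM H n) f) q)"
    by (rule extension_cover[OF H B p FP])
  then show ?thesis unfolding FP_def
    using FPU_extension[OF H ghom_kernel_gmod[OF f(1) freeM_gmod[OF H] H] q] by blast
qed

lemma freeM_zero: "freeM H 0 = {0}" and freeM_empty: "freeM {} r = {0}"
proof -
  have "v = 0" if "supp v = {}" for v :: "nat \<Rightarrow> 'a \<Rightarrow> int"
    using that by (intro HOL.ext) (simp add: supp_def)
  moreover have "supp 0 = {}" by (simp add: supp_def)
  ultimately show "freeM H 0 = {0}" "freeM {} r = {0}" unfolding freeM_def by force+
qed

lemma ghom_id: "ghom H \<rho> A \<rho> id"
  by (simp add: ghom_def additive_on_def)

lemma FPU_zero: "FPU H {0}"
proof (rule FPU_coinduct[of _ "{{0}}"])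
  fix B :: "(nat \<Rightarrow> 'a \<Rightarrow> int) set" assume B: "B \<in> {{0}}"
  have "ker_on (freeM H 0) id \<in> {{0}}" unfolding freeM_zero by force
  then show "\<exists>r f. ghom H act (freeM H r) act f \<and> f ` freeM H r = B \<and>
      ker_on (freeM H r) f \<in> {{0}}"
    using B freeM_zero ghom_id by (intro exI[of _ 0] exI[of _ id]) simp
qed simp

lemma FP_free: "FP H act (freeM H r)"
  unfolding FP_def
proof (intro exI[of _ r] exI[of _ id] conjI)
  have "ker_on (freeM H r) id = {0}"
    using add_subgroupD(1)[OF freeM_add_subgroup, of H r] unfolding id_def by blast
  then show "FPU H (ker_on (freeM H r) id)" by (simp add: FPU_zero)
qed (simp_all add: ghom_id)

text \<open>Composing a cover with an injective map does not change its kernel, so the same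
  resolution serves, even across types.\<close>

lemma FP_iso:
  assumes H: "subgroup H G" and "FP H \<rho> A" and k: "ghom H \<rho> A \<sigma> k"
    and inj: "\<And>v. v \<in> A \<Longrightarrow> k v = 0 \<Longrightarrow> v = 0"
  shows "FP H \<sigma> (k ` A)"
proof -
  obtain r f where f: "ghom H act (freeM H r) \<rho> f" "f ` freeM H r = A"
    "FPU H (ker_on (freeM H r) f)" using assms(2) unfolding FP_def by blast
  have A: "add_subgroup A" using gmodD(1)[OF FP_gmod[OF H assms(2)]] .
  have "k 0 = 0" using additive_onD(2)[OF ghomD(1)[OF k] A] .
  then have "ker_on (freeM H r) (k \<circ> f) = ker_on (freeM H r) f"
    using f(2) inj by auto
  moreover have "(k \<circ> f) ` freeM H r = k ` A" unfolding f(2)[symmetric] by (rule image_comp[symmetric])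
  ultimately show ?thesis unfolding FP_def
    using f ghom_comp[OF f(1) k] by (intro exI[of _ r] exI[of _ "k \<circ> f"]) simp
qed

text \<open>The kernel \<open>K\<close> of the composite from the free module to the quotient maps
  onto \<open>ker_on B p\<close>, with the kernel of the cover of \<open>B\<close> as its kernel;
  thus it is an extension of known modules.\<close>

lemma FP_quotient:
  assumes H: "subgroup H G" and p: "ghom H \<rho> B \<sigma> p"
    and "FP H \<rho> B" "FP H \<rho> (ker_on B p)"
  shows "FP H \<sigma> (p ` B)"
proof -
  obtain r f where f: "ghom H act (freeM H r) \<rho> f" "f ` freeM H r = B"
    "FPU H (ker_on (freeM H r) f)" using assms(3) unfolding FP_def by blast
  have B: "add_subgroup B" using gmodD(1)[OF FP_gmod[OF H assms(3)]] .
  have p0: "p 0 = 0" using additive_onD(2)[OF ghomD(1)[OF p] B] .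
  have pf: "ghom H act (freeM H r) \<sigma> (p \<circ> f)" using ghom_comp[OF f(1) p] f(2) by simp
  define K where "K = ker_on (freeM H r) (p \<circ> f)"
  have K: "gmod H act K" unfolding K_def by (rule ghom_kernel_gmod[OF pf freeM_gmod[OF H] H])
  have "f ` K = ker_on B p" using f(2) by (auto simp: K_def)
  moreover have "ker_on K f = ker_on (freeM H r) f" using p0 by (auto simp: K_def)
  moreover have "ghom H act K \<rho> f" by (rule ghom_subset[OF f(1)]) (auto simp: K_def)
  ultimately have "FP H act K"
    using FP_extension[OF H K, of \<rho> f] assms(4) f(3) by (simp add: FPU_iff_FP)
  then have "FPU H (ker_on (freeM H r) (p \<circ> f))" by (simp add: FPU_iff_FP K_def)
  moreover have "(p \<circ> f) ` freeM H r = p ` B" unfolding f(2)[symmetric] by (rule image_comp[symmetric])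
  ultimately show ?thesis unfolding FP_def using pf by blast
qed

text \<open>Schanuel's lemma: the pullback \<open>E\<close> of two presentations of one module maps onto both
  free modules; this trades the kernel of one for the kernel of the other.\<close>

lemma FP_kernel:
  assumes H: "subgroup H G" and \<pi>: "ghom H act (freeM H t) \<sigma> \<pi>" "FP H \<sigma> (\<pi> ` freeM H t)"
  shows "FPU H (ker_on (freeM H t) \<pi>)"
proof -
  obtain s \<epsilon> where \<epsilon>: "ghom H act (freeM H s) \<sigma> \<epsilon>" "\<epsilon> ` freeM H s = \<pi> ` freeM H t"
    "FPU H (ker_on (freeM H s) \<epsilon>)" using \<pi>(2) unfolding FP_def by blast
  have Fs: "gmod H act (freeM H s)" and Ft: "gmod H act (freeM H t)" using freeM_gmod[OF H] by blast+
  note \<pi>D = additive_onD[OF ghomD(1)[OF \<pi>(1)] freeM_add_subgroup]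
  note \<epsilon>D = additive_onD[OF ghomD(1)[OF \<epsilon>(1)] freeM_add_subgroup]
  note FD = add_subgroupD[OF freeM_add_subgroup]
  obtain g where g: "ghom H act (freeM H s) act g" "g ` freeM H s \<subseteq> freeM H t"
    "\<And>v. v \<in> freeM H s \<Longrightarrow> \<pi> (g v) = \<epsilon> v"
    using freeM_lift[OF H \<epsilon>(1) Ft \<pi>(1)] \<epsilon>(2) by (metis order_refl)
  note gD = additive_onD[OF ghomD(1)[OF g(1)] freeM_add_subgroup]
  have gt: "g u \<in> freeM H t" if "u \<in> freeM H s" for u using g(2) that by blast
  have diff: "trunc s (u - v) = trunc s u - trunc s v" "shift s (u - v) = shift s u - shift s v"
    "act h (u - v) = act h u - act h v" for u v h
    by (auto simp: trunc_def shift_def act_def fun_eq_iff)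
  have tact: "trunc s (act h v) = act h (trunc s v)" and sact: "shift s (act h v) = act h (shift s v)"
    if "h \<in> H" for h v
    using that ghomD(2)[OF trunc_ghom, of h H v UNIV] ghomD(2)[OF shift_ghom, of h H v UNIV] by simp_all
  \<comment> \<open>The pullback, stored in one vector: the first s coordinates hold a vector for
    \<epsilon>, the last t one for \<pi>, with equal images.\<close>
  define E where "E = {w\<in>freeM H (s + t). \<epsilon> (trunc s w) = \<pi> (shift s w)}"
  have ED: "trunc s w \<in> freeM H s" "shift s w \<in> freeM H t" "\<epsilon> (trunc s w) = \<pi> (shift s w)" if "w \<in> E" for w
    using that trunc_freeM shift_freeM unfolding E_def by blast+
  have EI: "u + unshift s v \<in> E" if "u \<in> freeM H s" "v \<in> freeM H t" "\<epsilon> u = \<pi> v" for u v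
    using that join_freeM[OF that(1,2)] trunc_shift_join[OF that(1)] by (simp add: E_def)
  have E: "gmod H act E"
  proof (rule gmod_subset[OF freeM_gmod[OF H]])
    show "E \<subseteq> freeM H (s + t)" by (auto simp: E_def)
    have "0 + unshift s 0 \<in> E" by (intro EI FD(1)) (simp add: \<epsilon>D(2) \<pi>D(2))
    moreover have "0 + unshift s 0 = 0" by (simp add: unshift_def fun_eq_iff)
    moreover have "u - v \<in> E" if "u \<in> E" "v \<in> E" for u v
      using ED[OF that(1)] ED[OF that(2)] that FD(2) by (simp add: E_def diff \<epsilon>D \<pi>D)
    ultimately show "add_subgroup E" by (simp add: add_subgroup_def)
    fix h v assume "h \<in> H" "v \<in> E"
    then show "act h v \<in> E"
      using ED[of v] gmodD(3)[OF freeM_gmod[OF H]] ghomD(2)[OF \<epsilon>(1)] ghomD(2)[OF \<pi>(1)]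
      by (simp add: E_def tact sact)
  qed
  \<comment> \<open>Projecting to the last t coordinates makes \<open>E\<close> an extension of a
    free module by the kernel of \<epsilon>, which has a resolution by choice of \<epsilon>.\<close>
  have FPE: "FP H act E"
  proof (rule FP_extension[OF H E shift_ghom])
    have "v \<in> shift s ` E" if v: "v \<in> freeM H t" for v
    proof -
      have "\<pi> v \<in> \<epsilon> ` freeM H s" using \<epsilon>(2) v by simp
      then obtain u where u: "u \<in> freeM H s" "\<epsilon> u = \<pi> v" by auto
      then show ?thesis using image_eqI[OF _ EI[OF u(1) v u(2)]] trunc_shift_join[OF u(1)] by metis
    qed
    then have "shift s ` E = freeM H t" using ED(2) by blast
    then show "FP H act (shift s ` E)" using FP_free by simp
    have "{e\<in>E. shift s e = 0} = ker_on (freeM H s) \<epsilon>"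
    proof (intro equalityI subsetI)
      fix e assume e: "e \<in> {e\<in>E. shift s e = 0}"
      then show "e \<in> ker_on (freeM H s) \<epsilon>" using ED[of e] trunc_shift_zero[of s e] \<pi>D(2) by simp
    next
      fix v assume v: "v \<in> ker_on (freeM H s) \<epsilon>"
      then have "v \<in> freeM H (s + t)" using freeM_mono[of H H s "s + t"] by auto
      then show "v \<in> {e\<in>E. shift s e = 0}" using v shift_zero[of v H s] trunc_id[of v H s] \<pi>D(2) by (simp add: E_def)
    qed
    then show "FP H act {e\<in>E. shift s e = 0}" using \<epsilon>(3) by (simp add: FPU_iff_FP)
  qed
  \<comment> \<open>Since \<open>g\<close> lifts \<epsilon> through \<pi>, subtracting it retracts
    the pullback onto the kernel of \<pi>. What \<open>q\<close> kills is the graph of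
    \<open>g\<close>, a copy of the free module of rank s.\<close>
  define q where "q w = shift s w - g (trunc s w)" for w
  have qE: "q w \<in> freeM H t" "\<pi> (q w) = 0" if "w \<in> E" for w
    using ED[OF that] gt FD(2) g(3) by (simp_all add: q_def \<pi>D)
  have qI: "q (u + unshift s v) = v - g u" if "u \<in> freeM H s" for u v
    using trunc_shift_join[OF that] by (simp add: q_def)
  have q: "ghom H act E act q"
    unfolding ghom_def additive_on_def
  proof (intro conjI ballI)
    have "trunc s (u + v) = trunc s u + trunc s v" "shift s (u + v) = shift s u + shift s v" for u v
      by (auto simp: trunc_def shift_def fun_eq_iff)
    then show "q (u + v) = q u + q v" if "u \<in> E" "v \<in> E" for u v
      using ED(1)[OF that(1)] ED(1)[OF that(2)] by (simp add: q_def gD)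
    show "q (act h v) = act h (q v)" if "h \<in> H" "v \<in> E" for h v
      using that ED(1)[OF that(2)] ghomD(2)[OF g(1)] by (simp add: q_def diff tact sact)
  qed
  have "q ` E = ker_on (freeM H t) \<pi>"
  proof (intro equalityI subsetI)
    fix v assume v: "v \<in> ker_on (freeM H t) \<pi>"
    have "0 + unshift s v \<in> E" using v FD(1) \<epsilon>D(2) by (intro EI) auto
    moreover have "q (0 + unshift s v) = v" unfolding qI[OF FD(1)] using gD(2) by simp
    ultimately show "v \<in> q ` E" by (metis imageI)
  next
    fix v assume "v \<in> q ` E"
    then show "v \<in> ker_on (freeM H t) \<pi>" using qE by blast
  qed
  moreover have "FP H act (ker_on E q)"
  proof (rule FP_extension[OF H ghom_kernel_gmod[OF q E H] trunc_ghom])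
    have "u \<in> trunc s ` (ker_on E q)" if u: "u \<in> freeM H s" for u
    proof (rule image_eqI)
      show "u = trunc s (u + unshift s (g u))" using trunc_shift_join(1)[OF u] by simp
      show "u + unshift s (g u) \<in> ker_on E q" using EI[OF u gt[OF u]] g(3)[OF u] qI[OF u] by simp
    qed
    then have "trunc s ` (ker_on E q) = freeM H s" using ED(1) by blast
    then show "FP H act (trunc s ` (ker_on E q))" using FP_free by simp
    have "e = 0" if "e \<in> E" "q e = 0" "trunc s e = 0" for e
    proof -
      have "shift s e = 0" using that gD(2) by (simp add: q_def)
      then show ?thesis using trunc_shift_zero[of s e] that(3) by simp
    qed
    moreover have "0 \<in> E" "trunc s 0 = 0" "shift s 0 = 0"
      using add_subgroupD(1)[OF gmodD(1)[OF E]] by (auto simp: trunc_def shift_def fun_eq_iff)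
    ultimately have "{e\<in>ker_on E q. trunc s e = 0} = {0}" using gD(2) by (auto simp: q_def)
    then show "FP H act {e\<in>ker_on E q. trunc s e = 0}" using FPU_zero by (simp add: FPU_iff_FP)
  qed
  ultimately show ?thesis using FP_quotient[OF H q FPE] FPU_iff_FP by simp
qed

end

section \<open>Subgroups of finite index\<close>

context group
begin

text \<open>Pulling back along a free cover of \<open>B\<close> reduces to \<open>FP_kernel\<close>;
  the kernel sought is then the quotient of that preimage by the kernel of the cover.\<close>

lemma FP_kernel_general:
  assumes H: "subgroup H G" and p: "ghom H \<rho> B \<sigma> p" and B: "FP H \<rho> B" and A: "FP H \<sigma> (p ` B)"
  shows "FP H \<rho> (ker_on B p)"
proof -
  obtain r f where f: "ghom H act (freeM H r) \<rho> f" "f ` freeM H r = B"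
    "FPU H (ker_on (freeM H r) f)" using B unfolding FP_def by blast
  have p0: "p 0 = 0" using additive_onD(2)[OF ghomD(1)[OF p]] gmodD(1)[OF FP_gmod[OF H B]] by blast
  have pf: "ghom H act (freeM H r) \<sigma> (p \<circ> f)" using ghom_comp[OF f(1) p] f(2) by simp
  have im: "(p \<circ> f) ` freeM H r = p ` B" unfolding f(2)[symmetric] by (rule image_comp[symmetric])
  define K where "K = ker_on (freeM H r) (p \<circ> f)"
  have K: "FP H act K"
    using FP_kernel[OF H pf] A unfolding im K_def FPU_iff_FP by blast
  have "ker_on K f = ker_on (freeM H r) f" using p0 by (auto simp: K_def)
  then have 1: "FP H act (ker_on K f)" using f(3) by (simp add: FPU_iff_FP)
  have 2: "f ` K = ker_on B p" using f(2) by (auto simp: K_def)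
  have 3: "ghom H act K \<rho> f" by (rule ghom_subset[OF f(1)]) (auto simp: K_def)
  show ?thesis using FP_quotient[OF H 3 K 1] unfolding 2 .
qed

lemma inv_mult_mem_iff:
  assumes M: "subgroup M G" and "g \<in> M" "y \<in> carrier G" shows "inv g \<otimes> y \<in> M \<longleftrightarrow> y \<in> M"
proof
  assume "inv g \<otimes> y \<in> M"
  then have "g \<otimes> (inv g \<otimes> y) \<in> M" using assms subgroup.m_closed[OF M] by blast
  then show "y \<in> M" using assms subgroup.mem_carrier[OF M] by (simp add: m_assoc[symmetric])
qed (use assms subgroup.m_closed[OF M] subgroup.m_inv_closed[OF M] in blast)

text \<open>Each right coset of \<open>M\<close> contributes a free \<open>M\<close>-module of rank
  s. Cosets are adjoined one at a time; a new one is either disjoint from the union so far or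
  already contained in it.\<close>

lemma FP_cosets:
  assumes M: "subgroup M G" and "finite T" "T \<subseteq> carrier G"
  shows "FP M act (freeM (\<Union>t\<in>T. M #> t) s)"
  using assms(2,3)
proof (induction T rule: finite_induct)
  case empty
  then show ?case using FPU_zero freeM_empty by (simp add: FPU_iff_FP)
next
  case (insert t T)
  let ?K = "\<Union>t\<in>T. M #> t"
  let ?L = "\<Union>t\<in>insert t T. M #> t"
  have Mc: "M \<subseteq> carrier G" by (rule subgroup.subset[OF M])
  have t: "t \<in> carrier G" and Tc: "T \<subseteq> carrier G" using insert.prems by auto
  have IH: "FP M act (freeM ?K s)" by (rule insert.IH[OF Tc])
  show ?case
  proof (cases "(M #> t) \<inter> ?K = {}")
    case False
    then obtain y u where y: "y \<in> M #> t" "u \<in> T" "y \<in> M #> u" by blast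
    then have "M #> t = M #> u" using repr_independence[OF y(1) t M] repr_independence[OF y(3) _ M] Tc by auto
    then have "?L = ?K" using y(2) by auto
    then show ?thesis using IH by simp
  next
    case disj: True
    have Lc: "?L \<subseteq> carrier G" using r_coset_subset_G[OF Mc] insert.prems by blast
    have "m \<otimes> y \<in> ?L" if m: "m \<in> M" and y: "y \<in> ?L" for m y
    proof -
      obtain u n where u: "u \<in> insert t T" "n \<in> M" "y = n \<otimes> u" using y unfolding r_coset_def by blast
      then have "m \<otimes> y = (m \<otimes> n) \<otimes> u" using m subsetD[OF Mc] subsetD[OF insert.prems] by (simp add: m_assoc)
      moreover have "m \<otimes> n \<in> M" using m u subgroup.m_closed[OF M] by blast
      ultimately show ?thesis using u(1) unfolding r_coset_def by blast
    qed
    then have E: "gmod M act (freeM ?L s)" by (intro freeM_gmod_stable Mc Lc)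
    \<comment> \<open>Restriction to the coset of \<open>t\<close>, moved back to \<open>M\<close>
      by right translation, which commutes with the left action.\<close>
    define p where "p v = (\<lambda>(i::nat) x. if x \<in> M then v i (x \<otimes> t) else 0)" for v :: "nat \<Rightarrow> 'a \<Rightarrow> int"
    have p: "ghom M act (freeM ?L s) act p"
      unfolding ghom_def additive_on_def
    proof (intro conjI ballI)
      show "p (u + v) = p u + p v" for u v by (auto simp: p_def fun_eq_iff)
      fix m v assume m: "m \<in> M"
      have "p (act m v) i x = act m (p v) i x" for i x
        using m Mc t inv_mult_mem_iff[OF M m, of x]
        by (cases "x \<in> carrier G") (auto simp: p_def act_def m_assoc subset_iff)
      then show "p (act m v) = act m (p v)" by (intro HOL.ext)
    qed
    have im: "p ` freeM ?L s = freeM M s"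
    proof (intro equalityI subsetI)
      fix w assume "w \<in> p ` freeM ?L s"
      then obtain v where v: "v \<in> freeM ?L s" "w = p v" by blast
      have sub: "(\<lambda>(i, x). (i, x \<otimes> t)) ` supp w \<subseteq> supp v"
        using v by (auto simp: p_def supp_def split: if_splits)
      have "inj_on (\<lambda>(i, x). (i, x \<otimes> t)) (supp w)"
        using v t Mc by (auto simp: p_def supp_def inj_on_def subset_iff split: if_splits)
      moreover have "finite (supp v)" using v by (simp add: freeM_def)
      ultimately have "finite (supp w)" using sub finite_subset finite_imageD by blast
      moreover have "supp w \<subseteq> {..<s} \<times> M" using v by (auto simp: p_def supp_def freeM_def split: if_splits)
      ultimately show "w \<in> freeM M s" by (simp add: freeM_def)
    next
      fix w assume w: "w \<in> freeM M s"
      define v where "v = (\<lambda>i y. if y \<in> M #> t then w i (y \<otimes> inv t) else 0)"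
      have sv: "supp v \<subseteq> (\<lambda>(i, x). (i, x \<otimes> t)) ` supp w"
      proof clarify
        fix i y assume "(i, y) \<in> supp v"
        then have k: "y \<in> M #> t" "(i, y \<otimes> inv t) \<in> supp w" by (auto simp: supp_def v_def split: if_splits)
        then have "y \<in> carrier G" using r_coset_subset_G[OF Mc t] by auto
        then have "y = (y \<otimes> inv t) \<otimes> t" using t by (simp add: m_assoc)
        then show "(i, y) \<in> (\<lambda>(i, x). (i, x \<otimes> t)) ` supp w"
          using k by (intro image_eqI[where x = "(i, y \<otimes> inv t)"]) auto
      qed
      have "(\<lambda>(i, x). (i, x \<otimes> t)) ` supp w \<subseteq> {..<s} \<times> ?L"
        using w by (auto simp: freeM_def r_coset_def)
      then have "supp v \<subseteq> {..<s} \<times> ?L" using sv by blast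
      moreover have "finite (supp v)" using finite_subset[OF sv] w by (simp add: freeM_def)
      ultimately have "v \<in> freeM ?L s" unfolding freeM_def by blast
      moreover have "p v i x = w i x" for i x
      proof (cases "x \<in> M")
        case True
        then have "x \<otimes> t \<in> M #> t" "x \<otimes> t \<otimes> inv t = x" using t Mc by (auto simp: r_coset_def m_assoc)
        then show ?thesis using True by (simp add: p_def v_def)
      next
        case False
        then have "w i x = 0" using w by (auto simp: freeM_def supp_def)
        then show ?thesis using False by (simp add: p_def)
      qed
      then have "p v = w" by (intro HOL.ext)
      ultimately show "w \<in> p ` freeM ?L s" by blast
    qed
    have ker: "ker_on (freeM ?L s) p = freeM ?K s"
    proof (intro equalityI subsetI)
      fix v assume v: "v \<in> ker_on (freeM ?L s) p"
      have "y \<notin> M #> t" if "(i, y) \<in> supp v" for i y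
      proof
        assume "y \<in> M #> t"
        then obtain x where "x \<in> M" "y = x \<otimes> t" unfolding r_coset_def by blast
        moreover have "p v i x = 0" using v by simp
        ultimately show False using that by (simp add: p_def supp_def)
      qed
      then show "v \<in> freeM ?K s" using v by (fastforce simp: freeM_def)
    next
      fix v assume v: "v \<in> freeM ?K s"
      have "v i (x \<otimes> t) = 0" if "x \<in> M" for i x
      proof (rule ccontr)
        assume "v i (x \<otimes> t) \<noteq> 0"
        then have "x \<otimes> t \<in> ?K" using v by (auto simp: freeM_def supp_def)
        moreover have "x \<otimes> t \<in> M #> t" using that unfolding r_coset_def by blast
        ultimately show False using disj by blast
      qed
      then have "p v = 0" by (auto simp: p_def fun_eq_iff)
      then show "v \<in> ker_on (freeM ?L s) p" using v freeM_mono[of ?K ?L s s] by auto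
    qed
    show ?thesis
      by (rule FP_extension[OF M E p]) (simp_all only: im ker FP_free IH)
  qed
qed

text \<open>Generators over \<open>M\<close> also generate over \<open>H\<close>. The free
  \<open>H\<close>-module is finitely generated free over \<open>M\<close> by the finite coset
  decomposition, so \<open>FP_kernel_general\<close> applies to the kernel over \<open>M\<close>,
  and the hypotheses on \<open>A\<close> are inherited by it.\<close>

lemma FP_finite_index_cover:
  assumes H: "subgroup H G" and M: "subgroup M G" "M \<subseteq> H"
    and T: "finite T" "T \<subseteq> carrier G" "H = (\<Union>t\<in>T. M #> t)"
    and A: "gmod H \<rho> A" "FP M \<rho> A"
  shows "\<exists>r f. ghom H act (freeM H r) \<rho> f \<and> f ` freeM H r = A \<and>
      gmod H act (ker_on (freeM H r) f) \<and> FP M act (ker_on (freeM H r) f)"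
proof -
  obtain s f where f: "ghom M act (freeM M s) \<rho> f" "f ` freeM M s = A"
    using A(2) unfolding FP_def by blast
  have b: "(f \<circ> bas) i \<in> A" if "i < s" for i using bas_freeM[OF M(1) that] f(2) by auto
  let ?F = "ext \<rho> (f \<circ> bas)"
  have F: "ghom H act (freeM H s) \<rho> ?F" by (rule ext_ghom[OF H A(1) b])
  have im: "?F ` freeM H s = A"
  proof
    show "?F ` freeM H s \<subseteq> A" using ext_in[OF A(1), of s "f \<circ> bas"] b by blast
    show "A \<subseteq> ?F ` freeM H s"
    proof -
      have F': "ghom M act (freeM M s) \<rho> ?F"
        using ghom_subset[OF ghom_mono[OF F M(2)] freeM_mono[OF M(2) order_refl]] .
      have "f v = ?F v" if "v \<in> freeM M s" for v
        by (rule ghom_cong_bas[OF M(1) f(1) F' _ that]) (use ext_bas[of H \<rho> A "f \<circ> bas", OF A(1) b] in simp)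
      then show ?thesis unfolding f(2)[symmetric] using freeM_mono[OF M(2) order_refl] by force
    qed
  qed
  have "FP M act (ker_on (freeM H s) ?F)"
    by (rule FP_kernel_general[OF M(1) ghom_mono[OF F M(2)] FP_cosets[OF M(1) T(1,2), of s, folded T(3)]])
      (simp add: im A(2))
  then show ?thesis using F im ghom_kernel_gmod[OF F freeM_gmod[OF H] H] by blast
qed

text \<open>The invariant of the coinduction is to be an \<open>H\<close>-module that has a
  resolution over \<open>M\<close>.\<close>

lemma FP_finite_index:
  assumes H: "subgroup H G" and M: "subgroup M G" "M \<subseteq> H"
    and T: "finite T" "T \<subseteq> carrier G" "H = (\<Union>t\<in>T. M #> t)"
    and A: "gmod H \<rho> A" "FP M \<rho> A"
  shows "FP H \<rho> A"
proof -
  have U: "FPU H B" if B: "gmod H act B" "FP M act B" for B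
  proof (rule FPU_coinduct[of _ "{B. gmod H act B \<and> FP M act B}"])
    show "B \<in> {B. gmod H act B \<and> FP M act B}" using B by simp
    fix B assume "B \<in> {B. gmod H act B \<and> FP M act B}"
    then show "\<exists>r f. ghom H act (freeM H r) act f \<and> f ` freeM H r = B \<and>
      ker_on (freeM H r) f \<in> {B. gmod H act B \<and> FP M act B}"
      using FP_finite_index_cover[OF H M T, of act B] by simp
  qed
  obtain r f where "ghom H act (freeM H r) \<rho> f" "f ` freeM H r = A"
      "gmod H act (ker_on (freeM H r) f)" "FP M act (ker_on (freeM H r) f)"
    using FP_finite_index_cover[OF H M T A] by blast
  then show ?thesis unfolding FP_def[of H] using U by blast
qed

end

section \<open>Extension of scalars\<close>

lemma lookup_zmul: "Poly_Mapping.lookup (zmul k x) c = k * Poly_Mapping.lookup x c"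
proof -
  have "additive_on UNIV (\<lambda>x. Poly_Mapping.lookup x c)" "add_subgroup (UNIV :: ('a \<Rightarrow>\<^sub>0 int) set)"
    by (simp_all add: additive_on_def add_subgroup_def lookup_add)
  from additive_on_zmul[OF this, of x k] show ?thesis by simp
qed

text \<open>Pigeonhole; it turns a finite set of cosets stable under the parent map into a periodic
  coset.\<close>

lemma finite_iterate_repeats:
  assumes "finite S" "c \<in> S" "\<phi> ` S \<subseteq> S"
  obtains i j :: nat where "i < j" "(\<phi> ^^ i) c = (\<phi> ^^ j) c"
proof -
  have "(\<phi> ^^ n) c \<in> S" for n using assms(2,3) by (induction n) auto
  then have "range (\<lambda>n. (\<phi> ^^ n) c) \<subseteq> S" by blast
  then have "finite (range (\<lambda>n. (\<phi> ^^ n) c))" using assms(1) by (rule finite_subset)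
  then have "\<not> inj (\<lambda>n. (\<phi> ^^ n) c)" using finite_imageD infinite_UNIV_nat by blast
  then show ?thesis using that by (metis injI linorder_neqE_nat)
qed

section \<open>Slices along left cosets and induced modules\<close>

context group
begin

text \<open>The part of \<open>v\<close> on the left coset hM, translated back to \<open>M\<close>:
  the h-component in the decomposition of the group ring of \<open>H\<close> as a direct sum of the
  pieces h \<int>M.\<close>

definition slice :: "'a set \<Rightarrow> 'a \<Rightarrow> (nat \<Rightarrow> 'a \<Rightarrow> int) \<Rightarrow> nat \<Rightarrow> 'a \<Rightarrow> int" where
  "slice M h v = (\<lambda>i m. if m \<in> M then v i (h \<otimes> m) else 0)"

text \<open>For an \<open>M\<close>-submodule \<open>K\<close> this is the induced module, the
  tensor product of the group ring of \<open>H\<close> with \<open>K\<close> over that of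
  \<open>M\<close>, realised inside a free module. Asking for every \<open>h\<close>, not only for
  representatives, avoids a choice and costs nothing, since by \<open>slice_mult\<close> slices on
  one coset differ by the action of \<open>M\<close>.\<close>

definition induced :: "'a set \<Rightarrow> 'a set \<Rightarrow> nat \<Rightarrow> (nat \<Rightarrow> 'a \<Rightarrow> int) set \<Rightarrow> (nat \<Rightarrow> 'a \<Rightarrow> int) set" where
  "induced M H r K = {v\<in>freeM H r. \<forall>h\<in>H. slice M h v \<in> K}"

context
  fixes M H :: "'a set"
  assumes M: "subgroup M G" and H: "subgroup H G" and MH: "M \<subseteq> H"
begin

lemma in_carrier: "m \<in> M \<Longrightarrow> m \<in> carrier G" "h \<in> H \<Longrightarrow> h \<in> carrier G" "m \<in> M \<Longrightarrow> m \<in> H"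
  using subgroup.subset[OF M] subgroup.subset[OF H] MH by auto

lemma slice_additive: "additive_on A (slice M h)"
  by (auto simp: additive_on_def slice_def fun_eq_iff)

lemma slice_freeM:
  assumes v: "v \<in> freeM H r" and h: "h \<in> H"
  shows "slice M h v \<in> freeM M r"
proof -
  have "(\<lambda>(i, x). (i, h \<otimes> x)) ` supp (slice M h v) \<subseteq> supp v"
    by (auto simp: supp_def slice_def split: if_splits)
  moreover have "inj_on (\<lambda>(i, x). (i, h \<otimes> x)) (supp (slice M h v))"
    using h in_carrier by (auto simp: inj_on_def supp_def slice_def split: if_splits)
  ultimately have "finite (supp (slice M h v))"
    using v unfolding freeM_def by (metis (mono_tags, lifting) finite_imageD finite_subset mem_Collect_eq)
  moreover have "supp (slice M h v) \<subseteq> {..<r} \<times> M"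
    using v by (auto simp: freeM_def supp_def slice_def split: if_splits)
  ultimately show ?thesis by (simp add: freeM_def)
qed

lemma slice_act:
  assumes "h \<in> H" "g \<in> H" shows "slice M h (act g v) = slice M (inv g \<otimes> h) v"
  using assms in_carrier by (auto simp: slice_def act_def m_assoc fun_eq_iff)

lemma slice_mult:
  assumes "h \<in> H" "m \<in> M" shows "slice M (h \<otimes> m) v = act (inv m) (slice M h v)"
proof (intro HOL.ext)
  fix i x
  show "slice M (h \<otimes> m) v i x = act (inv m) (slice M h v) i x"
  proof (cases "x \<in> carrier G")
    case True
    have "inv (inv m) \<otimes> x \<in> M \<longleftrightarrow> x \<in> M"
      using inv_mult_mem_iff[OF M, of "inv m" x] True assms(2) subgroup.m_inv_closed[OF M] by blast
    then show ?thesis using True assms in_carrier by (auto simp: slice_def act_def m_assoc)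
  qed (use in_carrier in \<open>auto simp: slice_def act_def\<close>)
qed

lemma slice_one: "u \<in> freeM M r \<Longrightarrow> slice M \<one> u = u"
  using in_carrier(1) by (force simp: slice_def freeM_def supp_def fun_eq_iff)

lemma slice_free:
  assumes u: "u \<in> freeM M r" and k: "k \<in> H"
  shows "slice M k u = (if k \<in> M then act (inv k) u else 0)"
proof (cases "k \<in> M")
  case True
  have "slice M (\<one> \<otimes> k) u = act (inv k) (slice M \<one> u)"
    using True subgroup.one_closed[OF H] by (rule slice_mult[rotated])
  then show ?thesis using True slice_one[OF u] in_carrier k by simp
next
  case False
  have "u i (k \<otimes> m) = 0" if m: "m \<in> M" for i m
  proof (rule ccontr)
    assume "u i (k \<otimes> m) \<noteq> 0"
    then have "k \<otimes> m \<in> M" using u by (auto simp: freeM_def supp_def)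
    then have "(k \<otimes> m) \<otimes> inv m \<in> M" using m subgroup.m_closed[OF M] subgroup.m_inv_closed[OF M] by blast
    then show False using False m k in_carrier by (simp add: m_assoc)
  qed
  then show ?thesis using False by (auto simp: slice_def fun_eq_iff)
qed

lemma slice_zeroD: assumes v: "v \<in> freeM H r" and z: "\<And>h. h \<in> H \<Longrightarrow> slice M h v = 0" shows "v = 0"
proof (intro HOL.ext)
  fix i x
  show "v i x = 0 i x"
  proof (cases "x \<in> H")
    case True
    have "slice M x v i \<one> = 0" using z[OF True] by simp
    then show ?thesis using True in_carrier subgroup.one_closed[OF M] by (simp add: slice_def)
  next
    case False
    then show ?thesis using v by (auto simp: freeM_def supp_def)
  qed
qed

text \<open>Extending scalars from \<open>M\<close> to \<open>H\<close> acts slicewise, because the group ring of \<open>H\<close> is a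
  free right module over that of \<open>M\<close> on coset representatives.\<close>

lemma slice_ext:
  assumes f: "ghom M act (freeM M s) act f" "f ` freeM M s \<subseteq> freeM M r"
    and v: "v \<in> freeM H s" and h: "h \<in> H"
  shows "slice M h (ext act (f \<circ> bas) v) = f (slice M h v)"
proof -
  have fb: "f (bas i) \<in> freeM M r" if "i < s" for i using f(2) bas_freeM[OF M that] by auto
  have fb': "(f \<circ> bas) i \<in> freeM H r" if "i < s" for i
    using fb[OF that] freeM_mono[OF MH order_refl] by auto
  have F: "ghom H act (freeM H s) act (ext act (f \<circ> bas))"
    by (rule ext_ghom[OF H freeM_gmod[OF H] fb'])
  show ?thesis
  proof (rule additive_cong_free[OF H _ _ _ v])
    show "additive_on (freeM H s) (\<lambda>v. slice M h (ext act (f \<circ> bas) v))"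
      using ghomD(1)[OF F] slice_additive[of UNIV h] by (simp add: additive_on_def)
    show "additive_on (freeM H s) (\<lambda>v. f (slice M h v))"
      using additive_onD(1)[OF ghomD(1)[OF f(1)] freeM_add_subgroup] slice_additive[of UNIV h] slice_freeM[OF _ h]
      by (simp add: additive_on_def)
    fix g i assume g: "g \<in> H" and i: "i < s"
    have gh: "inv g \<otimes> h \<in> H" using g h subgroup.m_closed[OF H] subgroup.m_inv_closed[OF H] by blast
    have bM: "bas i \<in> freeM M s" and bH: "bas i \<in> freeM H s" using bas_freeM[OF M i] bas_freeM[OF H i] by blast+
    have "ext act (f \<circ> bas) (act g (bas i)) = act g (f (bas i))"
      using ghomD(2)[OF F g bH] ext_bas[of H act _ "f \<circ> bas" i, OF freeM_gmod[OF H] fb'[OF i]] by simp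
    then have 1: "slice M h (ext act (f \<circ> bas) (act g (bas i))) = slice M (inv g \<otimes> h) (f (bas i))"
      using slice_act[OF h g] by simp
    have "f (slice M (inv g \<otimes> h) (bas i)) = slice M (inv g \<otimes> h) (f (bas i))"
    proof (cases "inv g \<otimes> h \<in> M")
      case True
      then show ?thesis
        using slice_free[OF bM gh] slice_free[OF fb[OF i] gh] ghomD(2)[OF f(1) _ bM]
          subgroup.m_inv_closed[OF M] by simp
    next
      case False
      then show ?thesis
        using slice_free[OF bM gh] slice_free[OF fb[OF i] gh]
          additive_onD(2)[OF ghomD(1)[OF f(1)] freeM_add_subgroup] by simp
    qed
    then show "slice M h (ext act (f \<circ> bas) (act g (bas i))) = f (slice M h (act g (bas i)))"
      using 1 slice_act[OF h g] by simp
  qed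
qed

text \<open>Induction preserves surjections: preimages are chosen slice by slice, one per left
  coset, and glued to a single finitely supported vector.\<close>

lemma induced_surj:
  assumes f: "ghom M act (freeM M s) act f" and v: "v \<in> freeM H r"
    and im: "\<And>h. h \<in> H \<Longrightarrow> slice M h v \<in> f ` freeM M s"
  obtains u where "u \<in> freeM H s" "\<And>h. h \<in> H \<Longrightarrow> f (slice M h u) = slice M h v"
proof -
  have f0: "f 0 = 0" by (rule additive_onD(2)[OF ghomD(1)[OF f] freeM_add_subgroup])
  \<comment> \<open>Choosing 0 over a zero slice is what makes the glued vector finitely
    supported.\<close>
  have "\<forall>h\<in>H. \<exists>w. w \<in> freeM M s \<and> f w = slice M h v \<and> (slice M h v = 0 \<longrightarrow> w = 0)"
    using im f0 add_subgroupD(1)[OF freeM_add_subgroup] by (metis imageE)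
  then obtain w where w: "\<And>h. h \<in> H \<Longrightarrow> w h \<in> freeM M s" "\<And>h. h \<in> H \<Longrightarrow> f (w h) = slice M h v"
    "\<And>h. h \<in> H \<Longrightarrow> slice M h v = 0 \<Longrightarrow> w h = 0" by metis
  \<comment> \<open>The choice depends on \<open>h\<close> only through the set hM, so equal cosets
    receive the same representative.\<close>
  define rep where "rep h = (SOME y. y \<in> l_coset G h M)" for h
  have rep: "rep h \<in> H" "inv (rep h) \<otimes> h \<in> M" if h: "h \<in> H" for h
  proof -
    have "h \<otimes> \<one> \<in> l_coset G h M" using subgroup.one_closed[OF M] by (auto simp: l_coset_def)
    then have "rep h \<in> l_coset G h M" unfolding rep_def by (rule someI)
    then obtain m where m: "m \<in> M" "rep h = h \<otimes> m" by (auto simp: l_coset_def)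
    then show "rep h \<in> H" using h in_carrier subgroup.m_closed[OF H] by simp
    have "inv (rep h) \<otimes> h = inv m" using m h in_carrier by (simp add: inv_mult_group m_assoc)
    then show "inv (rep h) \<otimes> h \<in> M" using m subgroup.m_inv_closed[OF M] by simp
  qed
  have rep_mult: "rep (h \<otimes> m) = rep h" if "h \<in> H" "m \<in> M" for h m
  proof -
    have "l_coset G (h \<otimes> m) M = l_coset G h (l_coset G m M)"
      using lcos_m_assoc[OF subgroup.subset[OF M]] in_carrier that by simp
    also have "l_coset G m M = M" using coset_join3 that(2) M in_carrier(1) by blast
    finally show ?thesis by (simp add: rep_def)
  qed
  define u where "u i x = (if x \<in> H then w (rep x) i (inv (rep x) \<otimes> x) else 0)" for i x
  have sl: "slice M h u = act (inv (inv (rep h) \<otimes> h)) (w (rep h))" if h: "h \<in> H" for h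
  proof (intro HOL.ext)
    fix i m
    let ?n = "inv (rep h) \<otimes> h"
    have n: "?n \<in> M" and r: "rep h \<in> H" using rep[OF h] by blast+
    show "slice M h u i m = act (inv ?n) (w (rep h)) i m"
    proof (cases "m \<in> M")
      case True
      then have "h \<otimes> m \<in> H" using h in_carrier subgroup.m_closed[OF H] by blast
      then show ?thesis
        using True h n r in_carrier rep_mult[OF h True] by (simp add: slice_def act_def u_def m_assoc)
    next
      case False
      have "act (inv ?n) (w (rep h)) \<in> freeM M s"
        using gmodD(3)[OF freeM_gmod[OF M]] w(1)[OF r] n subgroup.m_inv_closed[OF M] by blast
      then have "act (inv ?n) (w (rep h)) i m = 0" using False by (auto simp: freeM_def supp_def)
      then show ?thesis using False by (simp add: slice_def)
    qed
  qed
  have 1: "f (slice M h u) = slice M h v" if h: "h \<in> H" for h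
  proof -
    let ?n = "inv (rep h) \<otimes> h"
    have n: "?n \<in> M" and r: "rep h \<in> H" using rep[OF h] by blast+
    have "f (slice M h u) = act (inv ?n) (slice M (rep h) v)"
      using sl[OF h] ghomD(2)[OF f _ w(1)[OF r]] w(2)[OF r] n subgroup.m_inv_closed[OF M] by simp
    also have "\<dots> = slice M (rep h \<otimes> ?n) v" by (rule slice_mult[OF r n, symmetric])
    also have "rep h \<otimes> ?n = h" using h r in_carrier by (simp add: m_assoc[symmetric])
    finally show ?thesis .
  qed
  \<comment> \<open>Only the finitely many cosets that meet the support of \<open>v\<close>
    contribute, each through the finite support of its chosen preimage.\<close>
  let ?S = "\<Union>y\<in>rep ` snd ` supp v. (\<lambda>(i, m). (i, y \<otimes> m)) ` supp (w y)"
  have fv: "finite (supp v)" and sv: "supp v \<subseteq> UNIV \<times> H" using v by (auto simp: freeM_def)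
  have "supp u \<subseteq> ?S"
  proof clarify
    fix i x assume "(i, x) \<in> supp u"
    then have x: "x \<in> H" "w (rep x) i (inv (rep x) \<otimes> x) \<noteq> 0" by (auto simp: supp_def u_def split: if_splits)
    have r: "rep x \<in> H" using rep x by blast
    have "slice M (rep x) v \<noteq> 0" using w(3)[OF r] x(2) by auto
    then obtain j m where jm: "slice M (rep x) v j m \<noteq> 0" by (metis HOL.ext zero_fun_apply)
    then have m: "m \<in> M" "(j, rep x \<otimes> m) \<in> supp v" by (auto simp: slice_def supp_def split: if_splits)
    have "rep (rep x \<otimes> m) = rep (x \<otimes> inv (inv (rep x) \<otimes> x))"
      using rep_mult[OF r m(1)] x r in_carrier by (simp add: inv_mult_group m_assoc[symmetric])
    also have "\<dots> = rep x" using rep_mult[OF x(1)] rep[OF x(1)] subgroup.m_inv_closed[OF M] by blast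
    finally have "rep x = rep (snd (j, rep x \<otimes> m))" by simp
    then have "rep x \<in> rep ` snd ` supp v" using m(2) by (intro image_eqI) auto
    moreover have "(i, x) = (\<lambda>(i, m). (i, rep x \<otimes> m)) (i, inv (rep x) \<otimes> x)"
      using x r in_carrier by (simp add: m_assoc[symmetric])
    moreover have "(i, inv (rep x) \<otimes> x) \<in> supp (w (rep x))" using x by (simp add: supp_def)
    ultimately show "(i, x) \<in> ?S" by blast
  qed
  moreover have "finite ?S"
  proof (intro finite_UN_I finite_imageI fv)
    fix y assume "y \<in> rep ` snd ` supp v"
    then have "y \<in> H" using sv rep by auto
    then show "finite (supp (w y))" using w(1) by (simp add: freeM_def)
  qed
  ultimately have fin: "finite (supp u)" by (rule finite_subset)
  have "supp u \<subseteq> {..<s} \<times> H"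
  proof clarify
    fix i x assume "(i, x) \<in> supp u"
    then have x: "x \<in> H" "w (rep x) i (inv (rep x) \<otimes> x) \<noteq> 0" by (auto simp: supp_def u_def split: if_splits)
    then show "i \<in> {..<s} \<and> x \<in> H" using w(1)[OF rep(1)[OF x(1)]] by (auto simp: freeM_def supp_def)
  qed
  then have "u \<in> freeM H s" using fin by (simp add: freeM_def)
  then show ?thesis using that 1 by blast
qed

text \<open>Induction is exact: a cover of \<open>K\<close> over \<open>M\<close> extends to a cover
  of the induced module over \<open>H\<close>, whose kernel is induced from the kernel of the
  original cover. Hence the induced modules form a family closed under taking kernels.\<close>

lemma FPU_induced:
  assumes "FPU M K" "K \<subseteq> freeM M r" shows "FPU H (induced M H r K)"
proof (rule FPU_coinduct[of _ "{induced M H r K | r K. FPU M K \<and> K \<subseteq> freeM M r}"])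
  show "induced M H r K \<in> {induced M H r K | r K. FPU M K \<and> K \<subseteq> freeM M r}" using assms by blast
  fix B assume "B \<in> {induced M H r K | r K. FPU M K \<and> K \<subseteq> freeM M r}"
  then obtain r K where B: "B = induced M H r K" and K: "FP M act K" "K \<subseteq> freeM M r"
    unfolding FPU_iff_FP by blast
  obtain s f where f: "ghom M act (freeM M s) act f" "f ` freeM M s = K"
    and k: "FPU M (ker_on (freeM M s) f)" using K(1) unfolding FP_def by blast
  let ?F = "ext act (f \<circ> bas)"
  have fr: "f ` freeM M s \<subseteq> freeM M r" using f K by simp
  have fb: "(f \<circ> bas) i \<in> freeM H r" if "i < s" for i
    using bas_freeM[OF M that] fr freeM_mono[OF MH order_refl] by auto
  have F: "ghom H act (freeM H s) act ?F" by (rule ext_ghom[OF H freeM_gmod[OF H] fb])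
  have Fr: "?F v \<in> freeM H r" if "v \<in> freeM H s" for v
    using ext_in[OF freeM_gmod[OF H], of s "f \<circ> bas"] fb that by blast
  note sl = slice_ext[OF f(1) fr]
  have "?F ` freeM H s = B"
  proof (intro equalityI subsetI)
    fix y assume "y \<in> ?F ` freeM H s"
    then obtain v where v: "v \<in> freeM H s" "y = ?F v" by blast
    then have "slice M h y \<in> K" if "h \<in> H" for h
      using sl[OF v(1) that] slice_freeM[OF v(1) that] f(2) by blast
    then show "y \<in> B" unfolding B induced_def using Fr v by blast
  next
    fix y assume "y \<in> B"
    then have y: "y \<in> freeM H r" "\<And>h. h \<in> H \<Longrightarrow> slice M h y \<in> f ` freeM M s"
      unfolding B induced_def f(2) by blast+
    obtain u where u: "u \<in> freeM H s" "\<And>h. h \<in> H \<Longrightarrow> f (slice M h u) = slice M h y"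
      using induced_surj[OF f(1) y] by blast
    have "?F u - y = 0"
    proof (rule slice_zeroD)
      show "?F u - y \<in> freeM H r" using Fr u(1) y(1) add_subgroupD(2)[OF freeM_add_subgroup] by blast
      show "slice M h (?F u - y) = 0" if "h \<in> H" for h
        using additive_onD(4)[OF slice_additive[of "freeM H r"] freeM_add_subgroup] Fr u y(1) sl that by simp
    qed
    then show "y \<in> ?F ` freeM H s" using u(1) by force
  qed
  moreover have "ker_on (freeM H s) ?F = induced M H s (ker_on (freeM M s) f)"
  proof (intro equalityI subsetI)
    fix v assume v: "v \<in> ker_on (freeM H s) ?F"
    have "f (slice M h v) = 0" if "h \<in> H" for h
    proof -
      have "f (slice M h v) = slice M h 0" using sl[OF _ that, of v] v by simp
      then show ?thesis by (simp add: slice_def fun_eq_iff)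
    qed
    then show "v \<in> induced M H s (ker_on (freeM M s) f)"
      unfolding induced_def using v slice_freeM by simp
  next
    fix v assume v: "v \<in> induced M H s (ker_on (freeM M s) f)"
    then have "?F v = 0" using slice_zeroD[OF Fr] sl unfolding induced_def by simp
    then show "v \<in> ker_on (freeM H s) ?F" using v unfolding induced_def by simp
  qed
  moreover have "induced M H s (ker_on (freeM M s) f) \<in> {induced M H r K | r K. FPU M K \<and> K \<subseteq> freeM M r}"
    using k by blast
  ultimately show "\<exists>r f. ghom H act (freeM H r) act f \<and> f ` freeM H r = B \<and>
      ker_on (freeM H r) f \<in> {induced M H r K | r K. FPU M K \<and> K \<subseteq> freeM M r}"
    using F by (intro exI[of _ s] exI[of _ ?F]) simp
qed

end

end

section \<open>Ascending HNN extensions\<close>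

context group
begin

definition FP_group :: "'a set \<Rightarrow> bool" where
  "FP_group H \<longleftrightarrow> FP H (\<lambda>_ n. n) (UNIV :: int set)"

lemma gmod_trivial: "gmod H (\<lambda>_ n. n) (UNIV :: int set)"
  by (simp add: gmod_def add_subgroup_def additive_on_def)

section \<open>The permutation module on the left cosets\<close>

definition ctrans :: "'a \<Rightarrow> ('a set \<Rightarrow>\<^sub>0 int) \<Rightarrow> ('a set \<Rightarrow>\<^sub>0 int)" where
  "ctrans g = frag_extend (\<lambda>C. frag_of (l_coset G g C))"

definition cfrags :: "'a set \<Rightarrow> 'a set \<Rightarrow> ('a set \<Rightarrow>\<^sub>0 int) set" where
  "cfrags M H = {b. Poly_Mapping.keys b \<subseteq> (\<lambda>h. l_coset G h M) ` H}"

context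
  fixes M H :: "'a set"
  assumes M: "subgroup M G" and H: "subgroup H G" and MH: "M \<subseteq> H"
begin

lemmas inc = in_carrier[OF M H MH]

lemma lcoset_eq_iff:
  assumes "g \<in> H" "h \<in> H"
  shows "l_coset G g M = l_coset G h M \<longleftrightarrow> inv g \<otimes> h \<in> M"
proof
  assume eq: "l_coset G g M = l_coset G h M"
  have "h \<otimes> \<one> \<in> l_coset G h M" using subgroup.one_closed[OF M] unfolding l_coset_def by blast
  then have "h \<in> l_coset G g M" using eq assms inc by simp
  then obtain m where m: "m \<in> M" "h = g \<otimes> m" unfolding l_coset_def by blast
  then show "inv g \<otimes> h \<in> M" using assms inc by (simp add: m_assoc[symmetric])
next
  assume m: "inv g \<otimes> h \<in> M"
  have "l_coset G h M = l_coset G (g \<otimes> (inv g \<otimes> h)) M" using assms inc by (simp add: m_assoc[symmetric])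
  also have "\<dots> = l_coset G g (l_coset G (inv g \<otimes> h) M)"
    using lcos_m_assoc[OF subgroup.subset[OF M]] inc assms m by simp
  also have "l_coset G (inv g \<otimes> h) M = M" using coset_join3 m M inc(1) by blast
  finally show "l_coset G g M = l_coset G h M" by simp
qed

lemma ctrans_additive: "additive_on A (ctrans g)"
  by (simp add: additive_on_def ctrans_def frag_extend_add)

lemma ctrans_of: "g \<in> H \<Longrightarrow> h \<in> H \<Longrightarrow> ctrans g (frag_of (l_coset G h M)) = frag_of (l_coset G (g \<otimes> h) M)"
  using lcos_m_assoc[OF subgroup.subset[OF M]] inc by (simp add: ctrans_def)

lemma cfrags_add_subgroup: "add_subgroup (cfrags M H)"
proof -
  have "Poly_Mapping.keys (u - v) \<subseteq> (\<lambda>h. l_coset G h M) ` H"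
    if "Poly_Mapping.keys u \<subseteq> (\<lambda>h. l_coset G h M) ` H" "Poly_Mapping.keys v \<subseteq> (\<lambda>h. l_coset G h M) ` H"
    for u v :: "'a set \<Rightarrow>\<^sub>0 int"
    using that keys_diff[of u v] by blast
  then show ?thesis by (auto simp: add_subgroup_def cfrags_def)
qed

lemma frag_of_cfrags: "h \<in> H \<Longrightarrow> frag_of (l_coset G h M) \<in> cfrags M H"
  by (auto simp: cfrags_def)

lemma cfrags_induct [consumes 1, case_names zero one diff]:
  assumes "b \<in> cfrags M H" "P 0" "\<And>h. h \<in> H \<Longrightarrow> P (frag_of (l_coset G h M))"
    "\<And>a b. P a \<Longrightarrow> P b \<Longrightarrow> P (a - b)"
  shows "P b"
proof -
  have "Poly_Mapping.keys b \<subseteq> (\<lambda>h. l_coset G h M) ` H" using assms(1) by (simp add: cfrags_def)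
  then show ?thesis by (induction rule: frag_induction) (use assms in auto)
qed

lemma cfrags_gmod: "gmod H ctrans (cfrags M H)"
  unfolding gmod_def
proof (intro conjI ballI)
  show "add_subgroup (cfrags M H)" by (rule cfrags_add_subgroup)
  note D = add_subgroupD[OF cfrags_add_subgroup]
  have diff: "ctrans g (a - b) = ctrans g a - ctrans g b" for g a b
    by (simp add: ctrans_def frag_extend_diff)
  have zero: "ctrans g 0 = 0" for g by (simp add: ctrans_def)
  fix g assume g: "g \<in> H"
  show "additive_on (cfrags M H) (ctrans g)" by (rule ctrans_additive)
  show "ctrans g ` cfrags M H \<subseteq> cfrags M H"
  proof clarify
    fix b assume "b \<in> cfrags M H"
    then show "ctrans g b \<in> cfrags M H"
      by (induction rule: cfrags_induct)
        (use g subgroup.m_closed[OF H] D in \<open>auto simp: diff zero ctrans_of frag_of_cfrags\<close>)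
  qed
  fix h b assume h: "h \<in> H" and b: "b \<in> cfrags M H"
  show "ctrans (g \<otimes> h) b = ctrans g (ctrans h b)"
    using b by (induction rule: cfrags_induct)
      (use g h inc subgroup.m_closed[OF H] in \<open>auto simp: diff zero ctrans_of m_assoc\<close>)
next
  have diff: "ctrans g (a - b) = ctrans g a - ctrans g b" for g a b
    by (simp add: ctrans_def frag_extend_diff)
  fix b assume "b \<in> cfrags M H"
  then show "ctrans \<one> b = b"
    by (induction rule: cfrags_induct)
      (use inc subgroup.one_closed[OF H] in \<open>auto simp: diff ctrans_of, auto simp: ctrans_def\<close>)
qed

text \<open>The permutation module is induced from the trivial \<open>M\<close>-module. Concretely,
  a cover \<open>f\<close> of \<int> gives the cover sending \<open>bas i\<close> to
  \<open>f (bas i)\<close> times the coset \<open>M\<close>; its coefficient at hM is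
  \<open>f\<close> of the h-slice, so its kernel is induced from the kernel of
  \<open>f\<close>.\<close>

lemma FP_cfrags:
  assumes "FP_group M" shows "FP H ctrans (cfrags M H)"
proof -
  obtain s f where f: "ghom M act (freeM M s) (\<lambda>_ n. n) f" "f ` freeM M s = (UNIV :: int set)"
    "FPU M (ker_on (freeM M s) f)" using assms unfolding FP_group_def FP_def by blast
  note fD = additive_onD[OF ghomD(1)[OF f(1)] freeM_add_subgroup]
  define e where "e i = zmul (f (bas i)) (frag_of M)" for i
  have M1: "l_coset G \<one> M = M" using lcos_mult_one subgroup.subset[OF M] by blast
  have fM: "frag_of M \<in> cfrags M H" using frag_of_cfrags[OF subgroup.one_closed[OF H]] M1 by simp
  then have e: "e i \<in> cfrags M H" for i
    unfolding e_def by (intro add_subgroup_zmul[OF cfrags_add_subgroup])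
  let ?F = "ext ctrans e"
  have F: "ghom H act (freeM H s) ctrans ?F" by (rule ext_ghom[OF H cfrags_gmod e])
  have Fin: "?F v \<in> cfrags M H" if "v \<in> freeM H s" for v using ext_in[OF cfrags_gmod e that] .
  have key: "Poly_Mapping.lookup (?F v) (l_coset G h M) = f (slice M h v)"
    if h: "h \<in> H" and v: "v \<in> freeM H s" for h v
  proof (rule additive_cong_free[OF H _ _ _ v])
    show "additive_on (freeM H s) (\<lambda>v. Poly_Mapping.lookup (?F v) (l_coset G h M))"
      using ghomD(1)[OF F] by (simp add: additive_on_def lookup_add)
    show "additive_on (freeM H s) (\<lambda>v. f (slice M h v))"
      using fD(1) slice_additive[OF M H MH, of UNIV h] slice_freeM[OF M H MH _ h]
      by (simp add: additive_on_def)
    fix g i assume g: "g \<in> H" and i: "i < s"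
    have gh: "inv g \<otimes> h \<in> H" using g h subgroup.m_closed[OF H] subgroup.m_inv_closed[OF H] by blast
    have bM: "bas i \<in> freeM M s" and bH: "bas i \<in> freeM H s" using bas_freeM[OF M i] bas_freeM[OF H i] by blast+
    have "?F (act g (bas i)) = ctrans g (e i)"
      using ghomD(2)[OF F g bH] ext_bas[OF cfrags_gmod e] by simp
    also have "\<dots> = zmul (f (bas i)) (ctrans g (frag_of M))"
      unfolding e_def by (rule additive_on_zmul[OF ctrans_additive cfrags_add_subgroup fM])
    also have "ctrans g (frag_of M) = frag_of (l_coset G g M)"
      by (simp add: ctrans_def)
    finally have "Poly_Mapping.lookup (?F (act g (bas i))) (l_coset G h M) =
        (if inv g \<otimes> h \<in> M then f (bas i) else 0)"
      using lcoset_eq_iff[OF g h] by (auto simp: lookup_zmul)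
    also have "\<dots> = f (slice M h (act g (bas i)))"
      using slice_act[OF M H MH h g] slice_free[OF M H MH bM gh] ghomD(2)[OF f(1) _ bM]
        subgroup.m_inv_closed[OF M] fD(2) by simp
    finally show "Poly_Mapping.lookup (?F (act g (bas i))) (l_coset G h M) = f (slice M h (act g (bas i)))" .
  qed
  have zero: "b = 0" if b: "b \<in> cfrags M H" and z: "\<And>h. h \<in> H \<Longrightarrow> Poly_Mapping.lookup b (l_coset G h M) = 0" for b
  proof (rule poly_mapping_eqI)
    fix C
    show "Poly_Mapping.lookup b C = Poly_Mapping.lookup 0 C"
    proof (cases "C \<in> Poly_Mapping.keys b")
      case True
      then show ?thesis using b z by (auto simp: cfrags_def)
    qed (simp add: in_keys_iff)
  qed
  have ker: "ker_on (freeM H s) ?F = induced M H s (ker_on (freeM M s) f)"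
  proof (intro equalityI subsetI)
    fix v assume v: "v \<in> ker_on (freeM H s) ?F"
    then have "f (slice M h v) = 0" if "h \<in> H" for h using key[OF that, of v] by simp
    then show "v \<in> induced M H s (ker_on (freeM M s) f)"
      unfolding induced_def using v slice_freeM[OF M H MH] by simp
  next
    fix v assume v: "v \<in> induced M H s (ker_on (freeM M s) f)"
    then have "?F v = 0" using zero[OF Fin] key unfolding induced_def by simp
    then show "v \<in> ker_on (freeM H s) ?F" using v unfolding induced_def by simp
  qed
  have im: "?F ` freeM H s = cfrags M H"
  proof
    show "?F ` freeM H s \<subseteq> cfrags M H" using Fin by blast
    have g: "gmod H ctrans (?F ` freeM H s)" by (rule ghom_image_gmod[OF F freeM_gmod[OF H] H])
    note gD = add_subgroupD[OF gmodD(1)[OF g]]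
    have "(1::int) \<in> f ` freeM M s" using f(2) by simp
    \<comment> \<open>Supported in \<open>M\<close> and of value 1, this vector has value 1 on the
      slices at elements of \<open>M\<close> and 0 on all others, so it hits exactly the coset
      \<open>M\<close>; translates give the rest.\<close>
    then obtain u where u: "u \<in> freeM M s" "f u = 1" by force
    have uH: "u \<in> freeM H s" using u(1) freeM_mono[OF MH order_refl] by blast
    have "?F u - frag_of M = 0"
    proof (rule zero)
      show "?F u - frag_of M \<in> cfrags M H"
        using Fin[OF uH] fM add_subgroupD(2)[OF cfrags_add_subgroup] by blast
      fix h assume h: "h \<in> H"
      have "l_coset G h M = M \<longleftrightarrow> h \<in> M"
        using lcoset_eq_iff[OF subgroup.one_closed[OF H] h] M1 inc h by auto
      then show "Poly_Mapping.lookup (?F u - frag_of M) (l_coset G h M) = 0"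
        using key[OF h uH] slice_free[OF M H MH u(1) h] ghomD(2)[OF f(1) _ u(1)]
          subgroup.m_inv_closed[OF M] fD(2) u(2) by (simp add: lookup_minus)
    qed
    then have "frag_of M \<in> ?F ` freeM H s" using uH by force
    then have one: "frag_of (l_coset G h M) \<in> ?F ` freeM H s" if "h \<in> H" for h
    proof -
      have "ctrans h (frag_of M) = frag_of (l_coset G h M)" by (simp add: ctrans_def)
      then show ?thesis using gmodD(3)[OF g that \<open>frag_of M \<in> ?F ` freeM H s\<close>] by simp
    qed
    show "cfrags M H \<subseteq> ?F ` freeM H s"
    proof
      fix b assume "b \<in> cfrags M H"
      then show "b \<in> ?F ` freeM H s" by (induction rule: cfrags_induct) (fact gD(1), fact one, fact gD(2))
    qed
  qed
  have "FPU H (ker_on (freeM H s) ?F)"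
    unfolding ker by (rule FPU_induced[OF M H MH f(3)]) blast
  then show ?thesis unfolding FP_def using F im by blast
qed

end

section \<open>Normal forms in the group generated by \<open>M\<close> and \<open>x\<close>\<close>

context
  fixes M :: "'a set" and x :: 'a
  assumes M: "subgroup M G" and x: "x \<in> carrier G" and xM: "\<And>m. m \<in> M \<Longrightarrow> x \<otimes> m \<otimes> inv x \<in> M"
begin

lemma M_carrier: "m \<in> M \<Longrightarrow> m \<in> carrier G"
  using subgroup.subset[OF M] by blast

lemma conj_pow:
  assumes "m \<in> M" shows "x [^] (n::nat) \<otimes> m \<otimes> inv (x [^] n) \<in> M"
proof (induction n)
  case (Suc n)
  have "x [^] Suc n \<otimes> m \<otimes> inv (x [^] Suc n) = x \<otimes> (x [^] n \<otimes> m \<otimes> inv (x [^] n)) \<otimes> inv x"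
    using x M_carrier[OF assms] by (simp only: nat_pow_Suc2[OF x]) (simp add: inv_mult_group m_assoc)
  then show ?case using xM[OF Suc] by simp
qed (use assms M_carrier in simp)

text \<open>The elements x^-k m x^n. These exhaust the generated group because x m = (x m x^-1) x
  moves positive powers of \<open>x\<close> to the right, and, inverted, negative ones to the
  left.\<close>

definition HNN_set :: "'a set" where
  "HNN_set = {h\<in>carrier G. \<exists>(k::nat) (n::nat). x [^] k \<otimes> h \<otimes> inv (x [^] n) \<in> M}"

text \<open>Both exponents may be raised by the same amount, since positive powers of
  \<open>x\<close> also conjugate \<open>M\<close> into itself; this provides common
  exponents.\<close>

lemma HNN_raise:
  fixes k l n :: nat
  assumes h: "h \<in> carrier G" and m: "x [^] k \<otimes> h \<otimes> inv (x [^] n) \<in> M"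
  shows "x [^] (l + k) \<otimes> h \<otimes> inv (x [^] (l + n)) \<in> M"
proof -
  have "x [^] (l + k) \<otimes> h \<otimes> inv (x [^] (l + n)) =
    x [^] l \<otimes> (x [^] k \<otimes> h \<otimes> inv (x [^] n)) \<otimes> inv (x [^] l)"
    unfolding nat_pow_mult[OF x, symmetric] using x h by (simp add: inv_mult_group m_assoc)
  then show ?thesis using conj_pow[OF m] by simp
qed

lemma HNN_set_subgroup: "subgroup HNN_set G"
proof (rule subgroupI)
  show "HNN_set \<subseteq> carrier G" by (auto simp: HNN_set_def)
  have "x [^] (0::nat) \<otimes> \<one> \<otimes> inv (x [^] (0::nat)) \<in> M" using subgroup.one_closed[OF M] by simp
  then have "\<one> \<in> HNN_set" unfolding HNN_set_def by blast
  then show "HNN_set \<noteq> {}" by blast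
  fix a assume "a \<in> HNN_set"
  then obtain k n :: nat where a: "a \<in> carrier G" "x [^] k \<otimes> a \<otimes> inv (x [^] n) \<in> M" by (auto simp: HNN_set_def)
  have "inv (x [^] k \<otimes> a \<otimes> inv (x [^] n)) = x [^] n \<otimes> inv a \<otimes> inv (x [^] k)"
    using a x by (simp add: inv_mult_group m_assoc)
  then have "x [^] n \<otimes> inv a \<otimes> inv (x [^] k) \<in> M" using subgroup.m_inv_closed[OF M a(2)] by simp
  then show "inv a \<in> HNN_set" using a unfolding HNN_set_def by blast
  fix b assume "b \<in> HNN_set"
  then obtain k' n' :: nat where b: "b \<in> carrier G" "x [^] k' \<otimes> b \<otimes> inv (x [^] n') \<in> M" by (auto simp: HNN_set_def)
  \<comment> \<open>Raising \<open>a\<close> by k' and \<open>b\<close> by n makes the inner powers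
    of \<open>x\<close> cancel.\<close>
  have "(x [^] (k' + k) \<otimes> a \<otimes> inv (x [^] (k' + n))) \<otimes> (x [^] (n + k') \<otimes> b \<otimes> inv (x [^] (n + n'))) \<in> M"
    using HNN_raise[OF a, of k'] HNN_raise[OF b, of n] subgroup.m_closed[OF M] by blast
  moreover have "inv (x [^] (k' + n)) \<otimes> (x [^] (n + k') \<otimes> (b \<otimes> inv (x [^] (n + n')))) = b \<otimes> inv (x [^] (n + n'))"
    using x b by (simp add: add.commute[of n k'] m_assoc[symmetric])
  ultimately have "x [^] (k' + k) \<otimes> (a \<otimes> b) \<otimes> inv (x [^] (n + n')) \<in> M"
    using a b x by (simp add: m_assoc)
  then show "a \<otimes> b \<in> HNN_set" using a b unfolding HNN_set_def by blast
qed

lemma HNN_set_eq: "generate G (insert x M) = HNN_set"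
proof
  have "x [^] (0::nat) \<otimes> x \<otimes> inv (x [^] (1::nat)) \<in> M" using x subgroup.one_closed[OF M] by simp
  then have "x \<in> HNN_set" using x unfolding HNN_set_def by blast
  moreover have "m \<in> HNN_set" if "m \<in> M" for m
  proof -
    have "x [^] (0::nat) \<otimes> m \<otimes> inv (x [^] (0::nat)) \<in> M" using that M_carrier by simp
    then show ?thesis using that M_carrier unfolding HNN_set_def by blast
  qed
  ultimately show "generate G (insert x M) \<subseteq> HNN_set"
    by (intro generate_subgroup_incl HNN_set_subgroup) blast
  let ?H = "generate G (insert x M)"
  have sub: "subgroup ?H G" using x M_carrier by (intro generate_is_subgroup) auto
  have xH: "x \<in> ?H" and MH: "M \<subseteq> ?H" by (auto intro: generate.incl)
  show "HNN_set \<subseteq> ?H"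
  proof
    fix h assume "h \<in> HNN_set"
    then obtain k n :: nat where h: "h \<in> carrier G" "x [^] k \<otimes> h \<otimes> inv (x [^] n) \<in> M" by (auto simp: HNN_set_def)
    have p: "x [^] (n::nat) \<in> ?H" for n
      by (induction n) (use xH subgroup.one_closed[OF sub] subgroup.m_closed[OF sub] in auto)
    have "h = inv (x [^] k) \<otimes> (x [^] k \<otimes> h \<otimes> inv (x [^] n)) \<otimes> x [^] n"
      using h x by (simp add: m_assoc) (simp add: m_assoc[symmetric])
    also have "\<dots> \<in> ?H"
      by (intro subgroup.m_closed[OF sub] subgroup.m_inv_closed[OF sub] p subsetD[OF MH h(2)])
    finally show "h \<in> ?H" .
  qed
qed

end

end

lemma zmul_diff_left: "zmul (k - l) v = zmul k v - zmul l v"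
  using zmul_add[of k "- l" v] by (simp add: zmul_minus)

section \<open>The two kinds of ascending step\<close>

context group
begin

context
  fixes M :: "'a set" and x :: 'a
  assumes M: "subgroup M G" and x: "x \<in> carrier G" and xM: "\<And>m. m \<in> M \<Longrightarrow> x \<otimes> m \<otimes> inv x \<in> M"
begin

text \<open>The powers of \<open>x\<close> with exponents below \<open>n\<close> meet all right
  cosets of \<open>M\<close>, so \<open>M\<close> has finite index.\<close>

lemma HNN_torsion:
  assumes n: "(n::nat) > 0" "x [^] n \<in> M" and FP: "FP_group M"
  shows "FP_group (generate G (insert x M))"
proof -
  let ?H = "HNN_set M x"
  have Hc: "subgroup ?H G" by (rule HNN_set_subgroup[OF M x xM])
  have Mc: "m \<in> M \<Longrightarrow> m \<in> carrier G" for m using subgroup.subset[OF M] by blast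
  have pw: "x [^] (n * q) \<in> M" for q :: nat
  proof (induction q)
    case (Suc q)
    have "x [^] (n * Suc q) = x [^] n \<otimes> x [^] (n * q)" using x by (simp add: nat_pow_mult)
    then show ?case using Suc n(2) subgroup.m_closed[OF M] by simp
  qed (simp add: subgroup.one_closed[OF M])
  have MH: "M \<subseteq> ?H" and xH: "x \<in> ?H"
    using HNN_set_eq[OF M x xM] generate.incl[of _ "insert x M" G] by auto
  have pH: "x [^] (j::nat) \<in> ?H" for j
    by (induction j) (use xH subgroup.one_closed[OF Hc] subgroup.m_closed[OF Hc] in auto)
  have "?H = (\<Union>t\<in>(\<lambda>j. x [^] j) ` {..<n}. M #> t)"
  proof (intro equalityI subsetI)
    fix h assume "h \<in> ?H"
    then obtain k l :: nat where h: "h \<in> carrier G" "x [^] k \<otimes> h \<otimes> inv (x [^] l) \<in> M"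
      by (auto simp: HNN_set_def[OF M x xM])
    \<comment> \<open>The exponent k is raised by (n - 1) k to the multiple n k of \<open>n\<close>,
      so that the power on the left lies in \<open>M\<close>; the matching right exponent is
      \<open>l'\<close>, reduced modulo \<open>n\<close> below.\<close>
    define l' where "l' = (n - 1) * k + l"
    have "(n - 1) * k + k = n * k" using n(1) by (cases n) auto
    then have m1: "x [^] (n * k) \<otimes> h \<otimes> inv (x [^] l') \<in> M"
      using HNN_raise[OF M x xM h, of "(n - 1) * k"] by (simp add: l'_def)
    define j where "j = l' mod n"
    have l': "x [^] l' = x [^] (n * (l' div n)) \<otimes> x [^] j"
      using x by (simp add: nat_pow_mult j_def)
    define m where "m = inv (x [^] (n * k)) \<otimes> (x [^] (n * k) \<otimes> h \<otimes> inv (x [^] l')) \<otimes> x [^] (n * (l' div n))"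
    have "m \<in> M" unfolding m_def
      by (intro subgroup.m_closed[OF M] subgroup.m_inv_closed[OF M] pw m1)
    moreover have "h = m \<otimes> x [^] j"
    proof -
      have "m = h \<otimes> inv (x [^] l') \<otimes> x [^] (n * (l' div n))"
        unfolding m_def using h x by (simp add: m_assoc) (simp add: m_assoc[symmetric])
      then have "m \<otimes> x [^] j = h \<otimes> inv (x [^] l') \<otimes> x [^] l'"
        unfolding l' using h x by (simp add: m_assoc)
      then show ?thesis using h x by (simp add: m_assoc)
    qed
    moreover have "j < n" using n(1) by (simp add: j_def)
    ultimately show "h \<in> (\<Union>t\<in>(\<lambda>j. x [^] j) ` {..<n}. M #> t)" by (auto simp: r_coset_def)
  next
    fix h assume "h \<in> (\<Union>t\<in>(\<lambda>j. x [^] j) ` {..<n}. M #> t)"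
    then obtain j m where "m \<in> M" "h = m \<otimes> x [^] (j::nat)" by (auto simp: r_coset_def)
    then show "h \<in> ?H" using MH pH subgroup.m_closed[OF Hc] by auto
  qed
  then have "FP ?H (\<lambda>_ n. n) (UNIV :: int set)"
    by (rule FP_finite_index[OF Hc M MH, rotated 2])
      (use x FP gmod_trivial in \<open>auto simp: FP_group_def\<close>)
  then show ?thesis using HNN_set_eq[OF M x xM] by (simp add: FP_group_def)
qed

text \<open>The cosets of \<open>M\<close> form the vertices of a tree on which \<open>\<phi>\<close> is the parent map; without
  periodic points, the difference of the identity and \<open>\<phi>\<close> resolves the trivial module.\<close>

lemma HNN_free:
  assumes n: "\<And>n::nat. n > 0 \<Longrightarrow> x [^] n \<notin> M" and FP: "FP_group M"
  shows "FP_group (generate G (insert x M))"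
proof -
  let ?H = "HNN_set M x"
  have H: "subgroup ?H G" by (rule HNN_set_subgroup[OF M x xM])
  have MH: "M \<subseteq> ?H" and xH: "x \<in> ?H"
    using HNN_set_eq[OF M x xM] generate.incl[of _ "insert x M" G] by auto
  note inc = in_carrier[OF M H MH]
  note mH = subgroup.m_closed[OF H] and iH = subgroup.m_inv_closed[OF H]
  have pH: "x [^] (j::nat) \<in> ?H" for j
    by (induction j) (use xH subgroup.one_closed[OF H] mH in auto)
  let ?c = "\<lambda>h. l_coset G h M"
  have c1: "?c \<one> = M" using lcos_mult_one subgroup.subset[OF M] by blast
  \<comment> \<open>The parent of hM is h x^-1 M. Taking the union over all elements of the coset
    avoids representatives; the members of the union coincide because x M x^-1 \<subseteq>
    M.\<close>
  define \<phi> where "\<phi> C = (\<Union>y\<in>C. ?c (y \<otimes> inv x))" for C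
  have \<phi>: "\<phi> (?c h) = ?c (h \<otimes> inv x)" if h: "h \<in> ?H" for h
  proof -
    have eq: "?c (h \<otimes> m \<otimes> inv x) = ?c (h \<otimes> inv x)" if m: "m \<in> M" for m
    proof -
      have mem: "h \<otimes> inv x \<in> ?H" "h \<otimes> m \<otimes> inv x \<in> ?H" using h m xH mH iH inc(3) by blast+
      have "inv (h \<otimes> inv x) \<otimes> (h \<otimes> m \<otimes> inv x) = x \<otimes> m \<otimes> inv x"
        using h m x inc by (simp add: inv_mult_group m_assoc) (simp add: m_assoc[symmetric])
      then show ?thesis using lcoset_eq_iff[OF M H MH mem] xM[OF m] by simp
    qed
    have "\<phi> (?c h) = (\<Union>m\<in>M. ?c (h \<otimes> m \<otimes> inv x))" by (auto simp: \<phi>_def l_coset_def)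
    also have "\<dots> = (\<Union>m\<in>M. ?c (h \<otimes> inv x))" using eq by simp
    also have "\<dots> = ?c (h \<otimes> inv x)" using subgroup.one_closed[OF M] by auto
    finally show ?thesis .
  qed
  have \<phi>n: "(\<phi> ^^ n) (?c h) = ?c (h \<otimes> inv (x [^] n))" if h: "h \<in> ?H" for h n
  proof (induction n)
    case (Suc n)
    have "(\<phi> ^^ Suc n) (?c h) = \<phi> (?c (h \<otimes> inv (x [^] n)))" using Suc by simp
    also have "\<dots> = ?c (h \<otimes> inv (x [^] n) \<otimes> inv x)" using h pH mH iH by (intro \<phi>) blast
    also have "h \<otimes> inv (x [^] n) \<otimes> inv x = h \<otimes> inv (x [^] Suc n)"
      using h x inc nat_pow_Suc2[OF x, of n] by (simp add: inv_mult_group m_assoc del: nat_pow_Suc)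
    finally show ?case .
  qed (use h inc in simp)
  define \<Phi> where "\<Phi> = frag_extend (\<lambda>C. frag_of (\<phi> C))"
  have \<Phi>of: "\<Phi> (frag_of C) = frag_of (\<phi> C)" for C by (simp add: \<Phi>_def)
  have \<Phi>diff: "\<Phi> (a - b) = \<Phi> a - \<Phi> b" and \<Phi>add: "\<Phi> (a + b) = \<Phi> a + \<Phi> b" and \<Phi>0: "\<Phi> 0 = 0" for a b
    by (simp_all add: \<Phi>_def frag_extend_diff frag_extend_add)
  have cdiff: "ctrans g (a - b) = ctrans g a - ctrans g b" and c0: "ctrans g 0 = 0" for g a b
    by (simp_all add: ctrans_def frag_extend_diff)
  let ?B = "cfrags M ?H"
  note BS = cfrags_add_subgroup[OF M H MH]
  note BD = add_subgroupD[OF BS]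
  note B_induct = cfrags_induct[OF M H MH, consumes 1, case_names zero one diff]
  have fB: "frag_of (?c h) \<in> ?B" if "h \<in> ?H" for h by (rule frag_of_cfrags[OF M H MH that])
  have hx: "h \<otimes> inv x \<in> ?H" if "h \<in> ?H" for h using that xH mH iH by blast
  have \<Phi>B: "\<Phi> b \<in> ?B" if "b \<in> ?B" for b
    using that
  proof (induction rule: B_induct)
    case (one h)
    then show ?case using fB[OF hx] by (simp add: \<Phi>of \<phi>)
  qed (auto simp: \<Phi>0 \<Phi>diff BD)
  have \<Phi>c: "\<Phi> (ctrans g b) = ctrans g (\<Phi> b)" if g: "g \<in> ?H" and "b \<in> ?B" for g b
    using that(2)
  proof (induction rule: B_induct)
    case (one h)
    then show ?case using g mH hx inc x ctrans_of[OF M H MH g] by (simp add: \<Phi>of \<phi> m_assoc)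
  qed (auto simp: \<Phi>0 \<Phi>diff cdiff c0)
  \<comment> \<open>The boundary map of the tree: the edge from a coset to its parent is indexed by
    that coset, so edges and vertices give the same permutation module.\<close>
  define D where "D b = b - \<Phi> b" for b
  have D: "ghom ?H ctrans ?B ctrans D"
    unfolding ghom_def additive_on_def D_def using \<Phi>c by (auto simp: \<Phi>add cdiff)
  have DB: "D b \<in> ?B" if "b \<in> ?B" for b unfolding D_def using that \<Phi>B BD(2) by blast
  \<comment> \<open>A vector fixed by \<open>\<Phi>\<close> has a finite support that
    \<open>\<phi>\<close> maps onto itself. This yields a coset with two equal iterates, hence a
    positive power of \<open>x\<close> in \<open>M\<close>.\<close>
  have Dinj: "b = 0" if b: "b \<in> ?B" and Db: "D b = 0" for b
  proof (rule ccontr)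
    assume "b \<noteq> 0"
    let ?S = "Poly_Mapping.keys b"
    have "\<Phi> b = b" using Db by (simp add: D_def)
    then have "?S \<subseteq> \<phi> ` ?S"
      using keys_frag_extend[of "\<lambda>C. frag_of (\<phi> C)" b] unfolding \<Phi>_def by auto
    then have "\<phi> ` ?S = ?S" by (metis card_image_le card_seteq finite_imageI finite_keys)
    then have \<phi>S: "\<phi> ` ?S \<subseteq> ?S" by simp
    obtain C where "C \<in> ?S" using \<open>b \<noteq> 0\<close> by fastforce
    obtain i j where ij: "i < j" "(\<phi> ^^ i) C = (\<phi> ^^ j) C"
      by (rule finite_iterate_repeats[OF finite_keys \<open>C \<in> ?S\<close> \<phi>S])
    obtain h where h: "h \<in> ?H" "C = ?c h" using b \<open>C \<in> ?S\<close> by (auto simp: cfrags_def)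
    have mem: "h \<otimes> inv (x [^] j) \<in> ?H" "h \<otimes> inv (x [^] i) \<in> ?H" using h pH mH iH by blast+
    have "?c (h \<otimes> inv (x [^] j)) = ?c (h \<otimes> inv (x [^] i))" using ij h \<phi>n by simp
    then have "inv (h \<otimes> inv (x [^] j)) \<otimes> (h \<otimes> inv (x [^] i)) \<in> M"
      using lcoset_eq_iff[OF M H MH mem] by simp
    also have "inv (h \<otimes> inv (x [^] j)) \<otimes> (h \<otimes> inv (x [^] i)) = x [^] j \<otimes> inv (x [^] i)"
      using h x inc by (simp add: inv_mult_group m_assoc) (simp add: m_assoc[symmetric])
    also have "x [^] j = x [^] (j - i) \<otimes> x [^] i" using x ij(1) by (simp add: nat_pow_mult)
    also have "x [^] (j - i) \<otimes> x [^] i \<otimes> inv (x [^] i) = x [^] (j - i)" using x by (simp add: m_assoc)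
    finally show False using n[of "j - i"] ij(1) by simp
  qed
  have FPB: "FP ?H ctrans ?B" by (rule FP_cfrags[OF M H MH FP])
  have FPD: "FP ?H ctrans (D ` ?B)" by (rule FP_iso[OF H FPB D Dinj])
  \<comment> \<open>The augmentation, obtained by sending every coset to one point and reading off
    the coefficient.\<close>
  define aug where "aug b = Poly_Mapping.lookup (frag_extend (\<lambda>_. frag_of ()) b) ()" for b :: "'a set \<Rightarrow>\<^sub>0 int"
  have aug_of: "aug (frag_of C) = 1" for C by (simp add: aug_def)
  have aug_add: "aug (a + b) = aug a + aug b" and aug_diff: "aug (a - b) = aug a - aug b" and aug0: "aug 0 = 0" for a b
    by (simp_all add: aug_def frag_extend_add frag_extend_diff lookup_add lookup_minus)
  have aug_c: "aug (ctrans g b) = aug b" if "g \<in> ?H" "b \<in> ?B" for g b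
    using that(2)
    by (induction rule: B_induct) (auto simp: c0 cdiff aug_diff aug0 aug_of ctrans_of[OF M H MH that(1)])
  have aug: "ghom ?H ctrans ?B (\<lambda>_ n. n) aug"
    unfolding ghom_def additive_on_def using aug_c aug_add by simp
  have fM: "frag_of M \<in> ?B" using fB[OF subgroup.one_closed[OF H]] c1 by simp
  have aug_zmul: "aug (zmul k (frag_of M)) = k" for k
    using additive_on_zmul[OF ghomD(1)[OF aug] BS fM] aug_of by simp
  have im: "aug ` ?B = UNIV"
    using aug_zmul add_subgroup_zmul[OF BS fM] by (metis UNIV_eq_I imageI)
  have augD: "aug (D b) = 0" if "b \<in> ?B" for b
    using that
    by (induction rule: B_induct) (auto simp: D_def \<Phi>0 \<Phi>diff \<Phi>of aug_diff aug0 aug_of)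
  note ID = add_subgroupD[OF gmodD(1)[OF FP_gmod[OF H FPD]]]
  \<comment> \<open>The path from a coset to its n-th ancestor bounds, by a telescoping sum.\<close>
  have tele: "frag_of (?c h) - frag_of ((\<phi> ^^ n) (?c h)) \<in> D ` ?B" if h: "h \<in> ?H" for h n
  proof (induction n)
    case 0
    then show ?case using ID(1) by simp
  next
    case (Suc n)
    let ?C = "(\<phi> ^^ n) (?c h)"
    have "h \<otimes> inv (x [^] n) \<in> ?H" using h pH mH iH by blast
    then have "frag_of ?C \<in> ?B" using fB \<phi>n[OF h] by simp
    moreover have "D (frag_of ?C) = frag_of ?C - frag_of ((\<phi> ^^ Suc n) (?c h))"
      by (simp add: D_def \<Phi>of)
    ultimately have "frag_of ?C - frag_of ((\<phi> ^^ Suc n) (?c h)) \<in> D ` ?B" by (metis imageI)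
    from ID(4)[OF Suc this] show ?case by simp
  qed
  \<comment> \<open>Connectedness: x^k h x^-l in \<open>M\<close> says that the k-th ancestor of
    \<open>M\<close> is the l-th ancestor of hM, so two telescoping paths join hM to
    \<open>M\<close>.\<close>
  have base: "frag_of (?c h) - frag_of M \<in> D ` ?B" if h: "h \<in> ?H" for h
  proof -
    obtain k l :: nat where kl: "x [^] k \<otimes> h \<otimes> inv (x [^] l) \<in> M"
      using h by (auto simp: HNN_set_def[OF M x xM])
    have mem: "\<one> \<otimes> inv (x [^] k) \<in> ?H" "h \<otimes> inv (x [^] l) \<in> ?H"
      using h pH mH iH subgroup.one_closed[OF H] by blast+
    have "inv (\<one> \<otimes> inv (x [^] k)) \<otimes> (h \<otimes> inv (x [^] l)) = x [^] k \<otimes> h \<otimes> inv (x [^] l)"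
      using x h inc by (simp add: m_assoc)
    then have "?c (\<one> \<otimes> inv (x [^] k)) = ?c (h \<otimes> inv (x [^] l))"
      using lcoset_eq_iff[OF M H MH mem] kl by simp
    then have "(\<phi> ^^ k) (?c \<one>) = (\<phi> ^^ l) (?c h)"
      using \<phi>n[OF h, of l] \<phi>n[OF subgroup.one_closed[OF H], of k] by simp
    then show ?thesis
      using ID(2)[OF tele[OF h, of l] tele[OF subgroup.one_closed[OF H], of k]] c1 by simp
  qed
  have "b - zmul (aug b) (frag_of M) \<in> D ` ?B" if "b \<in> ?B" for b
    using that
  proof (induction rule: B_induct)
    case zero
    then show ?case using ID(1) by (simp add: aug0)
  next
    case (one h)
    then show ?case using base by (simp add: aug_of)
  next
    case (diff a b)
    have "a - b - zmul (aug (a - b)) (frag_of M) = (a - zmul (aug a) (frag_of M)) - (b - zmul (aug b) (frag_of M))"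
      by (simp add: aug_diff zmul_diff_left)
    then show ?case using ID(2)[OF diff] by (simp only:)
  qed
  then have "ker_on ?B aug \<subseteq> D ` ?B" by force
  moreover have "D ` ?B \<subseteq> ker_on ?B aug" using augD DB by blast
  ultimately have ker: "ker_on ?B aug = D ` ?B" by blast
  have "FP ?H (\<lambda>_ n. n) (aug ` ?B)"
    by (rule FP_quotient[OF H aug FPB]) (simp only: ker FPD)
  then show ?thesis unfolding im using HNN_set_eq[OF M x xM] by (simp add: FP_group_def)
qed

lemma FP_group_HNN: "FP_group M \<Longrightarrow> FP_group (generate G (insert x M))"
  using HNN_torsion HNN_free by blast

end

text \<open>Over the trivial group the free module of rank 1 is \<int> itself, so the cover has zero
  kernel.\<close>

lemma FP_group_one: "FP_group {\<one>}"
proof -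
  have H: "subgroup {\<one>} G" by (rule triv_subgroup)
  define f where "f v = v 0 \<one>" for v :: "nat \<Rightarrow> 'a \<Rightarrow> int"
  have f: "ghom {\<one>} act (freeM {\<one>} 1) (\<lambda>_ n. n) f"
    by (auto simp: ghom_def additive_on_def f_def act_def)
  have s: "u = (\<lambda>i x. if i = 0 \<and> x = \<one> then f u else 0)" if "u \<in> freeM {\<one>} 1" for u
    using that by (force simp: freeM_def supp_def f_def fun_eq_iff)
  have im: "f ` freeM {\<one>} 1 = UNIV"
  proof (intro equalityI subsetI)
    fix k :: int
    let ?u = "\<lambda>i x. if i = (0::nat) \<and> x = \<one> then k else 0"
    have "supp ?u \<subseteq> {(0, \<one>)}" by (auto simp: supp_def)
    then have "?u \<in> freeM {\<one>} 1" using finite_subset by (auto simp: freeM_def)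
    moreover have "k = f ?u" by (simp add: f_def)
    ultimately show "k \<in> f ` freeM {\<one>} 1" by blast
  qed simp
  have "u = 0" if "u \<in> freeM {\<one>} 1" "f u = 0" for u
    using s[OF that(1)] that(2) by (simp add: fun_eq_iff)
  then have "{v\<in>freeM {\<one>} 1. f v = 0} = {0}"
    using add_subgroupD(1)[OF freeM_add_subgroup, of "{\<one>}" 1] by (auto simp: f_def)
  then have "FPU {\<one>} {v\<in>freeM {\<one>} 1. f v = 0}" using FPU_zero by simp
  then show ?thesis unfolding FP_group_def FP_def using f im by blast
qed

end

section \<open>The group ring and its free modules\<close>

context group
begin

context
  fixes H :: "'a set"
  assumes H: "subgroup H G"
begin

abbreviation (input) ZH :: "('a \<Rightarrow> int) ring" where
  "ZH \<equiv> group_ring (G\<lparr>carrier := H\<rparr>)"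

definition conv :: "('a \<Rightarrow> int) \<Rightarrow> ('a \<Rightarrow> int) \<Rightarrow> 'a \<Rightarrow> int" where
  "conv f f' = (\<lambda>x. \<Sum>g | f g \<noteq> 0. \<Sum>h | f' h \<noteq> 0. if g \<otimes> h = x then f g * f' h else 0)"

lemma ZH_simps:
  "carrier ZH = {f. finite {g. f g \<noteq> 0} \<and> {g. f g \<noteq> 0} \<subseteq> H}"
  "monoid.mult ZH = conv" "one ZH = (\<lambda>x. if x = \<one> then 1 else 0)"
  "ring.zero ZH = (\<lambda>x. 0)" "add ZH = (\<lambda>f f' x. f x + f' x)"
  by (simp_all add: group_ring_def conv_def fun_eq_iff)

text \<open>The linear extension of \<phi> to the group ring, evaluated at \<open>f\<close>.
  Convolutions become iterated pairings, so that the ring axioms reduce to identities in the group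
  under the pairings.\<close>

definition pairing :: "('a \<Rightarrow> int) \<Rightarrow> ('a \<Rightarrow> int) \<Rightarrow> int" where
  "pairing f \<phi> = (\<Sum>g | f g \<noteq> 0. f g * \<phi> g)"

lemma pairing_superset:
  "finite S \<Longrightarrow> {g. f g \<noteq> 0} \<subseteq> S \<Longrightarrow> pairing f \<phi> = (\<Sum>g\<in>S. f g * \<phi> g)"
  unfolding pairing_def by (intro sum.mono_neutral_left) auto

lemma conv_pairing: "conv f f' x = pairing f (\<lambda>g. pairing f' (\<lambda>h. if g \<otimes> h = x then 1 else 0))"
  unfolding conv_def pairing_def
  by (intro sum.cong refl) (auto simp: sum_distrib_left intro!: sum.cong)

lemma conv_support: "{x. conv f f' x \<noteq> 0} \<subseteq> (\<lambda>(g, h). g \<otimes> h) ` ({g. f g \<noteq> 0} \<times> {h. f' h \<noteq> 0})"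
proof
  fix x assume "x \<in> {x. conv f f' x \<noteq> 0}"
  then obtain g h where "f g \<noteq> 0" "f' h \<noteq> 0" "g \<otimes> h = x"
  proof -
    assume "x \<in> {x. conv f f' x \<noteq> 0}" and *: "\<And>g h. f g \<noteq> 0 \<Longrightarrow> f' h \<noteq> 0 \<Longrightarrow> g \<otimes> h = x \<Longrightarrow> thesis"
    show thesis
    proof (rule ccontr)
      assume "\<not> thesis"
      then have "conv f f' x = 0" unfolding conv_def using * by (intro sum.neutral ballI) auto
      then show False using \<open>x \<in> {x. conv f f' x \<noteq> 0}\<close> by simp
    qed
  qed
  then show "x \<in> (\<lambda>(g, h). g \<otimes> h) ` ({g. f g \<noteq> 0} \<times> {h. f' h \<noteq> 0})" by auto
qed

text \<open>Fubini for finite sums: the terms are regrouped from products g h to pairs (g, h), and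
  the inner sum over products collapses to one term.\<close>

lemma pairing_conv:
  assumes "finite {g. f g \<noteq> 0}" "finite {h. f' h \<noteq> 0}"
  shows "pairing (conv f f') \<phi> = pairing f (\<lambda>g. pairing f' (\<lambda>h. \<phi> (g \<otimes> h)))"
proof -
  let ?F = "{g. f g \<noteq> 0}" and ?F' = "{h. f' h \<noteq> 0}"
  let ?S = "(\<lambda>(g, h). g \<otimes> h) ` (?F \<times> ?F')"
  have fS: "finite ?S" using assms by simp
  have "pairing (conv f f') \<phi> = (\<Sum>x\<in>?S. conv f f' x * \<phi> x)"
    by (rule pairing_superset[OF fS conv_support])
  also have "\<dots> = (\<Sum>x\<in>?S. \<Sum>g\<in>?F. \<Sum>h\<in>?F'. (if g \<otimes> h = x then f g * f' h else 0) * \<phi> x)"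
    by (simp add: conv_def sum_distrib_right)
  also have "\<dots> = (\<Sum>g\<in>?F. \<Sum>x\<in>?S. \<Sum>h\<in>?F'. (if g \<otimes> h = x then f g * f' h else 0) * \<phi> x)"
    by (rule sum.swap)
  also have "\<dots> = (\<Sum>g\<in>?F. \<Sum>h\<in>?F'. \<Sum>x\<in>?S. (if g \<otimes> h = x then f g * f' h else 0) * \<phi> x)"
    by (intro sum.cong refl sum.swap)
  also have "\<dots> = (\<Sum>g\<in>?F. \<Sum>h\<in>?F'. f g * (f' h * \<phi> (g \<otimes> h)))"
  proof (intro sum.cong refl)
    fix g h assume gh: "g \<in> ?F" "h \<in> ?F'"
    have "(\<Sum>x\<in>?S. (if g \<otimes> h = x then f g * f' h else 0) * \<phi> x) =
        (\<Sum>x\<in>?S. if g \<otimes> h = x then f g * f' h * \<phi> x else 0)"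
      by (intro sum.cong refl) simp
    also have "\<dots> = f g * f' h * \<phi> (g \<otimes> h)"
      using gh by (subst sum.delta'[OF fS]) auto
    finally show "(\<Sum>x\<in>?S. (if g \<otimes> h = x then f g * f' h else 0) * \<phi> x) = f g * (f' h * \<phi> (g \<otimes> h))"
      by simp
  qed
  finally show ?thesis by (simp add: pairing_def sum_distrib_left)
qed

lemma pairing_add_left:
  assumes "finite {g. f g \<noteq> 0}" "finite {g. k g \<noteq> 0}"
  shows "pairing (\<lambda>x. f x + k x) \<phi> = pairing f \<phi> + pairing k \<phi>"
proof -
  let ?S = "{g. f g \<noteq> 0} \<union> {g. k g \<noteq> 0}"
  have f: "finite ?S" using assms by simp
  have "pairing (\<lambda>x. f x + k x) \<phi> = (\<Sum>g\<in>?S. (f g + k g) * \<phi> g)"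
    by (rule pairing_superset[OF f]) auto
  also have "\<dots> = (\<Sum>g\<in>?S. f g * \<phi> g) + (\<Sum>g\<in>?S. k g * \<phi> g)"
    by (simp add: distrib_right sum.distrib)
  also have "\<dots> = pairing f \<phi> + pairing k \<phi>"
    using pairing_superset[OF f, of f \<phi>] pairing_superset[OF f, of k \<phi>] by simp
  finally show ?thesis .
qed

lemma pairing_add_right: "pairing f (\<lambda>g. \<phi> g + \<psi> g) = pairing f \<phi> + pairing f \<psi>"
  by (simp add: pairing_def distrib_left sum.distrib)

lemma pairing_cong: "(\<And>g. f g \<noteq> 0 \<Longrightarrow> \<phi> g = \<psi> g) \<Longrightarrow> pairing f \<phi> = pairing f \<psi>"
  unfolding pairing_def by (intro sum.cong) auto

lemma pairing_delta: "finite {g. f g \<noteq> 0} \<Longrightarrow> pairing f (\<lambda>g. if g = y then 1 else 0) = f y"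
proof -
  assume f: "finite {g. f g \<noteq> 0}"
  have "pairing f (\<lambda>g. if g = y then 1 else 0) = (\<Sum>g | f g \<noteq> 0. if g = y then f g else 0)"
    unfolding pairing_def by (intro sum.cong) auto
  then show ?thesis using f by (simp add: sum.delta)
qed

lemma pairing_one: "pairing (\<lambda>x. if x = \<one> then 1 else 0) \<phi> = \<phi> \<one>"
  by (simp add: pairing_def)

lemma H_carrier: "g \<in> H \<Longrightarrow> g \<in> carrier G"
  using subgroup.subset[OF H] by blast

lemma ZH_memI: "finite S \<Longrightarrow> {g. f g \<noteq> 0} \<subseteq> S \<Longrightarrow> S \<subseteq> H \<Longrightarrow> f \<in> carrier ZH"
  unfolding ZH_simps using finite_subset by blast

lemma ring_ZH: "ring ZH"
proof (rule ringI)
  have neg: "\<exists>g\<in>carrier ZH. f \<oplus>\<^bsub>ZH\<^esub> g = \<zero>\<^bsub>ZH\<^esub>" if "f \<in> carrier ZH" for f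
    using that by (intro bexI[of _ "\<lambda>x. - f x"]) (auto simp: ZH_simps)
  have addc: "f \<oplus>\<^bsub>ZH\<^esub> k \<in> carrier ZH" if "f \<in> carrier ZH" "k \<in> carrier ZH" for f k
  proof -
    have "finite ({g. f g \<noteq> 0} \<union> {g. k g \<noteq> 0})" "{g. f g \<noteq> 0} \<union> {g. k g \<noteq> 0} \<subseteq> H"
      using that by (auto simp: ZH_simps)
    moreover have "{g. (f \<oplus>\<^bsub>ZH\<^esub> k) g \<noteq> 0} \<subseteq> {g. f g \<noteq> 0} \<union> {g. k g \<noteq> 0}" by (auto simp: ZH_simps)
    ultimately show ?thesis by (intro ZH_memI)
  qed
  show "abelian_group ZH"
    by (rule abelian_groupI) (use addc neg in \<open>auto simp: ZH_simps add_ac\<close>)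
  have mc: "conv f k \<in> carrier ZH" if "f \<in> carrier ZH" "k \<in> carrier ZH" for f k
  proof -
    have "(\<lambda>(g, h). g \<otimes> h) ` ({g. f g \<noteq> 0} \<times> {h. k h \<noteq> 0}) \<subseteq> H"
      using that subgroup.m_closed[OF H] by (auto simp: ZH_simps)
    moreover have "finite ((\<lambda>(g, h). g \<otimes> h) ` ({g. f g \<noteq> 0} \<times> {h. k h \<noteq> 0}))"
      using that by (simp add: ZH_simps)
    ultimately show ?thesis using conv_support[of f k] by (intro ZH_memI)
  qed
  show "monoid ZH"
  proof (rule monoidI)
    show "f \<otimes>\<^bsub>ZH\<^esub> k \<in> carrier ZH" if "f \<in> carrier ZH" "k \<in> carrier ZH" for f k
      using mc[OF that] by (simp add: ZH_simps)
    show "\<one>\<^bsub>ZH\<^esub> \<in> carrier ZH" using subgroup.one_closed[OF H] by (simp add: ZH_simps)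
    fix a b c assume a: "a \<in> carrier ZH" and b: "b \<in> carrier ZH" and c: "c \<in> carrier ZH"
    note fin = a[unfolded ZH_simps(1), simplified] b[unfolded ZH_simps(1), simplified] c[unfolded ZH_simps(1), simplified]
    have "conv (conv a b) c x = conv a (conv b c) x" for x
    proof -
      have "conv (conv a b) c x = pairing a (\<lambda>g. pairing b (\<lambda>h. pairing c (\<lambda>l. if g \<otimes> h \<otimes> l = x then 1 else 0)))"
        unfolding conv_pairing[of "conv a b"] using fin by (intro pairing_conv) auto
      also have "\<dots> = pairing a (\<lambda>g. pairing b (\<lambda>h. pairing c (\<lambda>l. if g \<otimes> (h \<otimes> l) = x then 1 else 0)))"
      proof (intro pairing_cong)
        fix g h l assume "a g \<noteq> 0" "b h \<noteq> 0" "c l \<noteq> 0"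
        then have "g \<in> carrier G" "h \<in> carrier G" "l \<in> carrier G" using fin H_carrier by auto
        then show "(if g \<otimes> h \<otimes> l = x then 1 else 0) = (if g \<otimes> (h \<otimes> l) = x then 1 else (0::int))"
          by (simp add: m_assoc)
      qed
      also have "\<dots> = conv a (conv b c) x"
        unfolding conv_pairing[of a] using fin by (intro pairing_cong pairing_conv[symmetric]) auto
      finally show ?thesis .
    qed
    then show "a \<otimes>\<^bsub>ZH\<^esub> b \<otimes>\<^bsub>ZH\<^esub> c = a \<otimes>\<^bsub>ZH\<^esub> (b \<otimes>\<^bsub>ZH\<^esub> c)" by (simp add: ZH_simps fun_eq_iff)
  next
    fix a assume a: "a \<in> carrier ZH"
    note fin = a[unfolded ZH_simps(1), simplified]
    have "conv (\<lambda>x. if x = \<one> then 1 else 0) a x = a x" for x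
    proof -
      have "conv (\<lambda>x. if x = \<one> then 1 else 0) a x = pairing a (\<lambda>h. if \<one> \<otimes> h = x then 1 else 0)"
        unfolding conv_pairing pairing_one ..
      also have "\<dots> = pairing a (\<lambda>h. if h = x then 1 else 0)"
        using fin H_carrier by (intro pairing_cong) (auto simp: subset_iff)
      finally show ?thesis using pairing_delta fin by simp
    qed
    then show "\<one>\<^bsub>ZH\<^esub> \<otimes>\<^bsub>ZH\<^esub> a = a" by (simp add: ZH_simps fun_eq_iff)
    have "conv a (\<lambda>x. if x = \<one> then 1 else 0) x = a x" for x
    proof -
      have "conv a (\<lambda>x. if x = \<one> then 1 else 0) x = pairing a (\<lambda>h. if h \<otimes> \<one> = x then 1 else 0)"
        unfolding conv_pairing pairing_one ..
      also have "\<dots> = pairing a (\<lambda>h. if h = x then 1 else 0)"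
        using fin H_carrier by (intro pairing_cong) (auto simp: subset_iff)
      finally show ?thesis using pairing_delta fin by simp
    qed
    then show "a \<otimes>\<^bsub>ZH\<^esub> \<one>\<^bsub>ZH\<^esub> = a" by (simp add: ZH_simps fun_eq_iff)
  qed
  fix a b c assume a: "a \<in> carrier ZH" and b: "b \<in> carrier ZH" and c: "c \<in> carrier ZH"
  have fin: "finite {g. a g \<noteq> 0}" "finite {g. b g \<noteq> 0}" "finite {g. c g \<noteq> 0}"
    using a b c by (auto simp: ZH_simps)
  show "(a \<oplus>\<^bsub>ZH\<^esub> b) \<otimes>\<^bsub>ZH\<^esub> c = a \<otimes>\<^bsub>ZH\<^esub> c \<oplus>\<^bsub>ZH\<^esub> b \<otimes>\<^bsub>ZH\<^esub> c"
    using fin by (simp add: ZH_simps fun_eq_iff conv_pairing pairing_add_left)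
  show "c \<otimes>\<^bsub>ZH\<^esub> (a \<oplus>\<^bsub>ZH\<^esub> b) = c \<otimes>\<^bsub>ZH\<^esub> a \<oplus>\<^bsub>ZH\<^esub> c \<otimes>\<^bsub>ZH\<^esub> b"
    using fin by (simp add: ZH_simps fun_eq_iff conv_pairing pairing_add_left pairing_add_right)
qed

section \<open>Free modules of finite rank as module records\<close>

definition free_module :: "nat \<Rightarrow> ('a \<Rightarrow> int, nat \<Rightarrow> 'a \<Rightarrow> int) module" where
  "free_module r = \<lparr>carrier = freeM H r, monoid.mult = (\<lambda>u v. u), one = 0, ring.zero = 0,
     add = (+), smult = (\<lambda>a v i. conv a (v i))\<rparr>"

lemma free_module_simps:
  "carrier (free_module r) = freeM H r" "\<zero>\<^bsub>free_module r\<^esub> = 0"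
  "u \<oplus>\<^bsub>free_module r\<^esub> v = u + v" "a \<odot>\<^bsub>free_module r\<^esub> v = (\<lambda>i. conv a (v i))"
  by (simp_all add: free_module_def)

lemma freeM_component: "v \<in> freeM H r \<Longrightarrow> v i \<in> carrier ZH"
proof -
  assume v: "v \<in> freeM H r"
  have "{g. v i g \<noteq> 0} \<subseteq> snd ` supp v"
  proof
    fix g assume "g \<in> {g. v i g \<noteq> 0}"
    then show "g \<in> snd ` supp v" using image_eqI[of g snd "(i, g)" "supp v"] by (simp add: supp_def)
  qed
  then have "finite {g. v i g \<noteq> 0}" using v finite_subset by (auto simp: freeM_def)
  moreover have "{g. v i g \<noteq> 0} \<subseteq> H" using v by (auto simp: freeM_def supp_def)
  ultimately show ?thesis by (simp add: ZH_simps)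
qed

lemma freeM_componentI:
  assumes "\<And>i. v i \<in> carrier ZH" "\<And>i. i \<ge> r \<Longrightarrow> v i = 0"
  shows "v \<in> freeM H r"
proof -
  have *: "v i g \<noteq> 0 \<Longrightarrow> i < r \<and> g \<in> H" for i g
    using assms(1)[of i] assms(2)[of i] by (cases "i < r") (auto simp: ZH_simps)
  then have "supp v \<subseteq> (\<Union>i<r. {i} \<times> {g. v i g \<noteq> 0})" by (auto simp: supp_def)
  moreover have "finite (\<Union>i<r. {i} \<times> {g. v i g \<noteq> 0})"
    using assms(1) by (auto simp: ZH_simps)
  ultimately have "finite (supp v)" by (rule finite_subset)
  then show ?thesis using * by (auto simp: freeM_def supp_def)
qed

lemma conv_zero: "conv a 0 = 0"
  by (simp add: conv_def fun_eq_iff)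

lemma smult_freeM:
  assumes "a \<in> carrier ZH" "v \<in> freeM H r" shows "(\<lambda>i. conv a (v i)) \<in> freeM H r"
proof (rule freeM_componentI)
  interpret ring ZH by (rule ring_ZH)
  show "conv a (v i) \<in> carrier ZH" for i
    using m_closed[OF assms(1) freeM_component[OF assms(2)]] by (simp add: ZH_simps)
  show "conv a (v i) = 0" if "i \<ge> r" for i
  proof -
    have "v i = 0" using assms(2) that by (force simp: freeM_def supp_def fun_eq_iff)
    then show ?thesis by (simp add: conv_zero)
  qed
qed

lemma free_left_module: "left_module ZH (free_module r)"
proof -
  let ?F = "free_module r"
  interpret ring ZH by (rule ring_ZH)
  show ?thesis
  proof (intro left_module.intro left_module_axioms.intro ring_ZH abelian_groupI)
    note D = add_subgroupD[OF freeM_add_subgroup]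
    show "\<exists>y\<in>carrier ?F. y \<oplus>\<^bsub>?F\<^esub> u = \<zero>\<^bsub>?F\<^esub>"
      if "u \<in> carrier ?F" for u
      using that D(3) by (intro bexI[of _ "- u"]) (auto simp: free_module_simps)
    show "u \<oplus>\<^bsub>?F\<^esub> v \<in> carrier ?F"
      if "u \<in> carrier ?F" "v \<in> carrier ?F" for u v
      using that D(4) by (simp add: free_module_simps)
    show "\<zero>\<^bsub>?F\<^esub> \<in> carrier ?F" using D(1) by (simp add: free_module_simps)
  next
    have c: "u i \<in> carrier ZH" if "u \<in> carrier ?F" for u i
      using that freeM_component by (auto simp: free_module_simps)
    show "a \<odot>\<^bsub>?F\<^esub> u \<in> carrier ?F"
      if "a \<in> carrier ZH" "u \<in> carrier ?F" for a u
      using smult_freeM that by (simp add: free_module_simps)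
    show "(a \<oplus>\<^bsub>ZH\<^esub> b) \<odot>\<^bsub>?F\<^esub> u = a \<odot>\<^bsub>?F\<^esub> u \<oplus>\<^bsub>?F\<^esub> b \<odot>\<^bsub>?F\<^esub> u"
      if "a \<in> carrier ZH" "b \<in> carrier ZH" "u \<in> carrier ?F" for a b u
      using l_distr[OF that(1,2) c[OF that(3)]] by (simp add: free_module_simps ZH_simps fun_eq_iff)
    show "a \<odot>\<^bsub>?F\<^esub> (u \<oplus>\<^bsub>?F\<^esub> v) = a \<odot>\<^bsub>?F\<^esub> u \<oplus>\<^bsub>?F\<^esub> a \<odot>\<^bsub>?F\<^esub> v"
      if "a \<in> carrier ZH" "u \<in> carrier ?F" "v \<in> carrier ?F" for a u v
      using r_distr[OF c[OF that(2)] c[OF that(3)] that(1)]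
      by (simp add: free_module_simps ZH_simps fun_eq_iff plus_fun_def)
    show "(a \<otimes>\<^bsub>ZH\<^esub> b) \<odot>\<^bsub>?F\<^esub> u = a \<odot>\<^bsub>?F\<^esub> (b \<odot>\<^bsub>?F\<^esub> u)"
      if "a \<in> carrier ZH" "b \<in> carrier ZH" "u \<in> carrier ?F" for a b u
      using m_assoc[OF that(1,2) c[OF that(3)]] by (simp add: free_module_simps ZH_simps fun_eq_iff)
    show "\<one>\<^bsub>ZH\<^esub> \<odot>\<^bsub>?F\<^esub> u = u" if "u \<in> carrier ?F" for u
      using l_one[OF c[OF that]] by (simp add: free_module_simps ZH_simps fun_eq_iff)
  qed (auto simp: free_module_simps add_ac)
qed

text \<open>The bridge between the two descriptions of modules: scalar multiplication is the
  integer-linear extension of the group action. Thus additive equivariant maps are linear over the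
  group ring.\<close>

lemma smult_eq_sum_act:
  assumes a: "a \<in> carrier ZH" and v: "v \<in> freeM H r"
  shows "(\<lambda>i. conv a (v i)) = (\<Sum>g | a g \<noteq> 0. zmul (a g) (act g v))"
proof (intro HOL.ext)
  fix i x
  have fv: "finite {h. v i h \<noteq> 0}" and vH: "{h. v i h \<noteq> 0} \<subseteq> H"
    using freeM_component[OF v, of i] by (auto simp: ZH_simps)
  have "conv a (v i) x = pairing a (\<lambda>g. act g v i x)"
    unfolding conv_pairing
  proof (rule pairing_cong)
    fix g assume "a g \<noteq> 0"
    then have g: "g \<in> H" "g \<in> carrier G" using a H_carrier by (auto simp: ZH_simps)
    have "pairing (v i) (\<lambda>h. if g \<otimes> h = x then 1 else 0) =
        (if x \<in> carrier G then pairing (v i) (\<lambda>h. if h = inv g \<otimes> x then 1 else 0) else pairing (v i) (\<lambda>h. if h = x then 1 else 0))"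
    proof (cases "x \<in> carrier G")
      case True
      have "g \<otimes> h = x \<longleftrightarrow> h = inv g \<otimes> x" if "v i h \<noteq> 0" for h
        using that vH H_carrier g True inv_solve_left by (metis (mono_tags, lifting) mem_Collect_eq subsetD)
      then show ?thesis using True by (auto intro!: pairing_cong)
    next
      \<comment> \<open>Outside the carrier both sides vanish: products of group elements stay
        inside it, and \<open>act\<close> leaves there a coordinate of \<open>v\<close> that is
        0.\<close>
      case False
      have "g \<otimes> h \<noteq> x" "h \<noteq> x" if "v i h \<noteq> 0" for h
        using that vH H_carrier g False m_closed by (metis (mono_tags, lifting) mem_Collect_eq subsetD)+
      then show ?thesis using False by (auto intro!: pairing_cong)
    qed
    then show "pairing (v i) (\<lambda>h. if g \<otimes> h = x then 1 else 0) = act g v i x"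
      by (simp add: pairing_delta[OF fv] act_def)
  qed
  then show "conv a (v i) x = (\<Sum>g | a g \<noteq> 0. zmul (a g) (act g v)) i x"
    by (simp add: pairing_def sum_fun_apply zmul_fun_apply)
qed

lemma ghom_smult:
  assumes f: "ghom H act (freeM H r) \<rho> f" and a: "a \<in> carrier ZH" and v: "v \<in> freeM H r"
  shows "f (\<lambda>i. conv a (v i)) = (\<Sum>g | a g \<noteq> 0. zmul (a g) (\<rho> g (f v)))"
proof -
  have g: "g \<in> H" if "g \<in> {g. a g \<noteq> 0}" for g using a that by (auto simp: ZH_simps)
  have m: "act g v \<in> freeM H r" if "g \<in> H" for g
    using gmodD(3)[OF freeM_gmod[OF H]] that v by blast
  have "f (\<lambda>i. conv a (v i)) = (\<Sum>g | a g \<noteq> 0. f (zmul (a g) (act g v)))"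
    unfolding smult_eq_sum_act[OF a v]
    by (intro additive_on_sum[OF ghomD(1)[OF f] freeM_add_subgroup] add_subgroup_zmul[OF freeM_add_subgroup] m g)
  also have "\<dots> = (\<Sum>g | a g \<noteq> 0. zmul (a g) (\<rho> g (f v)))"
    using additive_on_zmul[OF ghomD(1)[OF f] freeM_add_subgroup m[OF g]] ghomD(2)[OF f g v] by (intro sum.cong) auto
  finally show ?thesis .
qed

lemma ghom_left_module_hom:
  assumes f: "ghom H act (freeM H r) act f" "f ` freeM H r \<subseteq> freeM H s"
  shows "f \<in> left_module_hom ZH (free_module r) (free_module s)"
  unfolding left_module_hom_def
proof (intro CollectI conjI ballI)
  show "f \<in> carrier (free_module r) \<rightarrow> carrier (free_module s)"
    using f(2) by (auto simp: free_module_simps)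
  show "f (u \<oplus>\<^bsub>free_module r\<^esub> v) = f u \<oplus>\<^bsub>free_module s\<^esub> f v"
    if "u \<in> carrier (free_module r)" "v \<in> carrier (free_module r)" for u v
    using that additive_onD(1)[OF ghomD(1)[OF f(1)] freeM_add_subgroup] by (simp add: free_module_simps)
  show "f (a \<odot>\<^bsub>free_module r\<^esub> v) = a \<odot>\<^bsub>free_module s\<^esub> f v"
    if "a \<in> carrier ZH" "v \<in> carrier (free_module r)" for a v
    using ghom_smult[OF f(1) that(1), of v] smult_eq_sum_act[OF that(1), of "f v" s] that(2) f(2)
    by (auto simp: free_module_simps)
qed

lemma ghom_trivial_module_hom:
  assumes f: "ghom H act (freeM H r) (\<lambda>_ n. n) f"
  shows "f \<in> left_module_hom ZH (free_module r) trivial_module"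
  unfolding left_module_hom_def
proof (intro CollectI conjI ballI)
  show "f \<in> carrier (free_module r) \<rightarrow> carrier trivial_module" by (simp add: trivial_module_def)
  show "f (u \<oplus>\<^bsub>free_module r\<^esub> v) = f u \<oplus>\<^bsub>trivial_module\<^esub> f v"
    if "u \<in> carrier (free_module r)" "v \<in> carrier (free_module r)" for u v
    using that additive_onD(1)[OF ghomD(1)[OF f(1)] freeM_add_subgroup]
    by (simp add: free_module_simps trivial_module_def)
  show "f (a \<odot>\<^bsub>free_module r\<^esub> v) = a \<odot>\<^bsub>trivial_module\<^esub> f v"
    if "a \<in> carrier ZH" "v \<in> carrier (free_module r)" for a v
    using ghom_smult[OF f(1) that(1), of v] that(2)
    by (simp add: free_module_simps trivial_module_def sum_distrib_right)
qed

text \<open>Adds the k-th coordinate as a scalar multiple of a basis vector; truncations then serve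
  for induction along the coordinates in the next two lemmas.\<close>

lemma trunc_Suc: "trunc (Suc k) v = trunc k v + (\<lambda>i. conv (v k) (bas k i))" if "v \<in> freeM H r"
proof -
  interpret ring ZH by (rule ring_ZH)
  have "conv (v k) (\<lambda>x. if x = \<one> then 1 else 0) = v k"
    using r_one[OF freeM_component[OF that]] by (simp add: ZH_simps)
  moreover have "bas k i = (if i = k then (\<lambda>x. if x = \<one> then 1 else 0) else 0)" for i
    by (auto simp: bas_def)
  ultimately have "conv (v k) (bas k i) = (if i = k then v k else 0)" for i
    by (simp add: conv_zero)
  then show ?thesis by (auto simp: trunc_def fun_eq_iff less_Suc_eq)
qed

lemma trunc_zero: "trunc 0 v = 0"
  by (simp add: trunc_def fun_eq_iff)

lemma free_finitely_generated: "finitely_generated_module ZH (free_module r)"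
  unfolding finitely_generated_module_def
proof (intro exI[of _ "bas ` {..<r}"] conjI allI impI)
  show "bas ` {..<r} \<subseteq> carrier (free_module r)"
    using bas_freeM[OF H] by (auto simp: free_module_simps)
  fix K assume K: "submodule K ZH (free_module r) \<and> bas ` {..<r} \<subseteq> K"
  then interpret submodule K ZH "free_module r" by blast
  have plusK: "x + y \<in> K" if "x \<in> K" "y \<in> K" for x y
    using m_closed[OF that] by (simp add: free_module_simps)
  have "trunc k v \<in> K" if "v \<in> freeM H r" "k \<le> r" for v k
    using that(2)
  proof (induction k)
    case 0
    have "0 \<in> K" using one_closed by (simp add: free_module_def)
    then show ?case by (simp only: trunc_zero)
  next
    case (Suc k)
    then have "bas k \<in> K" and IH: "trunc k v \<in> K" using K by auto
    then have "(\<lambda>i. conv (v k) (bas k i)) \<in> K"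
      using smult_closed[OF freeM_component[OF that(1)], of "bas k"] by (simp add: free_module_simps)
    then show ?case unfolding trunc_Suc[OF that(1)] by (intro plusK IH)
  qed
  then have "v \<in> K" if "v \<in> freeM H r" for v using trunc_id[OF that] that by fastforce
  then show "K = carrier (free_module r)" using subset by (auto simp: free_module_simps)
qed simp

lemma free_projective: "projective_module ZH (free_module r)"
  unfolding projective_module_def
proof (intro conjI allI impI free_left_module)
  fix L :: "('a \<Rightarrow> int, (nat \<Rightarrow> 'a \<Rightarrow> int) \<Rightarrow> 'a \<Rightarrow> int) module"
    and N :: "('a \<Rightarrow> int, nat \<Rightarrow> 'a \<Rightarrow> int) module" and p f
  assume A: "left_module ZH L \<and> left_module ZH N \<and> p \<in> left_module_hom ZH L N \<and>
    p ` carrier L = carrier N \<and> f \<in> left_module_hom ZH (free_module r) N"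
  interpret L: left_module ZH L using A by blast
  interpret N: left_module ZH N using A by blast
  have p: "p \<in> carrier L \<rightarrow> carrier N"
    "\<And>u v. u \<in> carrier L \<Longrightarrow> v \<in> carrier L \<Longrightarrow> p (u \<oplus>\<^bsub>L\<^esub> v) = p u \<oplus>\<^bsub>N\<^esub> p v"
    "\<And>a u. a \<in> carrier ZH \<Longrightarrow> u \<in> carrier L \<Longrightarrow> p (a \<odot>\<^bsub>L\<^esub> u) = a \<odot>\<^bsub>N\<^esub> p u"
    using A unfolding left_module_hom_def by blast+
  have f: "\<And>u. u \<in> freeM H r \<Longrightarrow> f u \<in> carrier N"
    "\<And>u v. u \<in> freeM H r \<Longrightarrow> v \<in> freeM H r \<Longrightarrow> f (u + v) = f u \<oplus>\<^bsub>N\<^esub> f v"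
    "\<And>a u. a \<in> carrier ZH \<Longrightarrow> u \<in> freeM H r \<Longrightarrow> f (\<lambda>i. conv a (u i)) = a \<odot>\<^bsub>N\<^esub> f u"
    using A unfolding left_module_hom_def by (auto simp: free_module_simps)
  have "\<exists>y. y \<in> carrier L \<and> p y = f (bas i)" if "i < r" for i
  proof -
    have "f (bas i) \<in> p ` carrier L" using A f(1)[OF bas_freeM[OF H that]] by simp
    then show ?thesis by auto
  qed
  then obtain m where m: "\<And>i. i < r \<Longrightarrow> m i \<in> carrier L" "\<And>i. i < r \<Longrightarrow> p (m i) = f (bas i)" by metis
  \<comment> \<open>The partial sum of the terms \<open>v i\<close> times \<open>m i\<close> for i <
    k, by recursion inside the record \<open>L\<close>. It lifts \<open>f\<close> on the truncation
    to k coordinates, and k = r gives the lift itself.\<close>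
  define g where "g k v = rec_nat \<zero>\<^bsub>L\<^esub> (\<lambda>k y. y \<oplus>\<^bsub>L\<^esub> v k \<odot>\<^bsub>L\<^esub> m k) k" for k and v :: "nat \<Rightarrow> 'a \<Rightarrow> int"
  have g0: "g 0 v = \<zero>\<^bsub>L\<^esub>" and gS: "g (Suc k) v = g k v \<oplus>\<^bsub>L\<^esub> v k \<odot>\<^bsub>L\<^esub> m k" for k v
    by (simp_all add: g_def)
  have gc: "g k v \<in> carrier L" if "v \<in> freeM H r" "k \<le> r" for k v
    using that(2) by (induction k) (use freeM_component[OF that(1)] m in \<open>auto simp: g0 gS\<close>)
  have gadd: "g k (u + v) = g k u \<oplus>\<^bsub>L\<^esub> g k v" if u: "u \<in> freeM H r" and v: "v \<in> freeM H r" and "k \<le> r" for k u v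
    using that(3)
  proof (induction k)
    case (Suc k)
    have c: "u k \<in> carrier ZH" "v k \<in> carrier ZH" using u v freeM_component by blast+
    have "(u + v) k \<odot>\<^bsub>L\<^esub> m k = u k \<odot>\<^bsub>L\<^esub> m k \<oplus>\<^bsub>L\<^esub> v k \<odot>\<^bsub>L\<^esub> m k"
      using L.smult_l_distr[OF c m(1)[of k]] Suc.prems by (simp add: ZH_simps plus_fun_def)
    moreover have "g k (u + v) = g k u \<oplus>\<^bsub>L\<^esub> g k v" using Suc.prems by (intro Suc.IH) simp
    moreover have "g k u \<in> carrier L" "g k v \<in> carrier L" "m k \<in> carrier L"
      using Suc.prems gc[OF u] gc[OF v] m(1) by simp_all
    ultimately show ?case unfolding gS using c by (simp only: L.M.a_ac L.M.a_closed L.smult_closed)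
  qed (simp add: g0)
  have gsm: "g k (\<lambda>i. conv a (v i)) = a \<odot>\<^bsub>L\<^esub> g k v" if a: "a \<in> carrier ZH" and v: "v \<in> freeM H r" and "k \<le> r" for k a v
    using that(3)
  proof (induction k)
    case 0
    have "a \<odot>\<^bsub>L\<^esub> \<zero>\<^bsub>L\<^esub> \<oplus>\<^bsub>L\<^esub> a \<odot>\<^bsub>L\<^esub> \<zero>\<^bsub>L\<^esub> = a \<odot>\<^bsub>L\<^esub> \<zero>\<^bsub>L\<^esub>"
      using L.smult_r_distr[OF a, of "\<zero>\<^bsub>L\<^esub>" "\<zero>\<^bsub>L\<^esub>"] by simp
    then show ?case using a by (simp add: g0)
  next
    case (Suc k)
    have c: "v k \<in> carrier ZH" using v freeM_component by blast
    show ?case using Suc c a m(1) gc[OF v] L.smult_assoc1[OF a c m(1)[of k]]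
      by (simp add: gS L.smult_r_distr ZH_simps(2))
  qed
  have pg: "p (g k v) = f (trunc k v)" if v: "v \<in> freeM H r" and "k \<le> r" for k v
    using that(2)
  proof (induction k)
    case 0
    have "p \<zero>\<^bsub>L\<^esub> \<oplus>\<^bsub>N\<^esub> p \<zero>\<^bsub>L\<^esub> = p \<zero>\<^bsub>L\<^esub>" using p(2)[of "\<zero>\<^bsub>L\<^esub>" "\<zero>\<^bsub>L\<^esub>"] by simp
    moreover have "p \<zero>\<^bsub>L\<^esub> \<in> carrier N" using p(1) L.M.zero_closed by blast
    ultimately have 1: "p \<zero>\<^bsub>L\<^esub> = \<zero>\<^bsub>N\<^esub>" using N.M.add.r_cancel_one by simp
    have z: "(0 :: nat \<Rightarrow> 'a \<Rightarrow> int) \<in> freeM H r" by (rule add_subgroupD(1)[OF freeM_add_subgroup])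
    then have "f 0 \<oplus>\<^bsub>N\<^esub> f 0 = f 0" using f(2)[of 0 0] by simp
    then have "f 0 = \<zero>\<^bsub>N\<^esub>" using f(1)[OF z] N.M.add.r_cancel_one by simp
    then show ?case unfolding g0 trunc_zero 1 ..
  next
    case (Suc k)
    have c: "v k \<in> carrier ZH" using v freeM_component by blast
    have k: "k < r" using Suc.prems by simp
    have "p (g (Suc k) v) = p (g k v) \<oplus>\<^bsub>N\<^esub> v k \<odot>\<^bsub>N\<^esub> f (bas k)"
      using gc[OF v, of k] k c m by (simp add: gS p)
    also have "\<dots> = f (trunc k v) \<oplus>\<^bsub>N\<^esub> f (\<lambda>i. conv (v k) (bas k i))"
      using Suc.IH k f(3)[OF c bas_freeM[OF H k]] by simp
    also have "\<dots> = f (trunc k v + (\<lambda>i. conv (v k) (bas k i)))"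
    proof (rule f(2)[symmetric])
      show "trunc k v \<in> freeM H r"
        using trunc_freeM[OF v, of k] freeM_mono[of H H k r] k by auto
      show "(\<lambda>i. conv (v k) (bas k i)) \<in> freeM H r" by (rule smult_freeM[OF c bas_freeM[OF H k]])
    qed
    finally show ?case unfolding trunc_Suc[OF v] .
  qed
  show "\<exists>g\<in>left_module_hom ZH (free_module r) L. \<forall>x\<in>carrier (free_module r). p (g x) = f x"
  proof (intro bexI[of _ "g r"] ballI)
    show "p (g r x) = f x" if "x \<in> carrier (free_module r)" for x
      using pg[of x r] trunc_id that by (simp add: free_module_simps)
    show "g r \<in> left_module_hom ZH (free_module r) L"
      unfolding left_module_hom_def using gc gadd gsm by (auto simp: free_module_simps)
  qed
qed

text \<open>The fixed point is unrolled into a sequence: a function chooses a cover for every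
  \<open>FPU\<close> module, and passing to kernels is iterated.\<close>

lemma FP_imp_type_FP_inf:
  assumes "FP H (\<lambda>_ n. n) (UNIV :: int set)"
  shows "type_FP_inf (G\<lparr>carrier := H\<rparr>)"
proof -
  obtain r0 \<epsilon> where \<epsilon>: "ghom H act (freeM H r0) (\<lambda>_ n. n) \<epsilon>" "\<epsilon> ` freeM H r0 = (UNIV :: int set)"
    "FPU H (ker_on (freeM H r0) \<epsilon>)" using assms unfolding FP_def by blast
  have "\<forall>A. \<exists>q. FPU H A \<longrightarrow> ghom H act (freeM H (fst q)) act (snd q) \<and> snd q ` freeM H (fst q) = A \<and>
      FPU H {v\<in>freeM H (fst q). snd q v = 0}"
  proof
    fix A
    show "\<exists>q. FPU H A \<longrightarrow> ghom H act (freeM H (fst q)) act (snd q) \<and> snd q ` freeM H (fst q) = A \<and>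
      FPU H {v\<in>freeM H (fst q). snd q v = 0}"
    proof (cases "FPU H A")
      case True
      then obtain r f where "ghom H act (freeM H r) act f" "f ` freeM H r = A" "FPU H (ker_on (freeM H r) f)"
        using FPU_iff_FP[of H A] unfolding FP_def by blast
      then show ?thesis by (intro exI[of _ "(r, f)"]) simp
    qed simp
  qed
  then obtain q where "\<forall>A. FPU H A \<longrightarrow> ghom H act (freeM H (fst (q A))) act (snd (q A)) \<and>
      snd (q A) ` freeM H (fst (q A)) = A \<and> FPU H {v\<in>freeM H (fst (q A)). snd (q A) v = 0}"
    by (rule choice[THEN exE])
  then have q: "\<And>A. FPU H A \<Longrightarrow> ghom H act (freeM H (fst (q A))) act (snd (q A))"
    "\<And>A. FPU H A \<Longrightarrow> snd (q A) ` freeM H (fst (q A)) = A"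
    "\<And>A. FPU H A \<Longrightarrow> FPU H {v\<in>freeM H (fst (q A)). snd (q A) v = 0}" by blast+
  \<comment> \<open>\<open>K n\<close> is the n-th syzygy, that is, the kernel inside the term of
    degree n. Its chosen cover supplies the term of degree n + 1 and the differential
    \<open>d n\<close>, whose image is \<open>K n\<close>.\<close>
  define K where "K = rec_nat (ker_on (freeM H r0) \<epsilon>) (\<lambda>_ A. {v\<in>freeM H (fst (q A)). snd (q A) v = 0})"
  have K0: "K 0 = ker_on (freeM H r0) \<epsilon>" and
    KS: "K (Suc n) = {v\<in>freeM H (fst (q (K n))). snd (q (K n)) v = 0}" for n
    by (simp_all add: K_def)
  have FK: "FPU H (K n)" for n by (induction n) (use K0 KS \<epsilon>(3) q(3) in auto)
  define rk where "rk n = (case n of 0 \<Rightarrow> r0 | Suc n \<Rightarrow> fst (q (K n)))" for n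
  define d where "d n = snd (q (K n))" for n
  have Ksub: "K n \<subseteq> freeM H (rk n)" for n
    by (cases n) (auto simp: K0 KS rk_def)
  have d: "ghom H act (freeM H (rk (Suc n))) act (d n)" "d n ` freeM H (rk (Suc n)) = K n" for n
    using q(1,2)[OF FK[of n]] by (simp_all add: rk_def d_def)
  show ?thesis
    unfolding type_FP_inf_def
  proof (rule exI[of _ "\<lambda>n. free_module (rk n)"], rule exI[of _ d], rule exI[of _ \<epsilon>], intro conjI allI)
    show "projective_module ZH (free_module (rk i))" for i by (rule free_projective)
    show "finitely_generated_module ZH (free_module (rk i))" for i by (rule free_finitely_generated)
    show "d i \<in> left_module_hom ZH (free_module (rk (Suc i))) (free_module (rk i))" for i
      using d Ksub by (intro ghom_left_module_hom) auto
    show "\<epsilon> \<in> left_module_hom ZH (free_module (rk 0)) trivial_module"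
      using ghom_trivial_module_hom[OF \<epsilon>(1)] by (simp add: rk_def)
    show "\<epsilon> ` carrier (free_module (rk 0)) = carrier trivial_module"
      using \<epsilon>(2) by (simp add: rk_def free_module_simps trivial_module_def)
    show "d 0 ` carrier (free_module (rk (Suc 0))) = a_kernel (free_module (rk 0)) trivial_module \<epsilon>"
      using d(2)[of 0] by (simp add: a_kernel_def' free_module_simps trivial_module_def K0 rk_def)
    show "d (Suc i) ` carrier (free_module (rk (Suc (Suc i)))) =
        a_kernel (free_module (rk (Suc i))) (free_module (rk i)) (d i)" for i
      using d(2)[of "Suc i"] by (simp add: a_kernel_def' free_module_simps KS) (simp add: rk_def d_def)
  qed
qed

end

end

section \<open>Towers of cyclic and ascending HNN extensions\<close>

context group
begin

lemma generate_finite_subset: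
  assumes "a \<in> generate G S"
  shows "\<exists>F. finite F \<and> F \<subseteq> S \<and> a \<in> generate G F"
  using assms
proof (induction rule: generate.induct)
  case one
  then show ?case by (intro exI[of _ "{}"]) (auto intro: generate.one)
next
  case (incl h)
  then show ?case by (intro exI[of _ "{h}"]) (auto intro: generate.incl)
next
  case (inv h)
  then show ?case by (intro exI[of _ "{h}"]) (auto intro: generate.inv)
next
  case (eng a b)
  then obtain F F' where F: "finite F" "F \<subseteq> S" "a \<in> generate G F" "finite F'" "F' \<subseteq> S" "b \<in> generate G F'"
    by blast
  have "a \<in> generate G (F \<union> F')" "b \<in> generate G (F \<union> F')"
    using F(3,6) mono_generate[of F "F \<union> F'"] mono_generate[of F' "F \<union> F'"] by auto
  then show ?case using F by (intro exI[of _ "F \<union> F'"]) (auto intro: generate.eng)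
qed

lemma generate_finite_subsets:
  assumes "finite A" "A \<subseteq> generate G S"
  obtains F where "finite F" "F \<subseteq> S" "A \<subseteq> generate G F"
proof -
  have "\<forall>a\<in>A. \<exists>F. finite F \<and> F \<subseteq> S \<and> a \<in> generate G F" using assms(2) generate_finite_subset by blast
  then obtain F where F: "\<And>a. a \<in> A \<Longrightarrow> finite (F a) \<and> F a \<subseteq> S \<and> a \<in> generate G (F a)" by metis
  have "a \<in> generate G (\<Union>(F ` A))" if "a \<in> A" for a
    using F[OF that] mono_generate[of "F a" "\<Union>(F ` A)"] that by blast
  moreover have "finite (\<Union>(F ` A))" "\<Union>(F ` A) \<subseteq> S" using F assms(1) by auto
  ultimately show ?thesis using that[of "\<Union>(F ` A)"] by blast
qed

section \<open>Conjugation and commutator identities\<close>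

definition cj :: "'a \<Rightarrow> 'a \<Rightarrow> 'a" where
  "cj x g = x \<otimes> g \<otimes> inv x"

definition cm :: "'a \<Rightarrow> 'a \<Rightarrow> 'a" where
  "cm x y = x \<otimes> y \<otimes> inv x \<otimes> inv y"

lemma cancel_left:
  "x \<in> carrier G \<Longrightarrow> y \<in> carrier G \<Longrightarrow> inv x \<otimes> (x \<otimes> y) = y"
  "x \<in> carrier G \<Longrightarrow> y \<in> carrier G \<Longrightarrow> x \<otimes> (inv x \<otimes> y) = y"
  by (simp_all add: m_assoc[symmetric])

lemmas word_simps = m_assoc inv_mult_group cancel_left

lemma cj_closed [simp]: "x \<in> carrier G \<Longrightarrow> g \<in> carrier G \<Longrightarrow> cj x g \<in> carrier G"
  and cm_closed [simp]: "x \<in> carrier G \<Longrightarrow> g \<in> carrier G \<Longrightarrow> cm x g \<in> carrier G"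
  by (simp_all add: cj_def cm_def)

lemma cj_mult: "x \<in> carrier G \<Longrightarrow> g \<in> carrier G \<Longrightarrow> h \<in> carrier G \<Longrightarrow> cj x (g \<otimes> h) = cj x g \<otimes> cj x h"
  and cj_inv: "x \<in> carrier G \<Longrightarrow> g \<in> carrier G \<Longrightarrow> cj x (inv g) = inv (cj x g)"
  and cj_cj: "x \<in> carrier G \<Longrightarrow> y \<in> carrier G \<Longrightarrow> g \<in> carrier G \<Longrightarrow> cj (x \<otimes> y) g = cj x (cj y g)"
  and cj_one: "x \<in> carrier G \<Longrightarrow> cj x \<one> = \<one>"
  and cj_one_left: "g \<in> carrier G \<Longrightarrow> cj \<one> g = g"
  and cj_eq_cm: "x \<in> carrier G \<Longrightarrow> g \<in> carrier G \<Longrightarrow> cj x g = cm x g \<otimes> g"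
  and cm_inv: "x \<in> carrier G \<Longrightarrow> g \<in> carrier G \<Longrightarrow> inv (cm x g) = cm g x"
  by (simp_all add: cj_def cm_def word_simps)

lemma cj_cm: "x \<in> carrier G \<Longrightarrow> g \<in> carrier G \<Longrightarrow> h \<in> carrier G \<Longrightarrow> cj x (cm g h) = cm (cj x g) (cj x h)"
  by (simp add: cj_def cm_def word_simps)

lemma cm_mult_left:
  "a \<in> carrier G \<Longrightarrow> b \<in> carrier G \<Longrightarrow> c \<in> carrier G \<Longrightarrow> cm (a \<otimes> b) c = cj a (cm b c) \<otimes> cm a c"
  and cm_inv_left: "a \<in> carrier G \<Longrightarrow> b \<in> carrier G \<Longrightarrow> cm (inv a) b = cj (inv a) (inv (cm a b))"
  by (simp_all add: cj_def cm_def word_simps)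

lemma cj_generate:
  assumes x: "x \<in> carrier G" and S: "S \<subseteq> carrier G" and T: "subgroup T G"
    and cS: "\<And>s. s \<in> S \<Longrightarrow> cj x s \<in> T" and g: "g \<in> generate G S"
  shows "cj x g \<in> T"
  using g
proof (induction rule: generate.induct)
  case one
  then show ?case using x subgroup.one_closed[OF T] by (simp add: cj_one)
next
  case (incl h)
  then show ?case by (rule cS)
next
  case (inv h)
  then show ?case using x S subgroup.m_inv_closed[OF T] cS by (auto simp: cj_inv)
next
  case (eng a b)
  then show ?case using x generate_in_carrier[OF S] subgroup.m_closed[OF T] by (simp add: cj_mult)
qed

lemma normal_cj: "N \<lhd> G \<Longrightarrow> x \<in> carrier G \<Longrightarrow> n \<in> N \<Longrightarrow> cj x n \<in> N"
  by (simp add: cj_def normal.inv_op_closed2)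

text \<open>Conjugation moves the factors from \<open>N\<close> to the right. Later \<open>w\<close>
  is the part realised by chosen generators and \<open>n\<close> the error in the next term of the
  series.\<close>

lemma generate_union_normal:
  assumes N: "N \<lhd> G" and E: "E \<subseteq> carrier G" and z: "z \<in> generate G (E \<union> N)"
  shows "\<exists>w\<in>generate G E. \<exists>n\<in>N. z = w \<otimes> n"
  using z
proof (induction rule: generate.induct)
  have sN: "subgroup N G" by (rule normal_imp_subgroup[OF N])
  have Nc: "N \<subseteq> carrier G" by (rule subgroup.subset[OF sN])
  note gE = generate_in_carrier[OF E]
  {
    case one
    then show ?case using generate.one subgroup.one_closed[OF sN] by force
  next
    case (incl h)
    then show ?case
    proof
      assume "h \<in> E"
      then show ?thesis using generate.incl[of h E G] subgroup.one_closed[OF sN] E by force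
    next
      assume "h \<in> N"
      then show ?thesis using generate.one[of G E] Nc by force
    qed
  next
    case (inv h)
    then show ?case
    proof
      assume "h \<in> E"
      then show ?thesis using generate.inv[of h E G] subgroup.one_closed[OF sN] E by force
    next
      assume "h \<in> N"
      then show ?thesis using generate.one[of G E] Nc subgroup.m_inv_closed[OF sN, of h] by force
    qed
  next
    case (eng a b)
    then obtain w n v m where w: "w \<in> generate G E" "n \<in> N" "a = w \<otimes> n" "v \<in> generate G E" "m \<in> N" "b = v \<otimes> m"
      by blast
    have "a \<otimes> b = (w \<otimes> v) \<otimes> (cj (inv v) n \<otimes> m)"
      using w gE Nc by (auto simp: cj_def word_simps subset_iff)
    moreover have "cj (inv v) n \<otimes> m \<in> N"
      using w gE normal_cj[OF N] subgroup.m_closed[OF sN] by simp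
    ultimately show ?case using generate.eng[OF w(1,4)] by blast
  }
qed

inductive tower :: "'a set \<Rightarrow> bool" where
  tower_one: "tower {\<one>}"
| tower_step: "tower M \<Longrightarrow> x \<in> carrier G \<Longrightarrow> (\<And>m. m \<in> M \<Longrightarrow> x \<otimes> m \<otimes> inv x \<in> M) \<Longrightarrow>
    tower (generate G (insert x M))"

lemma tower_subgroup: "tower M \<Longrightarrow> subgroup M G"
proof (induction rule: tower.induct)
  case (tower_step M x)
  then show ?case using subgroup.subset by (intro generate_is_subgroup) auto
qed (rule triv_subgroup)

text \<open>The elements of \<open>E\<close> are adjoined one by one. Each conjugates the group
  built so far into itself because e f e^-1 = [e, f] f and [e, f] already lies in
  \<open>K\<close>.\<close>

lemma tower_extend:
  assumes K: "tower K" and "finite E" "E \<subseteq> carrier G"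
    and "\<And>e k. e \<in> E \<Longrightarrow> k \<in> K \<Longrightarrow> cj e k \<in> K" "\<And>e f. e \<in> E \<Longrightarrow> f \<in> E \<Longrightarrow> cm e f \<in> K"
  shows "tower (generate G (K \<union> E))"
  using assms(2-)
proof (induction E rule: finite_induct)
  case empty
  have "generate G K = K"
    using generateI[OF tower_subgroup[OF K] order_refl] by blast
  then show ?case using K by simp
next
  case (insert e E)
  let ?M = "generate G (K \<union> E)"
  have Kc: "K \<subseteq> carrier G" using tower_subgroup[OF K] subgroup.subset by blast
  have c: "K \<union> E \<subseteq> carrier G" and e: "e \<in> carrier G" using Kc insert.prems(1) by auto
  have sM: "subgroup ?M G" by (rule generate_is_subgroup[OF c])
  have M: "tower ?M" using insert by simp
  have "cj e m \<in> ?M" if "m \<in> ?M" for m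
  proof (rule cj_generate[OF e c sM _ that])
    fix s assume "s \<in> K \<union> E"
    then show "cj e s \<in> ?M"
    proof
      assume "s \<in> K"
      then show ?thesis using insert.prems(2)[of e s] by (auto intro: generate.incl)
    next
      assume s: "s \<in> E"
      have "cj e s = cm e s \<otimes> s" using e s c by (intro cj_eq_cm) auto
      moreover have "cm e s \<in> ?M" using insert.prems(3)[of e s] s by (auto intro: generate.incl)
      ultimately show ?thesis using s by (auto intro: generate.eng generate.incl)
    qed
  qed
  then have "tower (generate G (insert e ?M))"
    by (intro tower_step M e) (simp add: cj_def)
  also have "generate G (insert e ?M) = generate G (K \<union> insert e E)"
  proof
    have s: "subgroup (generate G (K \<union> insert e E)) G" using c e by (intro generate_is_subgroup) auto
    show "generate G (insert e ?M) \<subseteq> generate G (K \<union> insert e E)"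
      using mono_generate[of "K \<union> E" "K \<union> insert e E"]
      by (intro generate_subgroup_incl s) (auto intro: generate.incl)
    show "generate G (K \<union> insert e E) \<subseteq> generate G (insert e ?M)"
      by (rule mono_generate) (auto intro: generate.incl)
  qed
  finally show ?case .
qed

text \<open>For normal \<open>B\<close> contained in \<open>A\<close>: every finite subset of A/B
  lies in a finitely generated subgroup mapped into itself by conjugation with \<open>Xs\<close>.
  Adding \<open>B\<close> to the generators expresses this without forming the quotient.\<close>

definition good_level :: "'a set \<Rightarrow> 'a set \<Rightarrow> 'a set \<Rightarrow> bool" where
  "good_level Xs A B \<longleftrightarrow> (\<forall>D. finite D \<and> D \<subseteq> A \<longrightarrow> (\<exists>E. finite E \<and> E \<subseteq> A \<and>
     D \<subseteq> generate G (E \<union> B) \<and> (\<forall>x\<in>Xs. \<forall>e\<in>E. cj x e \<in> generate G (E \<union> B))))"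

lemma good_levelD:
  assumes "good_level Xs A B" "finite D" "D \<subseteq> A"
  obtains E where "finite E" "E \<subseteq> A" "D \<subseteq> generate G (E \<union> B)"
    "\<And>x e. x \<in> Xs \<Longrightarrow> e \<in> E \<Longrightarrow> cj x e \<in> generate G (E \<union> B)"
proof -
  have "\<exists>E. finite E \<and> E \<subseteq> A \<and> D \<subseteq> generate G (E \<union> B) \<and> (\<forall>x\<in>Xs. \<forall>e\<in>E. cj x e \<in> generate G (E \<union> B))"
    using assms(1)[unfolded good_level_def, rule_format, of D] assms(2,3) by simp
  then obtain E where E: "finite E \<and> E \<subseteq> A \<and> D \<subseteq> generate G (E \<union> B) \<and>
      (\<forall>x\<in>Xs. \<forall>e\<in>E. cj x e \<in> generate G (E \<union> B))" by (rule exE)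
  show ?thesis
  proof (rule that[of E])
    show "finite E" "E \<subseteq> A" "D \<subseteq> generate G (E \<union> B)" using E by simp_all
    fix x e assume "x \<in> Xs" "e \<in> E"
    then show "cj x e \<in> generate G (E \<union> B)" using E by meson
  qed
qed

text \<open>Refining a finite set level by level: the errors made at level \<open>i\<close> lie one level deeper,
  where they are absorbed, and the generators chosen so far join the operators.\<close>

lemma tower_cover:
  assumes L: "\<And>i. L i \<lhd> G" and desc: "\<And>i. L (Suc i) \<subseteq> L i"
    and comm: "\<And>i h n. h \<in> L i \<Longrightarrow> n \<in> L 0 \<Longrightarrow> cm h n \<in> L (Suc i)"
    and Xs: "Xs \<subseteq> carrier G" and good: "\<And>i. good_level Xs (L i) (L (Suc i))"
    and L_end: "L (i + k) = {\<one>}" and D: "finite D" "D \<subseteq> L i" and Y: "finite Y" "Y \<subseteq> Xs \<union> L 0"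
  shows "\<exists>K. tower K \<and> D \<subseteq> K \<and> K \<subseteq> L i \<and> (\<forall>y\<in>Y. \<forall>k\<in>K. cj y k \<in> K)"
  using L_end D Y
proof (induction k arbitrary: i D Y)
  case 0
  then have "cj y \<one> = \<one>" if "y \<in> Y" for y
    using that Xs subgroup.subset[OF normal_imp_subgroup[OF L[of 0]]] by (intro cj_one) auto
  then show ?case using 0 tower_one by (intro exI[of _ "{\<one>}"]) auto
next
  case (Suc k)
  have sL: "subgroup (L i) G" for i by (rule normal_imp_subgroup[OF L])
  have Lc: "L i \<subseteq> carrier G" for i by (rule subgroup.subset[OF sL])
  have L0: "L i \<subseteq> L 0" for i by (induction i) (use desc in blast)+
  have Yc: "Y \<subseteq> carrier G" using Suc.prems(5) Xs Lc by blast
  obtain E where E: "finite E" "E \<subseteq> L i" "D \<subseteq> generate G (E \<union> L (Suc i))"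
    "\<And>x e. x \<in> Xs \<Longrightarrow> e \<in> E \<Longrightarrow> cj x e \<in> generate G (E \<union> L (Suc i))"
    using good_levelD[OF good Suc.prems(2,3)] by metis
  have Ec: "E \<subseteq> carrier G" using E(2) Lc by blast
  \<comment> \<open>All elements that must land in the final subgroup: the given ones and the
    conjugates of the new generators.\<close>
  let ?Z = "D \<union> (\<lambda>(y, e). cj y e) ` (Y \<times> E)"
  have "\<exists>w n. z = w \<otimes> n \<and> w \<in> generate G E \<and> n \<in> L (Suc i)" if "z \<in> ?Z" for z
  proof -
    have "z \<in> generate G (E \<union> L (Suc i))"
      using that
    proof
      assume "z \<in> (\<lambda>(y, e). cj y e) ` (Y \<times> E)"
      then obtain y e where ye: "y \<in> Y" "e \<in> E" "z = cj y e" by auto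
      show ?thesis
      proof (cases "y \<in> Xs")
        case False
        then have y: "y \<in> L 0" using ye Suc.prems(5) by blast
        have c: "y \<in> carrier G" "e \<in> carrier G" using ye Yc Ec by auto
        \<comment> \<open>Operators from the group \<open>L 0\<close> act trivially modulo the next
          level, so only those in \<open>Xs\<close> rely on \<open>good\<close>.\<close>
        have "cm e y \<in> L (Suc i)" using comm y ye E(2) by blast
        then have "cm y e \<in> L (Suc i)" using cm_inv[OF c(2,1)] subgroup.m_inv_closed[OF sL] by metis
        moreover have "z = cm y e \<otimes> e" using cj_eq_cm[OF c] ye by simp
        ultimately show ?thesis using ye by (auto intro: generate.eng generate.incl)
      qed (use ye E(4) in blast)
    qed (use E(3) in blast)
    then show ?thesis using generate_union_normal[OF L Ec] by blast
  qed
  then obtain w n where wn: "\<And>z. z \<in> ?Z \<Longrightarrow> z = w z \<otimes> n z \<and> w z \<in> generate G E \<and> n z \<in> L (Suc i)" by metis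
  \<comment> \<open>Passed to the next level are the errors of the decompositions and the
    commutators of the new generators; the latter are what \<open>tower_extend\<close>
    demands.\<close>
  let ?D = "n ` ?Z \<union> (\<lambda>(e, f). cm e f) ` (E \<times> E)"
  have "cm e f \<in> L (Suc i)" if "e \<in> E" "f \<in> E" for e f
    using comm[of e i f] that E(2) L0 by blast
  then have D1: "?D \<subseteq> L (Suc i)" using wn by auto
  have D2: "finite ?D" using Suc.prems(2,4) E(1) by simp
  have D3: "finite (Y \<union> E)" using Suc.prems(4) E(1) by simp
  have D4: "Y \<union> E \<subseteq> Xs \<union> L 0" using Suc.prems(5) E(2) L0[of i] by blast
  have D5: "L (Suc i + k) = {\<one>}" using Suc.prems(1) by simp
  obtain K where K: "tower K" "?D \<subseteq> K" "K \<subseteq> L (Suc i)" "\<forall>y\<in>Y \<union> E. \<forall>k\<in>K. cj y k \<in> K"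
    using Suc.IH[OF D5 D2 D1 D3 D4] by (elim exE conjE) (rule that)
  let ?K = "generate G (K \<union> E)"
  have cm_K: "cm e f \<in> K" if "e \<in> E" "f \<in> E" for e f
  proof -
    have "cm e f \<in> (\<lambda>(e, f). cm e f) ` (E \<times> E)" using that by (intro image_eqI[of _ _ "(e, f)"]) auto
    then show ?thesis by (rule subsetD[OF K(2) UnI2])
  qed
  have t: "tower ?K" using K(4) cm_K by (intro tower_extend K(1) E(1) Ec) auto
  have Kc: "K \<union> E \<subseteq> carrier G" using K(3) Lc Ec by blast
  have ZK: "z \<in> ?K" if "z \<in> ?Z" for z
  proof -
    have "n z \<in> K" by (rule subsetD[OF K(2) UnI1[OF imageI[OF that]]])
    then have "n z \<in> ?K" by (auto intro: generate.incl)
    moreover have "w z \<in> ?K" using wn[OF that] mono_generate[of E "K \<union> E"] by auto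
    ultimately show ?thesis using wn[OF that] generate.eng by metis
  qed
  show ?case
  proof (intro exI[of _ ?K] conjI ballI t)
    show "D \<subseteq> ?K" using ZK by blast
    show "?K \<subseteq> L i" using K(3) desc E(2) by (intro generate_subgroup_incl sL) blast
    fix y g assume y: "y \<in> Y" and g: "g \<in> ?K"
    show "cj y g \<in> ?K"
    proof (rule cj_generate[OF _ Kc generate_is_subgroup[OF Kc] _ g])
      show "y \<in> carrier G" using y Yc by blast
      fix s assume "s \<in> K \<union> E"
      then show "cj y s \<in> ?K"
      proof
        assume "s \<in> K"
        then show ?thesis using K(4) y by (auto intro: generate.incl)
      next
        assume "s \<in> E"
        then have "cj y s \<in> (\<lambda>(y, e). cj y e) ` (Y \<times> E)" using y by (intro image_eqI[of _ _ "(y, s)"]) auto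
        then show ?thesis using ZK by blast
      qed
    qed
  qed
qed

end

section \<open>Commutators and the lower central series\<close>

context group
begin

text \<open>Conjugation by \<open>a\<close> multiplies g and h by [a, g] and [a, h]. These factors
  commute with g, h and each other, so they cancel in the commutator of the two products and [g, h]
  is fixed by \<open>a\<close>.\<close>

lemma commutator_of_central:
  assumes c: "a \<in> carrier G" "g \<in> carrier G" "h \<in> carrier G"
    and z: "\<And>u. u \<in> {g, h, cm a h} \<Longrightarrow> cm a g \<otimes> u = u \<otimes> cm a g"
    and z': "\<And>u. u \<in> {g, h} \<Longrightarrow> cm a h \<otimes> u = u \<otimes> cm a h"
  shows "cm a (cm g h) = \<one>"
proof -
  define y y' where "y = cm a g" and "y' = cm a h"
  have yc: "y \<in> carrier G" "y' \<in> carrier G" using c by (simp_all add: y_def y'_def)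
  have e: "cj a g = y \<otimes> g" "cj a h = y' \<otimes> h" using c by (simp_all add: cj_eq_cm y_def y'_def)
  have k: "(y \<otimes> g) \<otimes> (y' \<otimes> h) = (y \<otimes> y') \<otimes> (g \<otimes> h)"
  proof -
    have "(y \<otimes> g) \<otimes> (y' \<otimes> h) = y \<otimes> (g \<otimes> y') \<otimes> h" using c yc by (simp add: m_assoc)
    also have "g \<otimes> y' = y' \<otimes> g" using z'[of g] by (simp add: y'_def)
    finally show ?thesis using c yc by (simp add: m_assoc)
  qed
  have k': "(y' \<otimes> h) \<otimes> (y \<otimes> g) = (y \<otimes> y') \<otimes> (h \<otimes> g)"
  proof -
    have "(y' \<otimes> h) \<otimes> (y \<otimes> g) = y' \<otimes> (h \<otimes> y) \<otimes> g" using c yc by (simp add: m_assoc)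
    also have "h \<otimes> y = y \<otimes> h" using z[of h] by (simp add: y_def)
    also have "y' \<otimes> (y \<otimes> h) \<otimes> g = (y' \<otimes> y) \<otimes> (h \<otimes> g)" using c yc by (simp add: m_assoc)
    also have "y' \<otimes> y = y \<otimes> y'" using z[of "cm a h"] by (simp add: y_def y'_def)
    finally show ?thesis .
  qed
  define k where "k = y \<otimes> y'"
  have kc: "k \<in> carrier G" using yc by (simp add: k_def)
  have ku: "k \<otimes> u = u \<otimes> k" if u: "u \<in> {g, h}" for u
  proof -
    have uc: "u \<in> carrier G" using u c by auto
    have "k \<otimes> u = y \<otimes> (y' \<otimes> u)" using uc yc by (simp add: k_def m_assoc)
    also have "y' \<otimes> u = u \<otimes> y'" using z'[OF u] by (simp add: y'_def)
    also have "y \<otimes> (u \<otimes> y') = (y \<otimes> u) \<otimes> y'" using uc yc by (simp add: m_assoc)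
    also have "y \<otimes> u = u \<otimes> y" using z[of u] u by (auto simp: y_def)
    finally show ?thesis using uc yc by (simp add: k_def m_assoc)
  qed
  have "cj a (cm g h) = cm (y \<otimes> g) (y' \<otimes> h)" using c by (simp add: cj_cm e)
  also have "\<dots> = ((y \<otimes> g) \<otimes> (y' \<otimes> h)) \<otimes> inv ((y' \<otimes> h) \<otimes> (y \<otimes> g))"
    using c yc by (simp add: cm_def word_simps)
  also have "\<dots> = (k \<otimes> (g \<otimes> h)) \<otimes> inv (k \<otimes> (h \<otimes> g))"
    unfolding k k' k_def ..
  also have "\<dots> = cj k (cm g h)"
    using c kc by (simp add: cj_def cm_def word_simps)
  also have "\<dots> = cm (cj k g) (cj k h)" using c kc by (simp add: cj_cm)
  also have "cj k g = g" using ku[of g] c kc by (simp add: cj_def m_assoc)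
  also have "cj k h = h" using ku[of h] c kc by (simp add: cj_def m_assoc)
  finally show ?thesis using c by (simp add: cj_def[of a]) (simp add: cm_def[of a "cm g h"])
qed

lemma cm_normal_commute:
  assumes L: "L \<lhd> G" and "u \<in> carrier G" "v \<in> carrier G" "cm u v \<in> L"
  shows "(L #> u) \<otimes>\<^bsub>G Mod L\<^esub> (L #> v) = (L #> v) \<otimes>\<^bsub>G Mod L\<^esub> (L #> u)"
proof -
  have s: "subgroup L G" by (rule normal_imp_subgroup[OF L])
  have "u \<otimes> v = cm u v \<otimes> (v \<otimes> u)" using assms(2,3) by (simp add: cm_def word_simps)
  then have "u \<otimes> v \<in> L #> (v \<otimes> u)" using assms(4) by (auto simp: r_coset_def)
  then have "L #> (v \<otimes> u) = L #> (u \<otimes> v)"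
    using assms(2,3) repr_independence[OF _ _ s] by simp
  then show ?thesis using assms(2,3) by (simp add: normal.rcos_sum[OF L])
qed

text \<open>The previous lemma in the quotient by \<open>L\<close>. It will show that commutators
  with elements of \<open>A\<close> do not see the derived subgroup of \<open>N\<close>.\<close>

lemma commutator_of_central_mod:
  assumes L: "L \<lhd> G" and c: "a \<in> carrier G" "g \<in> carrier G" "h \<in> carrier G"
    and z: "\<And>u. u \<in> {g, h, cm a h} \<Longrightarrow> cm (cm a g) u \<in> L"
    and z': "\<And>u. u \<in> {g, h} \<Longrightarrow> cm (cm a h) u \<in> L"
  shows "cm a (cm g h) \<in> L"
proof -
  interpret Q: group "G Mod L" by (rule normal.factorgroup_is_group[OF L])
  interpret \<pi>: group_hom G "G Mod L" "\<lambda>x. L #> x"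
    by (intro group_hom.intro group_hom_axioms.intro is_group Q.is_group normal.r_coset_hom_Mod[OF L])
  have \<pi>cm: "Q.cm (L #> u) (L #> v) = L #> cm u v" if "u \<in> carrier G" "v \<in> carrier G" for u v
    using that by (simp add: cm_def Q.cm_def del: mult_FactGroup)
  have "Q.cm (L #> a) (Q.cm (L #> g) (L #> h)) = \<one>\<^bsub>G Mod L\<^esub>"
  proof (rule Q.commutator_of_central)
    show "L #> a \<in> carrier (G Mod L)" "L #> g \<in> carrier (G Mod L)" "L #> h \<in> carrier (G Mod L)"
      using c by simp_all
    fix u
    {
      assume "u \<in> {L #> g, L #> h, Q.cm (L #> a) (L #> h)}"
      then obtain v where "v \<in> {g, h, cm a h}" "u = L #> v" using c \<pi>cm by auto
      then show "Q.cm (L #> a) (L #> g) \<otimes>\<^bsub>G Mod L\<^esub> u = u \<otimes>\<^bsub>G Mod L\<^esub> Q.cm (L #> a) (L #> g)"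
        using c z[of v] cm_normal_commute[OF L, of "cm a g" v] \<pi>cm by auto
    next
      assume "u \<in> {L #> g, L #> h}"
      then obtain v where "v \<in> {g, h}" "u = L #> v" by auto
      then show "Q.cm (L #> a) (L #> h) \<otimes>\<^bsub>G Mod L\<^esub> u = u \<otimes>\<^bsub>G Mod L\<^esub> Q.cm (L #> a) (L #> h)"
        using c z'[of v] cm_normal_commute[OF L, of "cm a h" v] \<pi>cm by auto
    }
  qed
  then have "L #> cm a (cm g h) = L" using c by (simp add: \<pi>cm)
  then show ?thesis using c coset_join1[OF _ _ normal_imp_subgroup[OF L]] by simp
qed

text \<open>By [a c, b] = a [c, b] a^-1 [a, b] and the stability of \<open>W\<close>. Containment of
  commutators in \<open>W\<close> may therefore be checked on generators of the left
  argument.\<close>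

lemma commutator_subgroup_left:
  assumes W: "subgroup W G" and A: "subgroup A G"
    and WN: "\<And>a w. a \<in> A \<Longrightarrow> w \<in> W \<Longrightarrow> cj a w \<in> W" and b: "b \<in> carrier G"
  shows "subgroup {a\<in>A. cm a b \<in> W} G"
proof (rule subgroupI)
  have Ac: "A \<subseteq> carrier G" by (rule subgroup.subset[OF A])
  show "{a\<in>A. cm a b \<in> W} \<subseteq> carrier G" using Ac by blast
  have "cm \<one> b = \<one>" using b by (simp add: cm_def)
  then show "{a\<in>A. cm a b \<in> W} \<noteq> {}" using subgroup.one_closed[OF A] subgroup.one_closed[OF W] by force
  fix a assume a: "a \<in> {a\<in>A. cm a b \<in> W}"
  then have "a \<in> carrier G" "inv a \<in> A" using Ac subgroup.m_inv_closed[OF A] by auto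
  then show "inv a \<in> {a\<in>A. cm a b \<in> W}"
    using a b cm_inv_left WN subgroup.m_inv_closed[OF W] by simp
  fix a' assume a': "a' \<in> {a\<in>A. cm a b \<in> W}"
  then have "a' \<in> carrier G" using Ac by auto
  then show "a \<otimes> a' \<in> {a\<in>A. cm a b \<in> W}"
    using a a' b \<open>a \<in> carrier G\<close> cm_mult_left WN subgroup.m_closed[OF W] subgroup.m_closed[OF A] by simp
qed

lemma commutator_subgroup_right:
  assumes W: "subgroup W G" and A: "subgroup A G"
    and WN: "\<And>a w. a \<in> A \<Longrightarrow> w \<in> W \<Longrightarrow> cj a w \<in> W" and b: "b \<in> carrier G"
  shows "subgroup {a\<in>A. cm b a \<in> W} G"
proof -
  have "cm b a \<in> W \<longleftrightarrow> cm a b \<in> W" if "a \<in> A" for a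
    using cm_inv[of a b] cm_inv[of b a] subgroup.m_inv_closed[OF W] b subgroup.mem_carrier[OF A that]
    by metis
  then have "{a\<in>A. cm b a \<in> W} = {a\<in>A. cm a b \<in> W}" by blast
  then show ?thesis using commutator_subgroup_left[OF W A WN b] by simp
qed

text \<open>Modulo the next term, the commutator is bilinear on \<open>A \<times> N\<close> and factors through the
  quotients by \<open>B\<close> and \<open>N1\<close>.\<close>

lemma good_level_Suc:
  assumes N: "N \<lhd> G" and A: "A \<lhd> G" "A \<subseteq> N" and B: "B \<lhd> G" "B \<subseteq> A" and C: "C \<lhd> G"
    and N1: "N1 = generate G {cm g h | g h. g \<in> N \<and> h \<in> N}"
    and B_def: "B = generate G {cm a g | a g. a \<in> A \<and> g \<in> N}"
    and C_in: "\<And>b g. b \<in> B \<Longrightarrow> g \<in> N \<Longrightarrow> cm b g \<in> C" and CB: "C \<subseteq> B"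
    and Xs: "Xs \<subseteq> carrier G" and good0: "good_level Xs N N1" and good: "good_level Xs A B"
  shows "good_level Xs B C"
  unfolding good_level_def
proof (intro allI impI)
  fix D assume D: "finite D \<and> D \<subseteq> B"
  have sN: "subgroup N G" and sA: "subgroup A G" and sB: "subgroup B G" and sC: "subgroup C G"
    using N A B C normal_imp_subgroup by blast+
  have Nc: "N \<subseteq> carrier G" using subgroup.subset[OF sN] .
  have Ac: "A \<subseteq> carrier G" using Nc A by blast
  have "finite D" and DS: "D \<subseteq> generate G {cm a g | a g. a \<in> A \<and> g \<in> N}" using D B_def by simp_all
  obtain P where P: "finite P" "P \<subseteq> {cm a g | a g. a \<in> A \<and> g \<in> N}" "D \<subseteq> generate G P"
    by (rule generate_finite_subsets[OF \<open>finite D\<close> DS])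
  have "\<forall>p\<in>P. \<exists>a g. a \<in> A \<and> g \<in> N \<and> p = cm a g" using P(2) by blast
  then obtain a g where ag: "\<And>p. p \<in> P \<Longrightarrow> a p \<in> A \<and> g p \<in> N \<and> p = cm (a p) (g p)" by metis
  obtain E1 where E1: "finite E1" "E1 \<subseteq> A" "a ` P \<subseteq> generate G (E1 \<union> B)"
    "\<And>x e. x \<in> Xs \<Longrightarrow> e \<in> E1 \<Longrightarrow> cj x e \<in> generate G (E1 \<union> B)"
    by (rule good_levelD[OF good, of "a ` P"]) (use P(1) ag in auto)
  obtain E0 where E0: "finite E0" "E0 \<subseteq> N" "g ` P \<subseteq> generate G (E0 \<union> N1)"
    "\<And>x e. x \<in> Xs \<Longrightarrow> e \<in> E0 \<Longrightarrow> cj x e \<in> generate G (E0 \<union> N1)"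
    by (rule good_levelD[OF good0, of "g ` P"]) (use P(1) ag in auto)
  \<comment> \<open>The image of a bilinear map on two finitely generated groups is generated by its
    values on pairs of generators.\<close>
  define E where "E = (\<lambda>(e, f). cm e f) ` (E1 \<times> E0)"
  have Efin: "finite E" using E1 E0 by (simp add: E_def)
  have cmB: "cm u v \<in> B" if "u \<in> A" "v \<in> N" for u v
    unfolding B_def using that by (intro generate.incl) blast
  have EB: "E \<subseteq> B"
  proof
    fix e assume "e \<in> E"
    then obtain u v where "u \<in> E1" "v \<in> E0" "e = cm u v" unfolding E_def by auto
    then show "e \<in> B" using cmB E1(2) E0(2) by blast
  qed
  have Bc: "B \<subseteq> carrier G" and Cc: "C \<subseteq> carrier G" using subgroup.subset[OF sB] subgroup.subset[OF sC] .
  define W where "W = generate G (E \<union> C)"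
  have ECc: "E \<union> C \<subseteq> carrier G" using EB Bc Cc by blast
  have sW: "subgroup W G" unfolding W_def by (rule generate_is_subgroup[OF ECc])
  have CW: "C \<subseteq> W" and EW: "E \<subseteq> W" unfolding W_def by (auto intro: generate.incl)
  have WB: "W \<subseteq> B" unfolding W_def using EB CB by (intro generate_subgroup_incl sB) blast
  \<comment> \<open>[W, N] \<subseteq> [B, N] \<subseteq> C \<subseteq> W, so \<open>N\<close>
    normalises \<open>W\<close> as \<open>commutator_subgroup_left\<close> requires.\<close>
  have cW: "cj n w \<in> W" if "n \<in> N" "w \<in> W" for n w
  proof -
    have c: "w \<in> carrier G" "n \<in> carrier G" using that Nc WB Bc by auto
    have "cm w n \<in> C" using C_in that WB by blast
    then have "cm n w \<in> C" using cm_inv[OF c] subgroup.m_inv_closed[OF sC] by force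
    moreover have "cj n w = cm n w \<otimes> w" by (rule cj_eq_cm[OF c(2,1)])
    ultimately show ?thesis using that CW subgroup.m_closed[OF sW] by auto
  qed
  have cWA: "cj n w \<in> W" if "n \<in> A" "w \<in> W" for n w using that cW A by blast
  \<comment> \<open>The pairing vanishes on \<open>N1\<close> modulo \<open>C\<close>: [u, g] and
    [u, h] lie in \<open>B\<close>, hence are central modulo \<open>C\<close> with respect to
    \<open>N\<close>.\<close>
  have N1C: "cm u v \<in> C" if u: "u \<in> A" and v: "v \<in> N1" for u v
  proof -
    have uc: "u \<in> carrier G" using u Ac by blast
    have "subgroup {n\<in>N. cm u n \<in> C} G"
      using commutator_subgroup_right[OF sC sN _ uc] normal_cj[OF C] Nc by blast
    moreover have "{cm g h | g h. g \<in> N \<and> h \<in> N} \<subseteq> {n\<in>N. cm u n \<in> C}"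
    proof clarify
      fix g h assume gh: "g \<in> N" "h \<in> N"
      have ghc: "g \<in> carrier G" "h \<in> carrier G" using gh Nc by auto
      have "cm g h \<in> N"
        using gh subgroup.m_closed[OF sN] subgroup.m_inv_closed[OF sN] by (simp add: cm_def)
      moreover have "cm u (cm g h) \<in> C"
      proof (rule commutator_of_central_mod[OF C uc ghc])
        have "cm u h \<in> N" using cmB[OF u gh(2)] A B by blast
        then show "cm (cm u g) w \<in> C" if "w \<in> {g, h, cm u h}" for w
          using that C_in[OF cmB[OF u gh(1)]] gh by blast
        show "cm (cm u h) w \<in> C" if "w \<in> {g, h}" for w
          using that C_in[OF cmB[OF u gh(2)]] gh by blast
      qed
      ultimately show "cm g h \<in> N \<and> cm u (cm g h) \<in> C" by blast
    qed
    ultimately have "N1 \<subseteq> {n\<in>N. cm u n \<in> C}" unfolding N1 by (intro generate_subgroup_incl)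
    then show ?thesis using v by blast
  qed
  \<comment> \<open>Bilinearity in use: first the right argument is extended from generators, then
    the left one. Applied to conjugates of generators, it gives stability of \<open>W\<close> under
    \<open>Xs\<close>.\<close>
  have sub: "cm u v \<in> W" if u: "u \<in> generate G (E1 \<union> B)" and v: "v \<in> generate G (E0 \<union> N1)" for u v
  proof -
    have E1W: "cm e v \<in> W" if e: "e \<in> E1" for e
    proof -
      have ec: "e \<in> carrier G" using e E1 Ac by blast
      have s: "subgroup {n\<in>N. cm e n \<in> W} G" by (rule commutator_subgroup_right[OF sW sN cW ec])
      have "N1 \<subseteq> N" unfolding N1
        using subgroup.m_closed[OF sN] subgroup.m_inv_closed[OF sN]
        by (intro generate_subgroup_incl sN) (auto simp: cm_def)
      moreover have "cm e n \<in> W" if "n \<in> E0" for n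
        using EW e that unfolding E_def by blast
      moreover have "cm e n \<in> W" if "n \<in> N1" for n
        using N1C[OF _ that] e E1(2) CW by blast
      ultimately have "E0 \<union> N1 \<subseteq> {n\<in>N. cm e n \<in> W}" using E0(2) by blast
      then have "generate G (E0 \<union> N1) \<subseteq> {n\<in>N. cm e n \<in> W}" by (intro generate_subgroup_incl s)
      then show ?thesis using v by blast
    qed
    have vN: "v \<in> N"
    proof -
      have "N1 \<subseteq> N" unfolding N1
        using subgroup.m_closed[OF sN] subgroup.m_inv_closed[OF sN]
        by (intro generate_subgroup_incl sN) (auto simp: cm_def)
      then have "generate G (E0 \<union> N1) \<subseteq> N" using E0(2) by (intro generate_subgroup_incl sN) blast
      then show ?thesis using v by blast
    qed
    have vc: "v \<in> carrier G" using vN Nc by blast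
    have s: "subgroup {a\<in>A. cm a v \<in> W} G" by (rule commutator_subgroup_left[OF sW sA cWA vc])
    have "E1 \<union> B \<subseteq> {a\<in>A. cm a v \<in> W}" using E1(2) B(2) E1W C_in vN CW by blast
    then have "generate G (E1 \<union> B) \<subseteq> {a\<in>A. cm a v \<in> W}" by (intro generate_subgroup_incl s)
    then show ?thesis using u by blast
  qed
  have "D \<subseteq> W"
  proof -
    have "P \<subseteq> W"
    proof
      fix p assume p: "p \<in> P"
      then have "cm (a p) (g p) \<in> W" using E1(3) E0(3) by (intro sub) auto
      then show "p \<in> W" using ag[OF p] by simp
    qed
    then have "generate G P \<subseteq> W" by (intro generate_subgroup_incl sW)
    then show ?thesis using P(3) by blast
  qed
  moreover have "cj x e \<in> W" if x: "x \<in> Xs" and e: "e \<in> E" for x e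
  proof -
    obtain u v where uv: "u \<in> E1" "v \<in> E0" "e = cm u v" using e by (auto simp: E_def)
    have "cj x e = cm (cj x u) (cj x v)"
      unfolding uv(3) using x uv Xs E1(2) E0(2) Ac Nc by (intro cj_cm) auto
    then show ?thesis using sub[OF E1(4)[OF x uv(1)] E0(4)[OF x uv(2)]] by simp
  qed
  ultimately show "\<exists>E. finite E \<and> E \<subseteq> B \<and> D \<subseteq> generate G (E \<union> C) \<and>
      (\<forall>x\<in>Xs. \<forall>e\<in>E. cj x e \<in> generate G (E \<union> C))"
    using Efin EB unfolding W_def by blast
qed

end

section \<open>Integral automorphisms\<close>

lemma (in comm_group) subgroup_finprod_closed:
  assumes "subgroup S G" "\<And>i. i \<in> I \<Longrightarrow> f i \<in> S"
  shows "finprod G f I \<in> S"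
  using assms(2)
proof (induction I rule: infinite_finite_induct)
  case (insert i I)
  then have "f \<in> insert i I \<rightarrow> carrier G" using subgroup.subset[OF assms(1)] by blast
  then have "finprod G f (insert i I) = f i \<otimes> finprod G f I"
    using insert.hyps by (intro finprod_insert) auto
  then show ?case using insert subgroup.m_closed[OF assms(1)] by simp
qed (use subgroup.one_closed[OF assms(1)] in auto)

context group
begin

lemma cj_pow_Suc: "x \<in> carrier G \<Longrightarrow> g \<in> carrier G \<Longrightarrow> cj (x [^] Suc i) g = cj x (cj (x [^] (i::nat)) g)"
  unfolding nat_pow_Suc2 by (rule cj_cj) auto

text \<open>Conjugations by two elements of \<open>Xs\<close> commute on N/N1, because their
  commutator lies in \<open>N\<close>, which acts trivially there. So a set stable under the other
  elements stays so after adding its conjugates by x^i with i < m, and integrality makes the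
  enlarged set stable under \<open>x\<close>.\<close>

lemma good_level_zero:
  assumes N: "N \<lhd> G" and N1: "N1 \<lhd> G" "N1 \<subseteq> N"
    and comm: "\<And>g h. g \<in> carrier G \<Longrightarrow> h \<in> carrier G \<Longrightarrow> cm g h \<in> N"
    and NN: "\<And>m n. m \<in> N \<Longrightarrow> n \<in> N \<Longrightarrow> cm m n \<in> N1"
    and "finite Xs" "Xs \<subseteq> carrier G"
    and "\<And>x. x \<in> Xs \<Longrightarrow> \<exists>m>0. \<forall>n\<in>N. cj (x [^] (m::nat)) n \<in> generate G ((\<lambda>i. cj (x [^] i) n) ` {..<m} \<union> N1)"
  shows "good_level Xs N N1"
  using assms(6-)
proof (induction Xs rule: finite_induct)
  case empty
  show ?case unfolding good_level_def
  proof (intro allI impI)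
    fix D assume "finite D \<and> D \<subseteq> N"
    moreover have "D \<subseteq> generate G (D \<union> N1)" by (auto intro: generate.incl)
    ultimately show "\<exists>E. finite E \<and> E \<subseteq> N \<and> D \<subseteq> generate G (E \<union> N1) \<and>
        (\<forall>x\<in>{}. \<forall>e\<in>E. cj x e \<in> generate G (E \<union> N1))" by blast
  qed
next
  case (insert x Xs)
  have sN: "subgroup N G" and sN1: "subgroup N1 G" using N N1 normal_imp_subgroup by blast+
  have Nc: "N \<subseteq> carrier G" and N1c: "N1 \<subseteq> carrier G" using subgroup.subset[OF sN] subgroup.subset[OF sN1] .
  have x: "x \<in> carrier G" and Xsc: "Xs \<subseteq> carrier G" using insert.prems(1) by auto
  have IH: "good_level Xs N N1" using insert.IH[OF Xsc] insert.prems(2) by blast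
  obtain m where m01: "(0::nat) < m \<and> (\<forall>n\<in>N. cj (x [^] m) n \<in> generate G ((\<lambda>i. cj (x [^] i) n) ` {..<m} \<union> N1))"
    using insert.prems(2)[OF insertI1] by (rule exE)
  then have m: "m > 0"
    "\<And>n. n \<in> N \<Longrightarrow> cj (x [^] m) n \<in> generate G ((\<lambda>i. cj (x [^] i) n) ` {..<m} \<union> N1)" by meson+
  show ?case unfolding good_level_def
  proof (intro allI impI)
    fix D assume D: "finite D \<and> D \<subseteq> N"
    then have D1: "finite D" and D2: "D \<subseteq> N" by simp_all
    obtain E where E: "finite E" "E \<subseteq> N" "D \<subseteq> generate G (E \<union> N1)"
      "\<And>x e. x \<in> Xs \<Longrightarrow> e \<in> E \<Longrightarrow> cj x e \<in> generate G (E \<union> N1)"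
      using good_levelD[OF IH D1 D2] by metis
    \<comment> \<open>As m > 0, the exponent 0 occurs, so \<open>E\<close> itself is
      covered.\<close>
    define F where "F = (\<lambda>(i, e). cj (x [^] i) e) ` ({..<m} \<times> E)"
    have FN: "F \<subseteq> N" unfolding F_def using normal_cj[OF N] x E(2) by auto
    have EN1c: "E \<union> N1 \<subseteq> carrier G" and FN1c: "F \<union> N1 \<subseteq> carrier G" using E(2) FN Nc N1c by auto
    let ?W = "generate G (F \<union> N1)"
    have sW: "subgroup ?W G" by (rule generate_is_subgroup[OF FN1c])
    have N1W: "n \<in> ?W" if "n \<in> N1" for n using that by (intro generate.incl) simp
    have FW: "cj (x [^] i) e \<in> ?W" if "i < m" "e \<in> E" for i e
    proof (rule generate.incl)
      show "cj (x [^] i) e \<in> F \<union> N1" unfolding F_def using that by (intro UnI1 image_eqI[of _ _ "(i, e)"]) auto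
    qed
    have cEW: "cj (x [^] i) g \<in> ?W" if i: "i < m" and g: "g \<in> generate G (E \<union> N1)" for i g
    proof (rule cj_generate[OF _ EN1c sW _ g])
      show "x [^] i \<in> carrier G" using x by simp
      fix s assume "s \<in> E \<union> N1"
      then show "cj (x [^] i) s \<in> ?W"
        using FW[OF i, of s] N1W normal_cj[OF N1(1)] x by auto
    qed
    have EW: "g \<in> ?W" if g: "g \<in> generate G (E \<union> N1)" for g
      using cEW[OF m(1) g] generate_in_carrier[OF EN1c g] by (simp add: cj_one_left)
    have "cj y f \<in> ?W" if y: "y \<in> insert x Xs" and f: "f \<in> F" for y f
    proof -
      obtain i e where ie: "i < m" "e \<in> E" "f = cj (x [^] i) e" using f by (auto simp: F_def)
      have e: "e \<in> N" "e \<in> carrier G" using ie E(2) Nc by auto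
      show ?thesis
      proof (cases "y = x")
        case True
        have eq: "cj y f = cj (x [^] Suc i) e" using True ie e x by (simp only: cj_pow_Suc)
        show ?thesis
        proof (cases "Suc i < m")
          case True
          then show ?thesis unfolding eq by (rule FW[OF _ ie(2)])
        next
          case False
          then have "Suc i = m" using ie by simp
          then have "cj y f \<in> generate G ((\<lambda>i. cj (x [^] i) e) ` {..<m} \<union> N1)"
            unfolding eq using m(2)[OF e(1)] by simp
          moreover have "generate G ((\<lambda>i. cj (x [^] i) e) ` {..<m} \<union> N1) \<subseteq> ?W"
            using FW ie(2) N1W by (intro generate_subgroup_incl sW) blast
          ultimately show ?thesis by blast
        qed
      next
        case False
        then have y: "y \<in> Xs" using y by simp
        have yc: "y \<in> carrier G" "x [^] i \<in> carrier G" using y Xsc x by auto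
        \<comment> \<open>From y x^i = c x^i y with c in \<open>N\<close>: conjugating by
          \<open>y\<close> before or after x^i differs by conjugation with \<open>c\<close>, whose
          effect on \<open>w\<close> is a factor in \<open>N1\<close>.\<close>
        define c where "c = cm y (x [^] i)"
        have c: "c \<in> N" "c \<in> carrier G" using comm[OF yc] Nc by (auto simp: c_def)
        define w where "w = cj (x [^] i) (cj y e)"
        have wW: "w \<in> ?W" unfolding w_def by (rule cEW[OF ie(1) E(4)[OF y ie(2)]])
        have wN: "w \<in> N" unfolding w_def using normal_cj[OF N] yc e by simp
        then have wc: "w \<in> carrier G" using Nc by blast
        have "cj y f = cj (y \<otimes> x [^] i) e" using ie(3) yc e by (simp add: cj_cj)
        also have "y \<otimes> x [^] i = c \<otimes> (x [^] i \<otimes> y)" using yc by (simp add: c_def cm_def word_simps)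
        also have "cj (c \<otimes> (x [^] i \<otimes> y)) e = cj c w" using yc c e by (simp add: cj_cj w_def)
        also have "\<dots> = cm c w \<otimes> w" by (rule cj_eq_cm[OF c(2) wc])
        also have "\<dots> \<in> ?W" using N1W[OF NN[OF c(1) wN]] wW by (rule generate.eng)
        finally show ?thesis .
      qed
    qed
    moreover have "D \<subseteq> ?W" using EW E(3) by blast
    moreover have "finite F" unfolding F_def using E(1) by simp
    ultimately show "\<exists>E. finite E \<and> E \<subseteq> N \<and> D \<subseteq> generate G (E \<union> N1) \<and>
        (\<forall>x\<in>insert x Xs. \<forall>e\<in>E. cj x e \<in> generate G (E \<union> N1))"
      using FN by (intro exI[of _ F]) simp
  qed
qed

lemma conj_induced_coset:
  assumes L: "L \<lhd> G" and x: "x \<in> carrier G" and n: "n \<in> carrier G"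
  shows "conj_induced G x (L #> n) = L #> cj x n"
proof (intro equalityI subsetI)
  have Lc: "L \<subseteq> carrier G" by (rule subgroup.subset[OF normal_imp_subgroup[OF L]])
  fix z
  {
    assume "z \<in> conj_induced G x (L #> n)"
    then obtain k where k: "k \<in> L" "z = cj x (k \<otimes> n)" by (auto simp: conj_induced_def r_coset_def cj_def)
    then have "z = cj x k \<otimes> cj x n" using x n Lc by (auto simp: cj_mult)
    then show "z \<in> L #> cj x n" using normal_cj[OF L x k(1)] by (auto simp: r_coset_def)
  next
    assume "z \<in> L #> cj x n"
    then obtain k where k: "k \<in> L" "z = k \<otimes> cj x n" by (auto simp: r_coset_def)
    have kc: "k \<in> carrier G" using k Lc by blast
    have "z = cj x (cj (inv x) k \<otimes> n)" using k(2) kc x n by (simp add: cj_def word_simps)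
    moreover have "cj (inv x) k \<in> L" using normal_cj[OF L _ k(1)] x by simp
    ultimately show "z \<in> conj_induced G x (L #> n)"
      by (auto simp: conj_induced_def r_coset_def cj_def)
  }
qed

text \<open>As the relation is monic, it expresses the m-th iterate through the lower ones. The
  coefficients are forgotten, keeping only membership in the subgroup those generate modulo the
  derived subgroup.\<close>

lemma integral_conj:
  assumes N: "N \<lhd> G" and x: "x \<in> carrier G"
    and int: "integral_endomorphism (abelianization (G\<lparr>carrier := N\<rparr>)) (conj_induced G x)"
  shows "\<exists>m>0. \<forall>n\<in>N. cj (x [^] (m::nat)) n \<in>
    generate G ((\<lambda>i. cj (x [^] i) n) ` {..<m} \<union> derived G N)"
proof -
  let ?GN = "G\<lparr>carrier := N\<rparr>"
  let ?N1 = "derived G N"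
  let ?A = "?GN Mod ?N1"
  let ?\<alpha> = "conj_induced G x"
  have sN: "subgroup N G" by (rule normal_imp_subgroup[OF N])
  have Nc: "N \<subseteq> carrier G" by (rule subgroup.subset[OF sN])
  have N1: "?N1 \<lhd> G" by (rule derived_is_normal[OF N])
  have N1N: "?N1 \<subseteq> N" by (rule derived_incl[OF order_refl sN])
  have ab: "abelianization ?GN = ?A"
    unfolding abelianization_def using derived_consistent[OF order_refl sN] by simp
  interpret A: comm_group ?A by (rule derived_quot_of_subgroup_is_comm_group[OF sN])
  interpret GN: group ?GN by (rule subgroup_imp_group[OF sN])
  have N1GN: "?N1 \<lhd> ?GN" by (rule derived_subgroup_is_normal[OF sN])
  interpret \<pi>: group_hom ?GN ?A "\<lambda>n. ?N1 #> n"
  proof (intro group_hom.intro group_hom_axioms.intro GN.is_group A.is_group)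
    show "(\<lambda>n. ?N1 #> n) \<in> hom ?GN ?A" using normal.r_coset_hom_Mod[OF N1GN] by simp
  qed
  obtain m b where m: "m > (0::nat)" and b: "\<And>a. a \<in> carrier ?A \<Longrightarrow>
      (?\<alpha> ^^ m) a \<otimes>\<^bsub>?A\<^esub> finprod ?A (\<lambda>i. (?\<alpha> ^^ i) a [^]\<^bsub>?A\<^esub> (b i :: int)) {..<m} = \<one>\<^bsub>?A\<^esub>"
    using int unfolding integral_endomorphism_def ab by blast
  show ?thesis
  proof (intro exI[of _ m] conjI m ballI)
    fix n assume n: "n \<in> N"
    then have nc: "n \<in> carrier G" using Nc by blast
    let ?E = "(\<lambda>i. cj (x [^] i) n) ` {..<m}"
    let ?W = "generate G (?E \<union> ?N1)"
    have cN: "cj (x [^] (i::nat)) n \<in> N" for i using normal_cj[OF N _ n] x by simp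
    have EN: "?E \<union> ?N1 \<subseteq> N" using cN N1N by auto
    have sW: "subgroup ?W G" using EN Nc by (intro generate_is_subgroup) blast
    have WN: "?W \<subseteq> N" by (rule generate_subgroup_incl[OF EN sN])
    have sWN: "subgroup ?W ?GN" by (rule subgroup_incl[OF sW sN WN])
    let ?S = "(\<lambda>n. ?N1 #> n) ` ?W"
    have sS: "subgroup ?S ?A" by (rule \<pi>.subgroup_img_is_subgroup[OF sWN])
    have \<alpha>: "(?\<alpha> ^^ i) (?N1 #> n) = ?N1 #> cj (x [^] i) n" for i
    proof (induction i)
      case (Suc i)
      have "(?\<alpha> ^^ Suc i) (?N1 #> n) = ?\<alpha> (?N1 #> cj (x [^] i) n)" using Suc by simp
      also have "\<dots> = ?N1 #> cj (x [^] Suc i) n"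
        unfolding cj_pow_Suc[OF x nc] using x nc by (intro conj_induced_coset[OF N1]) auto
      finally show ?case .
    qed (use nc in \<open>simp add: cj_one_left\<close>)
    have aA: "?N1 #> k \<in> carrier ?A" if "k \<in> N" for k using \<pi>.hom_closed[of k] that by simp
    let ?P = "finprod ?A (\<lambda>i. (?\<alpha> ^^ i) (?N1 #> n) [^]\<^bsub>?A\<^esub> (b i :: int)) {..<m}"
    have PS: "?P \<in> ?S"
    proof (rule A.subgroup_finprod_closed[OF sS])
      fix i assume "i \<in> {..<m}"
      then have "cj (x [^] i) n \<in> ?W" by (intro generate.incl) blast
      then have "?N1 #> cj (x [^] i) n \<in> ?S" by blast
      then show "(?\<alpha> ^^ i) (?N1 #> n) [^]\<^bsub>?A\<^esub> b i \<in> ?S"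
        unfolding \<alpha> by (rule A.subgroup_int_pow_closed[OF sS])
    qed
    have PA: "?P \<in> carrier ?A" using PS subgroup.subset[OF sS] by blast
    \<comment> \<open>The relation says that the top iterate is the inverse of the product
      \<open>?P\<close>, which lies in the subgroup \<open>?S\<close>.\<close>
    have inv: "(?N1 #> cj (x [^] m) n) \<otimes>\<^bsub>?A\<^esub> ?P = \<one>\<^bsub>?A\<^esub>"
      using b[OF aA[OF n]] unfolding \<alpha>[of m] .
    have "?N1 #> cj (x [^] m) n \<in> ?S"
      using subgroup.m_inv_closed[OF sS PS] unfolding A.inv_equality[OF inv PA aA[OF cN]] .
    then obtain w where w: "w \<in> ?W" "?N1 #> cj (x [^] m) n = ?N1 #> w" by blast
    have "cj (x [^] m) n \<in> ?N1 #> cj (x [^] m) n"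
      using cN Nc by (intro rcos_self normal_imp_subgroup[OF N1]) blast
    then have "cj (x [^] m) n \<in> ?N1 #> w" by (simp only: w(2))
    then obtain k where k: "k \<in> ?N1" "cj (x [^] m) n = k \<otimes> w" by (auto simp: r_coset_def)
    have "k \<in> ?W" using k(1) by (intro generate.incl) blast
    then show "cj (x [^] m) n \<in> ?W" unfolding k(2) using w(1) by (rule generate.eng)
  qed
qed

section \<open>Assembly along the lower central series\<close>

lemma lower_central_Suc_eq:
  assumes "subgroup N G" "lower_central (G\<lparr>carrier := N\<rparr>) i \<subseteq> N"
  shows "lower_central (G\<lparr>carrier := N\<rparr>) (Suc i) =
    generate G {cm h g | h g. h \<in> lower_central (G\<lparr>carrier := N\<rparr>) i \<and> g \<in> N}"
proof -
  let ?GN = "G\<lparr>carrier := N\<rparr>"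
  let ?L = "lower_central ?GN i"
  have "h \<otimes>\<^bsub>?GN\<^esub> g \<otimes>\<^bsub>?GN\<^esub> inv\<^bsub>?GN\<^esub> h \<otimes>\<^bsub>?GN\<^esub> inv\<^bsub>?GN\<^esub> g = cm h g"
    if "h \<in> ?L" "g \<in> N" for h g
    using m_inv_consistent[OF assms(1)] subsetD[OF assms(2)] that by (simp add: cm_def)
  then have "(\<Union>h\<in>?L. \<Union>g\<in>carrier ?GN. {h \<otimes>\<^bsub>?GN\<^esub> g \<otimes>\<^bsub>?GN\<^esub> inv\<^bsub>?GN\<^esub> h \<otimes>\<^bsub>?GN\<^esub> inv\<^bsub>?GN\<^esub> g}) =
      (\<Union>h\<in>?L. \<Union>g\<in>N. {cm h g})" by simp
  also have "\<dots> = {cm h g | h g. h \<in> ?L \<and> g \<in> N}" by blast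
  finally have "(\<Union>h\<in>?L. \<Union>g\<in>carrier ?GN. {h \<otimes>\<^bsub>?GN\<^esub> g \<otimes>\<^bsub>?GN\<^esub> inv\<^bsub>?GN\<^esub> h \<otimes>\<^bsub>?GN\<^esub> inv\<^bsub>?GN\<^esub> g}) =
      {cm h g | h g. h \<in> ?L \<and> g \<in> N}" .
  moreover have "{cm h g | h g. h \<in> ?L \<and> g \<in> N} \<subseteq> N"
  proof clarify
    fix h g assume "h \<in> ?L" "g \<in> N"
    then show "cm h g \<in> N"
      using subsetD[OF assms(2)] subgroup.m_closed[OF assms(1)] subgroup.m_inv_closed[OF assms(1)]
      by (simp add: cm_def)
  qed
  ultimately show ?thesis
    using generate_consistent[OF _ assms(1)] by simp
qed

lemma generate_cm_normal:
  assumes A: "A \<lhd> G" and N: "N \<lhd> G"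
  shows "generate G {cm h g | h g. h \<in> A \<and> g \<in> N} \<lhd> G"
    "generate G {cm h g | h g. h \<in> A \<and> g \<in> N} \<subseteq> A"
proof -
  have sA: "subgroup A G" and sN: "subgroup N G" using A N normal_imp_subgroup by blast+
  have c: "A \<subseteq> carrier G" "N \<subseteq> carrier G" using subgroup.subset[OF sA] subgroup.subset[OF sN] .
  let ?S = "{cm h g | h g. h \<in> A \<and> g \<in> N}"
  have Sc: "?S \<subseteq> carrier G" using subsetD[OF c(1)] subsetD[OF c(2)] by auto
  show "generate G ?S \<lhd> G"
  proof (rule normal_generateI[OF Sc])
    fix s x assume "s \<in> ?S" and x: "x \<in> carrier G"
    then obtain h g where hg: "h \<in> A" "g \<in> N" "s = cm h g" by blast
    have "cj x s = cm (cj x h) (cj x g)" unfolding hg(3) using x hg c by (intro cj_cm) auto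
    then have "cj x s \<in> ?S" using normal_cj[OF A x hg(1)] normal_cj[OF N x hg(2)] by blast
    then show "x \<otimes> s \<otimes> inv x \<in> ?S" by (simp only: cj_def)
  qed
  show "generate G ?S \<subseteq> A"
  proof (intro generate_subgroup_incl sA subsetI)
    fix s assume "s \<in> ?S"
    then obtain h g where hg: "h \<in> A" "g \<in> N" "s = cm h g" by blast
    have hgc: "h \<in> carrier G" "g \<in> carrier G" using hg c by auto
    have "s = h \<otimes> cj g (inv h)" unfolding hg(3) using hgc by (simp add: cm_def cj_def m_assoc)
    then show "s \<in> A"
      using hg hgc normal_cj[OF A] subgroup.m_closed[OF sA] subgroup.m_inv_closed[OF sA] by simp
  qed
qed

theorem locally_tower:
  assumes N: "N \<lhd> G" and nil: "nilpotent_group (G\<lparr>carrier := N\<rparr>)" and ab: "comm_group (G Mod N)"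
    and Xs: "finite Xs" "Xs \<subseteq> carrier G" and gen: "carrier G = generate G (N \<union> Xs)"
    and int: "\<And>x. x \<in> Xs \<Longrightarrow> integral_endomorphism (abelianization (G\<lparr>carrier := N\<rparr>)) (conj_induced G x)"
    and A: "finite A" "A \<subseteq> carrier G"
  shows "\<exists>H. tower H \<and> A \<subseteq> H"
proof -
  let ?L = "lower_central (G\<lparr>carrier := N\<rparr>)"
  have sN: "subgroup N G" by (rule normal_imp_subgroup[OF N])
  have Nc: "N \<subseteq> carrier G" by (rule subgroup.subset[OF sN])
  have L0: "?L 0 = N" by simp
  have L: "?L i \<lhd> G \<and> ?L i \<subseteq> N" for i
  proof (induction i)
    case (Suc i)
    then have LN: "?L i \<subseteq> N" and Ln: "?L i \<lhd> G" by blast+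
    show ?case unfolding lower_central_Suc_eq[OF sN LN]
      using generate_cm_normal[OF Ln N] LN by blast
  qed (use N in simp)
  have LS: "?L (Suc i) = generate G {cm h g | h g. h \<in> ?L i \<and> g \<in> N}" for i
    using lower_central_Suc_eq[OF sN] L by blast
  have desc: "?L (Suc i) \<subseteq> ?L i" for i
    unfolding LS using generate_cm_normal[OF _ N] L by blast
  have comm: "cm h n \<in> ?L (Suc i)" if "h \<in> ?L i" "n \<in> N" for h n i
    unfolding LS using that by (intro generate.incl) blast
  have "cm g h \<in> N" if "g \<in> carrier G" "h \<in> carrier G" for g h
  proof -
    have "cm g h \<in> derived G (carrier G)"
      unfolding derived_def cm_def using that by (intro generate.incl) blast
    then show ?thesis using derived_minimal[OF N ab] by blast
  qed
  note GN = this
  have der: "derived G N = ?L 1"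
  proof -
    have "derived_set G N = {cm h g | h g. h \<in> ?L 0 \<and> g \<in> N}" unfolding cm_def by auto
    then show ?thesis unfolding derived_def One_nat_def LS by simp
  qed
  have good0: "good_level Xs N (?L (Suc 0))"
  proof (rule good_level_zero[OF N _ _ GN _ Xs])
    show "?L (Suc 0) \<lhd> G" "?L (Suc 0) \<subseteq> N" using L by blast+
    show "cm m n \<in> ?L (Suc 0)" if "m \<in> N" "n \<in> N" for m n using comm[of m 0 n] that by simp
    show "\<exists>m>0. \<forall>n\<in>N. cj (x [^] (m::nat)) n \<in> generate G ((\<lambda>i. cj (x [^] i) n) ` {..<m} \<union> ?L (Suc 0))"
      if "x \<in> Xs" for x
      using integral_conj[OF N _ int[OF that]] subsetD[OF Xs(2) that] unfolding der One_nat_def by blast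
  qed
  \<comment> \<open>Induction along the series by the commutator pairing of L_i / L_(i+1) with N /
    L_1 into L_(i+1) / L_(i+2).\<close>
  have good: "good_level Xs (?L i) (?L (Suc i))" for i
  proof (induction i)
    case 0
    show ?case unfolding L0 by (rule good0)
  next
    case (Suc i)
    have L1: "?L (Suc 0) = generate G {cm g h |g h. g \<in> N \<and> h \<in> N}" using LS[of 0] by simp
    show ?case
      by (rule good_level_Suc[OF N _ _ _ desc _ L1 LS comm desc Xs(2) good0 Suc]) (use L in blast)+
  qed
  obtain c where c: "?L c = {\<one>}" using nil unfolding nilpotent_group_def by auto
  have AG: "A \<subseteq> generate G (N \<union> Xs)" using A(2) gen by simp
  obtain F' where F': "finite F'" "F' \<subseteq> N \<union> Xs" "A \<subseteq> generate G F'"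
    by (rule generate_finite_subsets[OF A(1) AG])
  define F where "F = F' \<inter> N"
  \<comment> \<open>The commutators of \<open>Xs\<close> lie in \<open>N\<close> because G/N is
    abelian; having them in \<open>K\<close> allows \<open>tower_extend\<close> to adjoin
    \<open>Xs\<close> at the end.\<close>
  let ?D = "F \<union> (\<lambda>(x, y). cm x y) ` (Xs \<times> Xs)"
  have "finite ?D" using F'(1) Xs(1) by (simp add: F_def)
  moreover have "?D \<subseteq> ?L 0" using GN subsetD[OF Xs(2)] by (auto simp: F_def)
  moreover have "?L (0 + c) = {\<one>}" using c by simp
  ultimately have "\<exists>K. tower K \<and> ?D \<subseteq> K \<and> K \<subseteq> ?L 0 \<and> (\<forall>y\<in>Xs. \<forall>k\<in>K. cj y k \<in> K)"
    using L desc comm good Xs by (intro tower_cover[where L = ?L and k = c]) auto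
  then obtain K where K: "tower K" "?D \<subseteq> K" "\<forall>y\<in>Xs. \<forall>k\<in>K. cj y k \<in> K" by blast
  have "cm x y \<in> K" if "x \<in> Xs" "y \<in> Xs" for x y
  proof -
    have "cm x y \<in> (\<lambda>(x, y). cm x y) ` (Xs \<times> Xs)" using that by (intro image_eqI[of _ _ "(x, y)"]) auto
    then show ?thesis using K(2) by blast
  qed
  then have "tower (generate G (K \<union> Xs))" using K(3) by (intro tower_extend K(1) Xs) auto
  moreover have "A \<subseteq> generate G (K \<union> Xs)"
  proof -
    have "F' \<subseteq> K \<union> Xs" using F'(2) K(2) by (auto simp: F_def)
    then show ?thesis using F'(3) mono_generate[of F' "K \<union> Xs"] by blast
  qed
  ultimately show ?thesis by blast
qed

end

lemma (in group) tower_FP_group: "tower M \<Longrightarrow> FP_group M"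
proof (induction rule: tower.induct)
  case (tower_step M x)
  then show ?case by (intro FP_group_HNN tower_subgroup)
qed (rule FP_group_one)

theorem theoremC:
  fixes G :: "('a, 'b) monoid_scheme" and N Xs :: "'a set"
  assumes "group G"
    and "N \<lhd> G"
    and "nilpotent_group (G\<lparr>carrier := N\<rparr>)"
    and "hirsch_length (G\<lparr>carrier := N\<rparr>) < \<infinity>"
    and "finitely_generated_group (G Mod N)"
    and "comm_group (G Mod N)"
    and "finite Xs" and "Xs \<subseteq> carrier G"
    and "carrier G = generate G (N \<union> Xs)"
    and "\<And>x. x \<in> Xs \<Longrightarrow>
           integral_endomorphism (abelianization (G\<lparr>carrier := N\<rparr>)) (conj_induced G x)"
  shows "locally_FP_inf G"
proof -
  interpret group G by fact
  show ?thesis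
    unfolding locally_FP_inf_def
  proof (intro allI impI)
    fix A assume A: "finite A \<and> A \<subseteq> carrier G"
    have "\<exists>H. tower H \<and> A \<subseteq> H"
      using A by (intro locally_tower[OF assms(2,3,6-10)]) auto
    then obtain H where H: "tower H" "A \<subseteq> H" by blast
    have "subgroup H G" by (rule tower_subgroup[OF H(1)])
    moreover have "type_FP_inf (G\<lparr>carrier := H\<rparr>)"
      using FP_imp_type_FP_inf[OF tower_subgroup[OF H(1)]] tower_FP_group[OF H(1)]
      unfolding FP_group_def by blast
    ultimately show "\<exists>H. subgroup H G \<and> A \<subseteq> H \<and> type_FP_inf (G\<lparr>carrier := H\<rparr>)"
      using H(2) by blast
  qed
qed

end
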